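(* Let $V,V'$ be Hilbert spaces dual to each other, $U$ a Hilbert space, and let $A,B,g_0,h_0,\omega,p$ satisfy hypotheses 1–7 listed in the context (in particular $p\ge 2$). Assume $\lambda>2\omega$. Let $x\in V'$, $t\ge 0$ and $t<T<+\infty$. Then a couple $(u^*,y^* )\in L^p_\lambda(t,T;U)\times L^1_{loc}(t,T;V')$ is optimal at $(t,x)$ for the problem of minimizing $$J_T(t,x,u)=\int_t^{T}e^{-\lambda\tau}\left[g_0(y(\tau;t,x,u))+h_0(u(\tau))\right]d\tau$$ over $u\in L^p_\lambda(t,T;U)$ if and only if it is extremal.
   Context: **Spaces and notation.** $V$ and $V'$ are Hilbert spaces, dual to each other but not identified, with duality pairing $\langle\cdot,\cdot\rangle$; $V'$ is the state space. $U$ is a Hilbert space (the control space), identified with its dual, with scalar product $(\cdot|\cdot)_U$. For a Banach space $X$, $C^1_{Lip}(X)$ is the set of $f\in C^1(X)$ (Fréchet sense, real valued) whose derivative $f'$ is Lipschitz continuous; $\mathcal B_r(X)$ is the set of $f:X\to\mathbb R$ with $\sup_{x\in X}\frac{|f(x)|}{1+|x|_X^r}<+\infty$; and $\Sigma_0(X)=\{w\in\mathcal B_2(X): w \text{ is convex},\ w\in C^1_{Lip}(X)\}$. For $g_0\in\Sigma_0(V')$ the derivative $g_0'$ is a map $V'\to V$. For $h_0:U\to\mathbb R\cup\{+\infty\}$ the convex conjugate is $h_0^*(v)=\sup_{u\in U}\{(u|v)_U-h_0(u)\}$, and $\partial h_0(u)=\{v\in U: h_0(w)\ge h_0(u)+(v|w-u)_U\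 \forall w\in U\}$ is the subdifferential. **Hypotheses 1–7.** 1. $A:D(A)\subset V'\to V'$ generates a strongly continuous semigroup $\{e^{\tau A}\}_{\tau\ge0}$ on $V'$. 2. $B\in L(U,V')$ (bounded linear). 3. There is $\omega\ge0$ with $|e^{\tau A}x|_{V'}\le e^{\omega\tau}|x|_{V'}$ for all $\tau\ge0$, $x\in V'$. 4. $g_0\in\Sigma_0(V')$. 5. $h_0$ is convex, lower semicontinuous, and $\partial h_0$ is injective (i.e. $\partial h_0(u_1)\cap\partial h_0(u_2)=\emptyset$ for $u_1\ne u_2$). 6. $h_0^*(0)=0$ and $h_0^*\in\Sigma_0(U)$. 7. There are $a>0$, $b\in\mathbb R$, $p\ge2$ with $h_0(u)\ge a|u|_U^p+b$ for all $u\in U$. $q$ is the conjugate exponent of $p$, $\frac1p+\frac1q=1$. For $r\ge 1$ and a Hilbert space $X$, $L^r_\lambda(t,T;X)$ is the space of $f:[t,T)\to X$ such that $\tau\mapsto f(\tau)e^{-\lambda\tau/r}$ is in $L^r(t,T;X)$. **State equation.** For $u\in L^p_\lambda(t,T;U)$, the trajectory starting at $x$ at time $t$ is the mild solution of $y'=Ay+Bu$, $y(t)=x$: $$y(\tau;t,x,u)=e^{(\tau-t)A}x+\int_t^\tau e^{(\tau-\sigma)A}Bu(\sigma)\,d\sigma .$$ A couple $(u^*,y^* )$ is optimal at $(t,x)$ if $u^*$ minimizes $J_T(t,x,\cdot)$ over $L^p_\lambda(t,T;U)$ and $y^*=y(\cdot;t,x,u^* )$. **Adjoint objects.** $B^*\in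 L(V,U)$ is defined by $(B^*v|u)_U=\langle v,Bu\rangle$. $\{e^{sA_0^*}\}_{s\ge0}$ denotes the strongly continuous semigroup on $V$ adjoint to $\{e^{sA}\}_{s\ge 0}$, i.e. $\langle e^{sA_0^*}v,x\rangle=\langle v,e^{sA}x\rangle$, and $e^{(A_0^*-\lambda)s}=e^{-\lambda s}e^{sA_0^*}$. **Extremal couples ($T<+\infty$).** A couple $(u,y)\in L^p_\lambda(t,T;U)\times L^1_{loc}(t,T;V')$ is extremal (at $(t,x)$) if there is $\pi\in L^q_\lambda(t,T;V)$ such that the following hold, the differential equations being understood in mild sense: - $y'(\tau)=Ay(\tau)+Bu(\tau)$ for $\tau\in[t,T)$, $y(t)=x$, i.e. $y=y(\cdot;t,x,u)$; - $\pi'(\tau)=(\lambda-A_0^* )\pi(\tau)-g_0'(y(\tau))$ for $\tau\in[t,T)$, $\pi(T)=0$, i.e. $\pi(\tau)=\int_\tau^T e^{(A_0^*-\lambda)(\sigma-\tau)}g_0'(y(\sigma))\,d\sigma$; - $-B^*\pi(\tau)\in\partial h_0(u(\tau))$ for almost every $\tau\in[t,T)$. *)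

theory Defs
  imports "HOL-Analysis.Analysis"
begin

text \<open>
  Hilbert spaces are types of sort \<open>{real_inner, complete_space}\<close>; they are not assumed to be
  separable.
\<close>

subsection \<open>Duality\<close>

text \<open>
  \<open>pr v w\<close> is the value of the pairing of \<open>v\<close> in \<open>V\<close> with \<open>w\<close> in \<open>V'\<close>. Each of the two spaces is,
  through \<open>pr\<close>, isometrically the whole dual of the other.
\<close>
definition dual_pairing ::
    "('v::real_normed_vector \<Rightarrow> 'w::real_normed_vector \<Rightarrow> real) \<Rightarrow> bool" where
  "dual_pairing pr \<longleftrightarrow>
     bounded_bilinear pr
   \<and> (\<forall>v. onorm (pr v) = norm v)
   \<and> (\<forall>\<phi>. bounded_linear \<phi> \<longrightarrow> (\<exists>v. pr v = \<phi>))
   \<and> (\<forall>w. onorm (\<lambda>v. pr v w) = norm w)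
   \<and> (\<forall>\<psi>. bounded_linear \<psi> \<longrightarrow> (\<exists>w. (\<lambda>v. pr v w) = \<psi>))"

text \<open>The adjoint on \<open>V\<close> of an operator on \<open>V'\<close>.\<close>
definition pairing_adjoint ::
    "('v \<Rightarrow> 'w \<Rightarrow> real) \<Rightarrow> ('w::real_normed_vector \<Rightarrow>\<^sub>L 'w) \<Rightarrow> 'v \<Rightarrow> 'v" where
  "pairing_adjoint pr L v = (THE z. \<forall>x. pr z x = pr v (blinfun_apply L x))"

text \<open>The adjoint of an operator from \<open>U\<close> (identified with its dual) to \<open>V'\<close>.\<close>
definition control_adjoint ::
    "('v \<Rightarrow> 'w \<Rightarrow> real) \<Rightarrow> ('u::real_inner \<Rightarrow>\<^sub>L 'w::real_normed_vector) \<Rightarrow> 'v \<Rightarrow> 'u" where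
  "control_adjoint pr B v = (THE z. \<forall>u. z \<bullet> u = pr v (blinfun_apply B u))"

text \<open>The Frechet derivative of a function on \<open>V'\<close>, as an element of \<open>V\<close>.\<close>
definition pairing_deriv ::
    "('v \<Rightarrow> 'w::real_normed_vector \<Rightarrow> real) \<Rightarrow> ('w \<Rightarrow> real) \<Rightarrow> 'w \<Rightarrow> 'v" where
  "pairing_deriv pr g x = (THE v. (g has_derivative pr v) (at x))"

subsection \<open>Semigroups\<close>

definition C0_semigroup :: "(real \<Rightarrow> 'w::real_normed_vector \<Rightarrow>\<^sub>L 'w) \<Rightarrow> bool" where
  "C0_semigroup S \<longleftrightarrow>
     S 0 = id_blinfun
   \<and> (\<forall>s\<ge>0. \<forall>r\<ge>0. S (s + r) = S s o\<^sub>L S r)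
   \<and> (\<forall>x. ((\<lambda>s. blinfun_apply (S s) x) \<longlongrightarrow> x) (at_right 0))"

text \<open>\<open>A\<close> with domain \<open>D\<close> generates \<open>S\<close>; the values of \<open>A\<close> outside \<open>D\<close> are irrelevant.\<close>
definition generates_semigroup ::
    "'w set \<Rightarrow> ('w \<Rightarrow> 'w) \<Rightarrow> (real \<Rightarrow> 'w::real_normed_vector \<Rightarrow>\<^sub>L 'w) \<Rightarrow> bool" where
  "generates_semigroup D A S \<longleftrightarrow>
     C0_semigroup S
   \<and> D = {x. \<exists>y. ((\<lambda>s. (blinfun_apply (S s) x - x) /\<^sub>R s) \<longlongrightarrow> y) (at_right 0)}
   \<and> (\<forall>x\<in>D. ((\<lambda>s. (blinfun_apply (S s) x - x) /\<^sub>R s) \<longlongrightarrow> A x) (at_right 0))"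

subsection \<open>Function classes\<close>

definition C1_Lip :: "('a::real_normed_vector \<Rightarrow> real) set" where
  "C1_Lip = {f. \<exists>f' :: 'a \<Rightarrow> 'a \<Rightarrow>\<^sub>L real.
      (\<forall>x. (f has_derivative blinfun_apply (f' x)) (at x)) \<and> (\<exists>L. L-lipschitz_on UNIV f')}"

definition growth_class :: "real \<Rightarrow> ('a::real_normed_vector \<Rightarrow> real) set" where
  "growth_class r = {f. bdd_above (range (\<lambda>x. \<bar>f x\<bar> / (1 + norm x powr r)))}"

definition Sigma0 :: "('a::real_normed_vector \<Rightarrow> real) set" where
  "Sigma0 = {w \<in> growth_class 2. convex_on UNIV w \<and> w \<in> C1_Lip}"

subsection \<open>Convex functions with values in the extended reals\<close>

definition convex_ereal :: "('u::real_vector \<Rightarrow> ereal) \<Rightarrow> bool" where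
  "convex_ereal h \<longleftrightarrow> (\<forall>u w \<theta>::real. 0 < \<theta> \<and> \<theta> < 1 \<longrightarrow>
     h (\<theta> *\<^sub>R u + (1 - \<theta>) *\<^sub>R w) \<le> ereal \<theta> * h u + ereal (1 - \<theta>) * h w)"

definition lower_semicontinuous :: "('u::topological_space \<Rightarrow> ereal) \<Rightarrow> bool" where
  "lower_semicontinuous h \<longleftrightarrow> (\<forall>u. h u \<le> Liminf (at u) h)"

definition subdifferential :: "('u::real_inner \<Rightarrow> ereal) \<Rightarrow> 'u \<Rightarrow> 'u set" where
  "subdifferential h u = {v. \<forall>w. h w \<ge> h u + ereal (v \<bullet> (w - u))}"

definition convex_conjugate :: "('u::real_inner \<Rightarrow> ereal) \<Rightarrow> 'u \<Rightarrow> ereal" where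
  "convex_conjugate h v = (SUP u. ereal (u \<bullet> v) - h u)"

subsection \<open>Lebesgue spaces of vector valued functions\<close>

text \<open>
  Strong (Bochner) measurability. It is spelled out because the library's Bochner theory is
  restricted to second countable, that is, separable target spaces.
\<close>
definition strongly_measurable :: "'a measure \<Rightarrow> ('a \<Rightarrow> 'b::topological_space) \<Rightarrow> bool" where
  "strongly_measurable M f \<longleftrightarrow>
     (\<exists>s. (\<forall>i::nat. simple_function M (s i)) \<and> (AE x in M. (\<lambda>i. s i x) \<longlonglongrightarrow> f x))"

definition Lspace :: "real \<Rightarrow> real set \<Rightarrow> (real \<Rightarrow> 'b::real_normed_vector) set" where
  "Lspace r I = {f. strongly_measurable (lebesgue_on I) f
                  \<and> (\<integral>\<^sup>+\<tau>. ennreal (norm (f \<tau>) powr r) \<partial>lebesgue_on I) < \<infinity>}"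

definition Lspace_weighted ::
    "real \<Rightarrow> real \<Rightarrow> real \<Rightarrow> real \<Rightarrow> (real \<Rightarrow> 'b::real_normed_vector) set" where
  "Lspace_weighted r lam t T = {f. (\<lambda>\<tau>. exp (- lam * \<tau> / r) *\<^sub>R f \<tau>) \<in> Lspace r {t..<T}}"

definition L1_loc :: "real \<Rightarrow> real \<Rightarrow> (real \<Rightarrow> 'b::real_normed_vector) set" where
  "L1_loc t T = {f. \<forall>K. compact K \<and> K \<subseteq> {t<..<T} \<longrightarrow> f \<in> Lspace 1 K}"

text \<open>The Lebesgue integral of an extended real function as the difference of the integrals of
  its positive and negative parts (\<open>e2ennreal\<close> sends negative numbers to 0).\<close>
definition ereal_integral :: "'a measure \<Rightarrow> ('a \<Rightarrow> ereal) \<Rightarrow> ereal" where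
  "ereal_integral M f =
     enn2ereal (\<integral>\<^sup>+x. e2ennreal (f x) \<partial>M) - enn2ereal (\<integral>\<^sup>+x. e2ennreal (- f x) \<partial>M)"

subsection \<open>The control problem\<close>

text \<open>
  Vector valued integrals are written with the library's gauge integral \<open>integral\<close>, which needs
  no separability. All integrands below are Bochner integrable, and for these the two integrals
  coincide.
\<close>
definition trajectory ::
    "(real \<Rightarrow> 'w::real_normed_vector \<Rightarrow>\<^sub>L 'w) \<Rightarrow> ('u::real_normed_vector \<Rightarrow>\<^sub>L 'w) \<Rightarrow>
     real \<Rightarrow> 'w \<Rightarrow> (real \<Rightarrow> 'u) \<Rightarrow> real \<Rightarrow> 'w" where
  "trajectory S B t x u \<tau> =
     blinfun_apply (S (\<tau> - t)) x
     + integral {t..\<tau>} (\<lambda>\<sigma>. blinfun_apply (S (\<tau> - \<sigma>)) (blinfun_apply B (u \<sigma>)))"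

definition cost ::
    "(real \<Rightarrow> 'w::real_normed_vector \<Rightarrow>\<^sub>L 'w) \<Rightarrow> ('u::real_normed_vector \<Rightarrow>\<^sub>L 'w) \<Rightarrow>
     ('w \<Rightarrow> real) \<Rightarrow> ('u \<Rightarrow> ereal) \<Rightarrow> real \<Rightarrow> real \<Rightarrow> real \<Rightarrow> 'w \<Rightarrow> (real \<Rightarrow> 'u) \<Rightarrow> ereal" where
  "cost S B g0 h0 lam T t x u =
     ereal_integral (lebesgue_on {t..<T})
       (\<lambda>\<tau>. ereal (exp (- lam * \<tau>)) * (ereal (g0 (trajectory S B t x u \<tau>)) + h0 (u \<tau>)))"

definition optimal_couple ::
    "(real \<Rightarrow> 'w::real_normed_vector \<Rightarrow>\<^sub>L 'w) \<Rightarrow> ('u::real_normed_vector \<Rightarrow>\<^sub>L 'w) \<Rightarrow>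
     ('w \<Rightarrow> real) \<Rightarrow> ('u \<Rightarrow> ereal) \<Rightarrow> real \<Rightarrow> real \<Rightarrow> real \<Rightarrow> real \<Rightarrow> 'w \<Rightarrow>
     (real \<Rightarrow> 'u) \<Rightarrow> (real \<Rightarrow> 'w) \<Rightarrow> bool" where
  "optimal_couple S B g0 h0 lam p T t x u y \<longleftrightarrow>
     u \<in> Lspace_weighted p lam t T
   \<and> (\<forall>w \<in> Lspace_weighted p lam t T. cost S B g0 h0 lam T t x u \<le> cost S B g0 h0 lam T t x w)
   \<and> (\<forall>\<tau>\<in>{t..<T}. y \<tau> = trajectory S B t x u \<tau>)"

text \<open>The costate equation is required on all of \<open>[t, T]\<close>, so that it contains the terminal
  condition \<open>\<pi>(T) = 0\<close>.\<close>
definition extremal_couple ::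
    "('v::real_normed_vector \<Rightarrow> 'w::real_normed_vector \<Rightarrow> real) \<Rightarrow>
     (real \<Rightarrow> 'w \<Rightarrow>\<^sub>L 'w) \<Rightarrow> ('u::real_inner \<Rightarrow>\<^sub>L 'w) \<Rightarrow>
     ('w \<Rightarrow> real) \<Rightarrow> ('u \<Rightarrow> ereal) \<Rightarrow> real \<Rightarrow> real \<Rightarrow> real \<Rightarrow> real \<Rightarrow> real \<Rightarrow> 'w \<Rightarrow>
     (real \<Rightarrow> 'u) \<Rightarrow> (real \<Rightarrow> 'w) \<Rightarrow> bool" where
  "extremal_couple pr S B g0 h0 lam p q T t x u y \<longleftrightarrow>
     u \<in> Lspace_weighted p lam t T \<and> y \<in> L1_loc t T
   \<and> (\<exists>\<pi> \<in> Lspace_weighted q lam t T.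
        (\<forall>\<tau>\<in>{t..<T}. y \<tau> = trajectory S B t x u \<tau>)
      \<and> (\<forall>\<tau>\<in>{t..T}. \<pi> \<tau> = integral {\<tau>..T}
           (\<lambda>\<sigma>. exp (- lam * (\<sigma> - \<tau>)) *\<^sub>R
                 pairing_adjoint pr (S (\<sigma> - \<tau>)) (pairing_deriv pr g0 (y \<sigma>))))
      \<and> (AE \<tau> in lebesgue_on {t..<T}. - control_adjoint pr B (\<pi> \<tau>) \<in> subdifferential h0 (u \<tau>)))"

end

theory Submission
  imports Defs
begin

text \<open>
  The state depends affinely on the control and the cost is convex in state and control, so a control
  is optimal exactly when the first variation of the cost is nonnegative in all directions. The
  costate \<open>\<pi>\<close> turns the variation of the state cost into an expression in the control alone: if \<open>y\<close> is
  the trajectory of \<open>u\<close> and \<open>z\<close> is the response of the state to the variation \<open>d\<close> of the control, then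
  Fubini's theorem on the triangle \<open>t \<le> \<sigma> \<le> \<tau> \<le> T\<close> gives (lemma \<open>response_costate_duality\<close>)

  \<open>\<integral> exp (- \<lambda> \<tau>) \<langle>g0' (y \<tau>), z \<tau>\<rangle> d\<tau> = \<integral> exp (- \<lambda> \<sigma>) (B* \<pi> \<sigma> | d \<sigma>) d\<sigma>\<close>.

  Extremal couples are optimal. For a competitor \<open>w\<close> and \<open>d = w - u\<close>, convexity of \<open>g0\<close> and the inclusion
  \<open>- B* \<pi> \<in> \<partial>h0 (u)\<close> bound the running cost of \<open>u\<close> pointwise by that of \<open>w\<close> plus two error terms, and these
  have opposite integrals by the duality formula (lemma \<open>subdifferential_imp_cost_le\<close>).

  Optimal couples are extremal. Write \<open>v = - B* \<pi>\<close> and let \<open>k\<close> be the conjugate of \<open>h0\<close>. Since \<open>k\<close> is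
  differentiable with Lipschitz derivative, every maximizing sequence in
  \<open>k (v) = sup {(u | v) - h0 (u)}\<close> is Cauchy, so that by lower semicontinuity the supremum is attained at
  a point \<open>G (v)\<close>, and \<open>G\<close> is Lipschitz (lemma \<open>conjugate_gradient\<close>). Hence \<open>G (v \<tau>)\<close> is a continuous
  control. Moving from \<open>u\<close> a fraction \<open>\<theta>\<close> of the way towards it changes the cost by at most \<open>\<theta>\<close> times the
  first variation plus a multiple of \<open>\<theta>\<^sup>2\<close>. Optimality therefore yields
  \<open>\<integral> exp (- \<lambda> \<tau>) (h0 (u \<tau>) - (u \<tau> | v \<tau>) + k (v \<tau>)) d\<tau> \<le> 0\<close>. The integrand is nonnegative by the
  definition of the conjugate, so it vanishes almost everywhere, and this equality case of the Fenchel
  inequality says that \<open>v \<in> \<partial>h0 (u)\<close> (lemma \<open>optimal_imp_subdifferential\<close>).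

  The remaining work is to give the integrals a meaning in spaces that need not be separable. A
  strongly measurable function with integrable norm is gauge integrable
  (\<open>bochner_integrable_imp_integrable_on\<close>), and its integral is then handled through bounded linear
  functionals. For the costate one needs moreover that the adjoint semigroup is strongly continuous;
  this holds because it is weakly continuous on a Hilbert space (\<open>adjoint_semigroup_continuous_at_0\<close>).
\<close>

section \<open>Projection and representation in a Hilbert space\<close>

text \<open>By the parallelogram law a minimizing sequence for the distance from \<open>v\<close> to the subspace
  is Cauchy; its limit is the foot of the perpendicular.\<close>

lemma closed_subspace_perpendicular_foot:
  fixes M :: "'a::{real_inner, complete_space} set"
  assumes sub: "subspace M" and cl: "closed M"
  obtains m where "m \<in> M" "\<And>z. z \<in> M \<Longrightarrow> inner (v - m) z = 0"
proof -
  have ne: "M \<noteq> {}" using sub subspace_0 by blast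
  define d where "d = (INF z\<in>M. (norm (v - z))\<^sup>2)"
  have bdd: "bdd_below ((\<lambda>z. (norm (v - z))\<^sup>2) ` M)" by (rule bdd_belowI2[of _ 0]) simp
  have dle: "d \<le> (norm (v - z))\<^sup>2" if "z \<in> M" for z
    unfolding d_def by (rule cINF_lower[OF bdd that])
  have "\<exists>z\<in>M. (norm (v - z))\<^sup>2 < d + inverse (Suc n)" for n
  proof -
    have "(INF z\<in>M. (norm (v - z))\<^sup>2) < d + inverse (Suc n)"
      unfolding d_def[symmetric] by simp
    then show ?thesis using cINF_less_iff[OF ne bdd] by blast
  qed
  then obtain s where sM: "\<And>n::nat. s n \<in> M"
    and s: "\<And>n. (norm (v - s n))\<^sup>2 < d + inverse (Suc n)" by metis
  have par: "(norm (s i - s j))\<^sup>2 \<le> 2 * inverse (Suc i) + 2 * inverse (Suc j)" for i j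
  proof -
    define c where "c = (1/2) *\<^sub>R (s i + s j)"
    have "c \<in> M" unfolding c_def using sub sM by (simp add: subspace_add subspace_scale)
    have "(norm (s i - s j))\<^sup>2 = 2 * (norm (v - s i))\<^sup>2 + 2 * (norm (v - s j))\<^sup>2 - 4 * (norm (v - c))\<^sup>2"
      unfolding c_def power2_norm_eq_inner
      by (simp add: inner_diff inner_add inner_commute algebra_simps)
    with dle[OF \<open>c \<in> M\<close>] s[of i] s[of j] show ?thesis by linarith
  qed
  \<comment> \<open>the parallelogram law \<open>par\<close> is the Cauchy estimate\<close>
  have "Cauchy s"
  proof (rule metric_CauchyI)
    fix e :: real assume e: "e > 0"
    obtain N where N: "inverse (real (Suc N)) < e\<^sup>2 / 4" using reals_Archimedean[of "e\<^sup>2/4"] e by auto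
    have "dist (s i) (s j) < e" if "i \<ge> N" "j \<ge> N" for i j
    proof -
      have "inverse (real (Suc i)) \<le> inverse (real (Suc N))" "inverse (real (Suc j)) \<le> inverse (real (Suc N))"
        using that by (auto intro!: le_imp_inverse_le)
      with par[of i j] N have "(norm (s i - s j))\<^sup>2 < e\<^sup>2" by linarith
      then show ?thesis using e by (simp add: dist_norm power2_less_imp_less)
    qed
    then show "\<exists>N. \<forall>i\<ge>N. \<forall>j\<ge>N. dist (s i) (s j) < e" by blast
  qed
  then obtain m where m: "s \<longlonglongrightarrow> m" using Cauchy_convergent convergent_def by blast
  have mM: "m \<in> M" using closed_sequentially[OF cl] sM m by blast
  have "(\<lambda>n. (norm (v - s n))\<^sup>2) \<longlonglongrightarrow> (norm (v - m))\<^sup>2" using m by (intro tendsto_intros)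
  moreover have "(\<lambda>n. d + inverse (real (Suc n))) \<longlonglongrightarrow> d + 0"
    by (intro tendsto_intros LIMSEQ_inverse_real_of_nat)
  ultimately have min: "(norm (v - m))\<^sup>2 \<le> d"
    using s by (intro LIMSEQ_le[where Y="\<lambda>n. d + inverse (real (Suc n))"]) (auto intro: less_imp_le)
  have "inner (v - m) z = 0" if "z \<in> M" for z
  proof (cases "z = 0")
    case False
    define r where "r = inner (v - m) z / inner z z"
    have "m + r *\<^sub>R z \<in> M" using mM that sub by (simp add: subspace_add subspace_scale)
    then have "(norm (v - m))\<^sup>2 \<le> (norm (v - (m + r *\<^sub>R z)))\<^sup>2" using min dle order_trans by blast
    also have "\<dots> = (norm (v - m))\<^sup>2 - 2 * r * inner (v - m) z + r\<^sup>2 * inner z z"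
      unfolding power2_norm_eq_inner
      by (simp add: inner_diff inner_add inner_commute power2_eq_square algebra_simps)
    also have "\<dots> = (norm (v - m))\<^sup>2 - (inner (v - m) z)\<^sup>2 / inner z z"
      using False by (simp add: r_def power2_eq_square field_simps)
    finally have "(inner (v - m) z)\<^sup>2 / inner z z \<le> 0" by simp
    moreover have "inner z z > 0" using False by simp
    ultimately show ?thesis by (simp add: divide_le_0_iff)
  qed simp
  with mM that show ?thesis by blast
qed

theorem riesz_representation:
  fixes \<phi> :: "'a::{real_inner, complete_space} \<Rightarrow> real"
  assumes \<phi>: "bounded_linear \<phi>"
  shows "\<exists>!z. \<forall>x. inner z x = \<phi> x"
proof -
  interpret bounded_linear \<phi> by fact
  have ex: "\<exists>z. \<forall>x. inner z x = \<phi> x"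
  proof (cases "\<forall>x. \<phi> x = 0")
    case True then show ?thesis by (intro exI[of _ 0]) simp
  next
    case False
    then obtain v where v: "\<phi> v \<noteq> 0" by blast
    define M where "M = {x. \<phi> x = 0}"
    have "subspace M" unfolding M_def subspace_def by (simp add: add scaleR)
    moreover have "closed M" unfolding M_def
      by (intro closed_Collect_eq continuous_intros linear_continuous_on \<phi>)
    ultimately obtain m where m: "m \<in> M" "\<And>z. z \<in> M \<Longrightarrow> inner (v - m) z = 0"
      by (rule closed_subspace_perpendicular_foot[where v=v]) blast
    define n where "n = v - m"
    have pn: "\<phi> n = \<phi> v" using m(1) by (simp add: n_def diff M_def)
    then have "n \<noteq> 0" using v zero by auto
    have "inner ((\<phi> n / inner n n) *\<^sub>R n) x = \<phi> x" for x
    proof -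
      have "x - (\<phi> x / \<phi> n) *\<^sub>R n \<in> M" using pn v by (simp add: M_def diff scaleR)
      then have "inner n (x - (\<phi> x / \<phi> n) *\<^sub>R n) = 0" using m(2) n_def by blast
      then have "inner n x = (\<phi> x / \<phi> n) * inner n n" by (simp add: inner_diff_right)
      then show ?thesis using \<open>n \<noteq> 0\<close> pn v by simp
    qed
    then show ?thesis by blast
  qed
  have "z = z'" if "\<forall>x. inner z x = \<phi> x" "\<forall>x. inner z' x = \<phi> x" for z z'
    using that by (metis vector_eq_rdot)
  with ex show ?thesis by blast
qed

section \<open>Strongly measurable functions and their integrals\<close>

lemma complete_measure_lebesgue_on:
  assumes "S \<in> sets lebesgue"
  shows "complete_measure (lebesgue_on S)"
proof
  fix A B :: "'a set" assume "B \<subseteq> A" "A \<in> null_sets (lebesgue_on S)"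
  then have "B \<in> null_sets (lebesgue_on S)"
    using null_sets_restrict_space[OF assms] completion.complete2 by blast
  then show "B \<in> sets (lebesgue_on S)" by blast
qed

lemma finite_measure_lebesgue_on_interval: "finite_measure (lebesgue_on {a..b::real})"
proof (rule finite_measureI)
  have "emeasure lborel {a..b} \<noteq> \<infinity>" by (cases "a \<le> b") auto
  then show "emeasure (lebesgue_on {a..b}) (space (lebesgue_on {a..b})) \<noteq> \<infinity>"
    by (simp add: emeasure_restrict_space)
qed

lemma (in complete_measure) borel_measurable_AE_eq:
  fixes f g :: "'a \<Rightarrow> 'b::topological_space"
  assumes f: "f \<in> borel_measurable M" and eq: "AE x in M. f x = g x"
  shows "g \<in> borel_measurable M"
proof (rule measurableI)
  fix A :: "'b set" assume A: "A \<in> sets borel"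
  define N where "N = {x \<in> space M. f x \<noteq> g x}"
  have N: "N \<in> null_sets M" using eq unfolding AE_iff_null_sets N_def by simp
  have "g -` A \<inter> space M = (f -` A \<inter> space M - N) \<union> (g -` A \<inter> N)"
    unfolding N_def by auto
  moreover have "f -` A \<inter> space M \<in> sets M" using f A by (rule measurable_sets)
  moreover have "g -` A \<inter> N \<in> null_sets M" by (rule complete2[OF _ N]) auto
  ultimately show "g -` A \<inter> space M \<in> sets M" using N by (metis null_setsD2 sets.Diff sets.Un)
qed simp

text \<open>On the null set where the simple functions fail to converge to \<open>f\<close> they are replaced by zero, which
  turns convergence almost everywhere into convergence everywhere. The last clause keeps the norm of
  the modified function below that of \<open>f\<close>.\<close>

lemma (in complete_measure) strongly_measurable_everywhere:
  fixes f :: "'a \<Rightarrow> 'b::real_normed_vector"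
  assumes "strongly_measurable M f"
  obtains s f' where "\<And>i. simple_function M (s i)" "\<And>x. x \<in> space M \<Longrightarrow> (\<lambda>i. s i x) \<longlonglongrightarrow> f' x"
    "AE x in M. f' x = f x" "\<And>x. f' x \<in> {0, f x}"
proof -
  obtain s where s: "\<And>i::nat. simple_function M (s i)" and lim: "AE x in M. (\<lambda>i. s i x) \<longlonglongrightarrow> f x"
    using assms unfolding strongly_measurable_def by blast
  define N where "N = {x \<in> space M. \<not> (\<lambda>i. s i x) \<longlonglongrightarrow> f x}"
  have N: "N \<in> null_sets M" using lim unfolding AE_iff_null_sets N_def by simp
  have [measurable]: "N \<in> sets M" using N by blast
  define s' where "s' i x = (if x \<in> N then 0 else s i x)" for i x
  define f' where "f' x = (if x \<in> N then 0 else f x)" for x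
  have "simple_function M (s' i)" for i
    unfolding s'_def using s[of i] \<open>N \<in> sets M\<close> by (intro simple_function_If_set) auto
  moreover have "(\<lambda>i. s' i x) \<longlonglongrightarrow> f' x" if "x \<in> space M" for x
    using that by (auto simp: s'_def f'_def N_def)
  moreover have "AE x in M. f' x = f x"
    using AE_not_in[OF N] by eventually_elim (simp add: f'_def)
  ultimately show ?thesis using that[of s' f'] by (auto simp: f'_def)
qed

lemma (in complete_measure) strongly_measurable_imp_borel:
  fixes f :: "'a \<Rightarrow> 'b::real_normed_vector"
  assumes "strongly_measurable M f"
  shows "f \<in> borel_measurable M"
proof -
  obtain s f' where s: "\<And>i. simple_function M (s i)"
    and lim: "\<And>x. x \<in> space M \<Longrightarrow> (\<lambda>i. s i x) \<longlonglongrightarrow> f' x" and ae: "AE x in M. f' x = f x"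
    by (rule strongly_measurable_everywhere[OF assms]) blast
  have "f' \<in> borel_measurable M"
    by (rule borel_measurable_LIMSEQ_metric[OF _ lim]) (auto intro: borel_measurable_simple_function s)
  then show ?thesis using ae by (rule borel_measurable_AE_eq)
qed

lemma strongly_measurable_diff:
  fixes f g :: "'a \<Rightarrow> 'b::real_normed_vector"
  assumes "strongly_measurable M f" "strongly_measurable M g"
  shows "strongly_measurable M (\<lambda>x. f x - g x)"
proof -
  obtain s r where sr: "\<And>i::nat. simple_function M (s i)" "\<And>i::nat. simple_function M (r i)"
    and lim: "AE x in M. (\<lambda>i. s i x) \<longlonglongrightarrow> f x" "AE x in M. (\<lambda>i. r i x) \<longlonglongrightarrow> g x"
    using assms unfolding strongly_measurable_def by blast
  have "AE x in M. (\<lambda>i. s i x - r i x) \<longlonglongrightarrow> f x - g x"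
    using lim by eventually_elim (rule tendsto_diff)
  moreover have "simple_function M (\<lambda>x. s i x - r i x)" for i
    using sr by (rule simple_function_compose2[where h="(-)"])
  ultimately show ?thesis unfolding strongly_measurable_def
    by (intro exI[of _ "\<lambda>i x. s i x - r i x"]) blast
qed

lemma strongly_measurable_simple_function:
  "simple_function M s \<Longrightarrow> strongly_measurable M s"
  unfolding strongly_measurable_def by (intro exI[of _ "\<lambda>_. s"]) auto

text \<open>Null sets may be added to the domain, because the approximating functions can be extended by zero.\<close>

lemma strongly_measurable_restrict:
  fixes f :: "real \<Rightarrow> 'b::real_normed_vector"
  assumes f: "strongly_measurable (lebesgue_on S) f" and S: "S \<in> sets lebesgue" "T \<in> sets lebesgue"
    and sub: "negligible (T - S)"
  shows "strongly_measurable (lebesgue_on T) f"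
proof -
  obtain s where s: "\<And>i::nat. simple_function (lebesgue_on S) (s i)"
    and lim: "AE x in lebesgue_on S. (\<lambda>i. s i x) \<longlonglongrightarrow> f x"
    using f unfolding strongly_measurable_def by blast
  define r where "r i x = (if x \<in> S then s i x else 0)" for i x
  have "simple_function (lebesgue_on T) (r i)" for i
    unfolding simple_function_def
  proof safe
    have "r i ` T \<subseteq> s i ` S \<union> {0}" unfolding r_def by auto
    moreover have "finite (s i ` S)" using simple_functionD(1)[OF s[of i]] by simp
    ultimately show "finite (r i ` space (lebesgue_on T))" by (simp add: finite_subset)
    fix x
    have "s i -` {r i x} \<inter> S \<in> sets lebesgue"
      using simple_functionD(2)[OF s[of i], of "{r i x}"] S by (simp add: sets_restrict_space_iff)
    then have "s i -` {r i x} \<inter> S \<inter> T \<in> sets lebesgue" using S(2) by (rule sets.Int)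
    moreover have "(if r i x = 0 then T - S else {}) \<in> sets lebesgue" using S by auto
    moreover have "r i -` {r i x} \<inter> T =
      (s i -` {r i x} \<inter> S) \<inter> T \<union> (if r i x = 0 then T - S else {})"
      unfolding r_def by (auto split: if_splits)
    ultimately have "r i -` {r i x} \<inter> T \<in> sets lebesgue" by (simp only: sets.Un)
    then show "r i -` {r i x} \<inter> space (lebesgue_on T) \<in> sets (lebesgue_on T)"
      using S(2) by (simp add: sets_restrict_space_iff)
  qed
  moreover have "AE x in lebesgue_on T. (\<lambda>i. r i x) \<longlonglongrightarrow> f x"
  proof -
    have "AE x in lebesgue. x \<in> S \<longrightarrow> (\<lambda>i. s i x) \<longlonglongrightarrow> f x"
      using lim S(1) by (simp add: AE_restrict_space_iff)
    moreover have "AE x in lebesgue. x \<notin> T - S"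
      using sub unfolding negligible_iff_null_sets by (rule AE_not_in)
    ultimately have "AE x in lebesgue. x \<in> T \<longrightarrow> (\<lambda>i. r i x) \<longlonglongrightarrow> f x"
      by eventually_elim (auto simp: r_def)
    then show ?thesis using S(2) by (simp add: AE_restrict_space_iff)
  qed
  ultimately show ?thesis unfolding strongly_measurable_def by blast
qed

text \<open>A strongly continuous operator-valued function is in general not continuous in operator norm, but
  joint continuity in time and argument is enough here: the time is rounded down to a grid of width
  \<open>1 / (i + 1)\<close> while the argument is replaced by the \<open>i\<close>-th simple function. Both then take finitely
  many values, so the composition is simple.\<close>

lemma strongly_measurable_continuous_compose:
  fixes f :: "real \<Rightarrow> 'b::real_normed_vector" and F :: "real \<Rightarrow> 'b \<Rightarrow> 'c::real_normed_vector"
  assumes F: "continuous_on ({a..b} \<times> UNIV) (\<lambda>(\<sigma>, z). F \<sigma> z)"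
    and f: "strongly_measurable (lebesgue_on {a..b}) f"
  shows "strongly_measurable (lebesgue_on {a..b}) (\<lambda>\<sigma>. F \<sigma> (f \<sigma>))"
proof -
  obtain s where s: "\<And>i::nat. simple_function (lebesgue_on {a..b}) (s i)"
    and lim: "AE x in lebesgue_on {a..b}. (\<lambda>i. s i x) \<longlonglongrightarrow> f x"
    using f unfolding strongly_measurable_def by blast
  define k where "k i \<sigma> = nat \<lfloor>real (Suc i) * (\<sigma> - a)\<rfloor>" for i and \<sigma> :: real
  define g where "g i \<sigma> = a + real (k i \<sigma>) / real (Suc i)" for i \<sigma>
  have g: "g i \<sigma> \<in> {a..b}" "\<bar>g i \<sigma> - \<sigma>\<bar> \<le> inverse (real (Suc i))" if "\<sigma> \<in> {a..b}" for i \<sigma>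
  proof -
    define m where "m = real (Suc i)"
    have m: "m > 0" by (simp add: m_def)
    have k: "real (k i \<sigma>) = of_int \<lfloor>m * (\<sigma> - a)\<rfloor>" using that by (simp add: k_def m_def)
    have "real (k i \<sigma>) \<le> m * (\<sigma> - a)" "m * (\<sigma> - a) \<le> real (k i \<sigma>) + 1" unfolding k by linarith+
    then have 1: "real (k i \<sigma>) / m \<le> \<sigma> - a" "\<sigma> - a \<le> real (k i \<sigma>) / m + inverse m"
      using m by (simp_all add: field_simps)
    have "0 \<le> real (k i \<sigma>) / m" using m by simp
    with 1 that show "g i \<sigma> \<in> {a..b}" "\<bar>g i \<sigma> - \<sigma>\<bar> \<le> inverse (real (Suc i))"
      unfolding g_def m_def[symmetric] using 1 by auto
  qed
  have gs: "simple_function (lebesgue_on {a..b}) (g i)" for i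
  proof -
    have "k i \<sigma> \<le> nat \<lfloor>real (Suc i) * (b - a)\<rfloor>" if "\<sigma> \<in> {a..b}" for \<sigma>
      unfolding k_def using that by (intro nat_mono floor_mono mult_left_mono) auto
    then have "k i ` {a..b} \<subseteq> {..nat \<lfloor>real (Suc i) * (b - a)\<rfloor>}" by auto
    then have "finite (k i ` {a..b})" using finite_subset by blast
    then have "finite ((\<lambda>k. a + real k / real (Suc i)) ` (k i ` {a..b}))" by (rule finite_imageI)
    then have "finite (g i ` {a..b})" by (simp add: g_def image_image)
    moreover have "g i \<in> borel_measurable borel" unfolding g_def k_def by measurable
    then have "g i \<in> borel_measurable (lebesgue_on {a..b})"
      by (intro measurable_restrict_space1 measurable_completion) simp
    ultimately show ?thesis by (simp add: simple_function_iff_borel_measurable)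
  qed
  have "simple_function (lebesgue_on {a..b}) (\<lambda>\<sigma>. F (g i \<sigma>) (s i \<sigma>))" for i
    by (rule simple_function_compose2[where h=F, OF gs s])
  moreover have "AE \<sigma> in lebesgue_on {a..b}. (\<lambda>i. F (g i \<sigma>) (s i \<sigma>)) \<longlonglongrightarrow> F \<sigma> (f \<sigma>)"
    using lim AE_space
  proof eventually_elim
    case (elim \<sigma>)
    then have \<sigma>: "\<sigma> \<in> {a..b}" by simp
    have "(\<lambda>i. g i \<sigma> - \<sigma>) \<longlonglongrightarrow> 0"
      by (rule Lim_null_comparison[OF _ LIMSEQ_inverse_real_of_nat]) (use g(2)[OF \<sigma>] in auto)
    then have "(\<lambda>i. g i \<sigma>) \<longlonglongrightarrow> \<sigma>" by (simp add: LIM_zero_iff)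
    then have "(\<lambda>i. (g i \<sigma>, s i \<sigma>)) \<longlonglongrightarrow> (\<sigma>, f \<sigma>)" using elim by (intro tendsto_Pair)
    then have "(\<lambda>i. (\<lambda>(\<sigma>, z). F \<sigma> z) (g i \<sigma>, s i \<sigma>)) \<longlonglongrightarrow> (\<lambda>(\<sigma>, z). F \<sigma> z) (\<sigma>, f \<sigma>)"
      by (rule continuous_on_tendsto_compose[OF F]) (use g(1)[OF \<sigma>] \<sigma> in auto)
    then show ?case by simp
  qed
  ultimately show ?thesis unfolding strongly_measurable_def
    by (intro exI[of _ "\<lambda>i \<sigma>. F (g i \<sigma>) (s i \<sigma>)"]) blast
qed

lemma strongly_measurable_continuous:
  fixes f :: "real \<Rightarrow> 'c::real_normed_vector"
  assumes "continuous_on {a..b} f"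
  shows "strongly_measurable (lebesgue_on {a..b}) f"
proof -
  have "continuous_on ({a..b} \<times> (UNIV::real set)) (\<lambda>(\<sigma>, z). f \<sigma>)"
    unfolding case_prod_beta by (rule continuous_on_compose2[OF assms]) (auto intro: continuous_intros)
  then show ?thesis
    by (rule strongly_measurable_continuous_compose[where f="\<lambda>_. 0::real"])
       (simp add: strongly_measurable_simple_function)
qed

definition bochner_integrable :: "'a measure \<Rightarrow> ('a \<Rightarrow> 'b::real_normed_vector) \<Rightarrow> bool" where
  "bochner_integrable M f \<longleftrightarrow> strongly_measurable M f \<and> integrable M (\<lambda>x. norm (f x))"

lemma bochner_integrable_bound:
  fixes f :: "real \<Rightarrow> 'b::real_normed_vector"
  assumes f: "strongly_measurable (lebesgue_on {a..b}) f"
    and g: "integrable (lebesgue_on {a..b}) g"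
    and le: "\<And>x. x \<in> {a..b} \<Longrightarrow> norm (f x) \<le> g x"
  shows "bochner_integrable (lebesgue_on {a..b}) f"
proof -
  interpret complete_measure "lebesgue_on {a..b}" by (rule complete_measure_lebesgue_on) simp
  have [measurable]: "f \<in> borel_measurable (lebesgue_on {a..b})"
    by (rule strongly_measurable_imp_borel[OF f])
  have "(\<lambda>x. norm (f x)) \<in> borel_measurable (lebesgue_on {a..b})" by measurable
  then have "integrable (lebesgue_on {a..b}) (\<lambda>x. norm (f x))"
    by (rule Bochner_Integration.integrable_bound[OF g]) (auto intro!: AE_I2 order_trans[OF le])
  then show ?thesis using f by (simp add: bochner_integrable_def)
qed

lemma bochner_integrable_diff:
  fixes f g :: "real \<Rightarrow> 'b::real_normed_vector"
  assumes f: "bochner_integrable (lebesgue_on {a..b}) f" and g: "bochner_integrable (lebesgue_on {a..b}) g"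
  shows "bochner_integrable (lebesgue_on {a..b}) (\<lambda>x. f x - g x)"
proof (rule bochner_integrable_bound)
  show "strongly_measurable (lebesgue_on {a..b}) (\<lambda>x. f x - g x)"
    using f g by (auto simp: bochner_integrable_def intro: strongly_measurable_diff)
  show "integrable (lebesgue_on {a..b}) (\<lambda>x. norm (f x) + norm (g x))"
    using f g by (simp add: bochner_integrable_def)
qed (rule norm_triangle_ineq4)

lemma bochner_integrable_continuous:
  fixes f :: "real \<Rightarrow> 'b::real_normed_vector"
  assumes "continuous_on {a..b} f"
  shows "bochner_integrable (lebesgue_on {a..b}) f"
proof -
  have "continuous_on {a..b} (\<lambda>x. norm (f x))" using assms by (rule continuous_on_norm)
  then have "integrable (lebesgue_on {a..b}) (\<lambda>x. norm (f x))"
    by (rule continuous_imp_integrable_real)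
  with strongly_measurable_continuous[OF assms] show ?thesis by (simp add: bochner_integrable_def)
qed

lemma interval_in_sets_lebesgue: "{a..b::real} \<in> sets lebesgue" by simp

lemma bochner_integrable_mono:
  fixes f :: "real \<Rightarrow> 'b::real_normed_vector"
  assumes f: "bochner_integrable (lebesgue_on {a..b}) f" and sub: "{c..d} \<subseteq> {a..b}"
  shows "bochner_integrable (lebesgue_on {c..d}) f"
proof -
  have sm: "strongly_measurable (lebesgue_on {a..b}) f" and i: "integrable (lebesgue_on {a..b}) (\<lambda>x. norm (f x))"
    using f unfolding bochner_integrable_def by simp_all
  have "{c..d} - {a..b} = {}" using sub by blast
  then have "negligible ({c..d} - {a..b})" by (simp only: negligible_empty)
  with sm have "strongly_measurable (lebesgue_on {c..d}) f"
    by (rule strongly_measurable_restrict[OF _ interval_in_sets_lebesgue interval_in_sets_lebesgue])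
  moreover have "integrable (lebesgue_on {c..d}) (\<lambda>x. norm (f x))"
    using i sub by (rule Equivalence_Lebesgue_Henstock_Integration.integrable_subinterval)
  ultimately show ?thesis unfolding bochner_integrable_def by (rule conjI)
qed

lemma simple_function_indicator_sum:
  fixes s :: "'a \<Rightarrow> 'b::real_vector"
  assumes s: "simple_function M s" and x: "x \<in> space M"
  shows "s x = (\<Sum>y\<in>s ` space M. indicator (s -` {y} \<inter> space M) x *\<^sub>R y)"
proof -
  have "(\<Sum>y\<in>s ` space M. indicator (s -` {y} \<inter> space M) x *\<^sub>R y) =
        (\<Sum>y\<in>s ` space M. if y = s x then y else 0)"
    using x by (intro sum.cong) (auto simp: indicator_def)
  also have "\<dots> = s x" using simple_functionD(1)[OF s] x by simp
  finally show ?thesis by simp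
qed

text \<open>The approximating simple functions are cut off where their norm exceeds \<open>1 + norm (f x)\<close>. This
  leaves the limit unchanged, and on a finite measure space it makes dominated convergence
  applicable to the norm of the error.\<close>

lemma bochner_integrable_simple_approx:
  fixes f :: "'a \<Rightarrow> 'b::real_normed_vector"
  assumes M: "complete_measure M" "finite_measure M" and f: "bochner_integrable M f" and e: "e > 0"
  obtains s where "simple_function M s" "integrable M (\<lambda>x. norm (f x - s x))"
    "(LINT x|M. norm (f x - s x)) < e"
proof -
  interpret complete_measure M by fact
  interpret finite_measure M by fact
  have fm: "strongly_measurable M f" and fi: "integrable M (\<lambda>x. norm (f x))"
    using f by (auto simp: bochner_integrable_def)
  have [measurable]: "f \<in> borel_measurable M" by (rule strongly_measurable_imp_borel[OF fm])
  obtain s where s: "\<And>i::nat. simple_function M (s i)" and lim: "AE x in M. (\<lambda>i. s i x) \<longlonglongrightarrow> f x"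
    using fm unfolding strongly_measurable_def by blast
  have [measurable]: "s i \<in> borel_measurable M" for i using s by (rule borel_measurable_simple_function)
  define E where "E i = {x \<in> space M. norm (s i x) \<le> 1 + norm (f x)}" for i
  have E: "E i \<in> sets M" for i unfolding E_def by measurable
  define r where "r i x = (if x \<in> E i then s i x else 0)" for i x
  have r: "simple_function M (r i)" for i
    unfolding r_def using s[of i] E[of i] by (intro simple_function_If_set) auto
  have rb: "norm (r i x) \<le> 1 + norm (f x)" for i x
    by (auto simp: r_def E_def add_nonneg_nonneg)
  have rlim: "AE x in M. (\<lambda>i. norm (f x - r i x)) \<longlonglongrightarrow> 0"
    using lim AE_space
  proof eventually_elim
    case (elim x)
    then have "(\<lambda>i. norm (s i x)) \<longlonglongrightarrow> norm (f x)" by (intro tendsto_norm)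
    then have "eventually (\<lambda>i. norm (s i x) < 1 + norm (f x)) sequentially"
      by (rule order_tendstoD) simp
    then have "eventually (\<lambda>i. s i x = r i x) sequentially"
      by eventually_elim (use elim in \<open>auto simp: r_def E_def\<close>)
    with elim(1) have "(\<lambda>i. r i x) \<longlonglongrightarrow> f x" by (rule Lim_transform_eventually)
    with tendsto_const have "(\<lambda>i. f x - r i x) \<longlonglongrightarrow> f x - f x" by (rule tendsto_diff)
    then have "(\<lambda>i. f x - r i x) \<longlonglongrightarrow> 0" by simp
    then show ?case by (rule tendsto_norm_zero)
  qed
  have mr: "(\<lambda>x. norm (f x - r i x)) \<in> borel_measurable M" for i
  proof -
    have [measurable]: "r i \<in> borel_measurable M" using r by (rule borel_measurable_simple_function)
    have "(\<lambda>x. f x - r i x) \<in> borel_measurable M"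
      by (intro strongly_measurable_imp_borel strongly_measurable_diff fm
        strongly_measurable_simple_function r)
    then show ?thesis by (rule measurable_compose) measurable
  qed
  have bound: "norm (norm (f x - r i x)) \<le> 1 + 2 * norm (f x)" for i x
    using norm_triangle_ineq4[of "f x" "r i x"] rb[of i x] by simp
  have dom: "integrable M (\<lambda>x. 1 + 2 * norm (f x))" using fi by simp
  have int: "integrable M (\<lambda>x. norm (f x - r i x))" for i
    by (rule Bochner_Integration.integrable_bound[OF dom mr]) (use bound in \<open>auto intro: order_trans\<close>)
  have "(\<lambda>i. LINT x|M. norm (f x - r i x)) \<longlonglongrightarrow> (LINT x|M. 0)"
    by (rule integral_dominated_convergence[OF _ mr dom rlim]) (use bound in auto)
  then have "(\<lambda>i. LINT x|M. norm (f x - r i x)) \<longlonglongrightarrow> 0" by simp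
  then have "eventually (\<lambda>i. (LINT x|M. norm (f x - r i x)) < e) sequentially"
    using e by (rule order_tendstoD)
  then obtain i where "(LINT x|M. norm (f x - r i x)) < e"
    using eventually_happens trivial_limit_sequentially by blast
  then show ?thesis using that r int by blast
qed

lemma simple_function_integrable_on:
  fixes s :: "real \<Rightarrow> 'b::real_normed_vector"
  assumes s: "simple_function (lebesgue_on {a..b}) s"
  shows "s integrable_on {a..b}"
proof -
  let ?E = "\<lambda>y. s -` {y} \<inter> {a..b}"
  have "(\<lambda>x. indicator (?E y) x *\<^sub>R y) integrable_on {a..b}" for y
  proof -
    have "?E y \<in> sets (lebesgue_on {a..b})" using simple_functionD(2)[OF s, of "{y}"] by simp
    then have "integrable (lebesgue_on {a..b}) (indicator (?E y) :: real \<Rightarrow> real)"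
      using finite_measure.emeasure_finite[OF finite_measure_lebesgue_on_interval]
      by (intro integrable_real_indicator) (auto simp: top.not_eq_extremum)
    then have "(indicator (?E y) :: real \<Rightarrow> real) integrable_on {a..b}"
      by (rule integrable_on_lebesgue_on) simp
    then have "((\<lambda>r. r *\<^sub>R y) \<circ> indicator (?E y)) integrable_on {a..b}"
      by (rule integrable_linear) (rule bounded_linear_scaleR_left)
    then show ?thesis by (simp add: o_def)
  qed
  then have "(\<lambda>x. \<Sum>y\<in>s ` {a..b}. indicator (?E y) x *\<^sub>R y) integrable_on {a..b}"
    using simple_functionD(1)[OF s] by (intro integrable_sum) auto
  then show ?thesis
    by (rule integrable_eq) (rule simple_function_indicator_sum[OF s, simplified, symmetric], simp)
qed

text \<open>Write \<open>f = s + (f - s)\<close> with \<open>s\<close> simple and \<open>norm (f - s)\<close> of small integral. On a fine tagged division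
  the Riemann sum of \<open>s\<close> is close to its integral, and the norm of the Riemann sum of \<open>f - s\<close> is at most
  the Riemann sum of the real function \<open>norm (f - s)\<close>, which is small as well. So the Riemann sums of
  \<open>f\<close> satisfy the Cauchy criterion.\<close>

theorem bochner_integrable_imp_integrable_on:
  fixes f :: "real \<Rightarrow> 'b::{real_normed_vector, complete_space}"
  assumes f: "bochner_integrable (lebesgue_on {a..b}) f"
  shows "f integrable_on {a..b}"
  unfolding cbox_interval[symmetric] integrable_Cauchy
proof (intro allI impI)
  fix e :: real assume e: "e > 0"
  let ?M = "lebesgue_on {a..b}"
  have "complete_measure ?M" by (rule complete_measure_lebesgue_on) simp
  then obtain s where s: "simple_function ?M s" and n: "integrable ?M (\<lambda>x. norm (f x - s x))"
    and small: "(LINT x|?M. norm (f x - s x)) < e / 6"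
    using bochner_integrable_simple_approx[OF _ finite_measure_lebesgue_on_interval f, of "e/6"] e by auto
  have "s integrable_on cbox a b" using simple_function_integrable_on[OF s] by simp
  then have "(s has_integral integral (cbox a b) s) (cbox a b)" by (rule integrable_integral)
  then obtain \<gamma>1 where \<gamma>1: "gauge \<gamma>1" and s1: "\<And>\<D>. \<D> tagged_division_of cbox a b \<Longrightarrow> \<gamma>1 fine \<D> \<Longrightarrow>
      norm ((\<Sum>(x,K)\<in>\<D>. measure lborel K *\<^sub>R s x) - integral (cbox a b) s) < e / 6"
    by (rule has_integralD[of s _ a b "e / 6"]) (use e in auto)
  have "((\<lambda>x. norm (f x - s x)) has_integral (LINT x|?M. norm (f x - s x))) (cbox a b)"
    using has_integral_integral_lebesgue_on[OF n] by simp
  then obtain \<gamma>2 where \<gamma>2: "gauge \<gamma>2" and s2: "\<And>\<D>. \<D> tagged_division_of cbox a b \<Longrightarrow> \<gamma>2 fine \<D> \<Longrightarrow>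
      norm ((\<Sum>(x,K)\<in>\<D>. measure lborel K *\<^sub>R norm (f x - s x)) - (LINT x|?M. norm (f x - s x))) < e / 6"
    by (rule has_integralD[of _ _ a b "e / 6"]) (use e in auto)
  have near: "norm ((\<Sum>(x,K)\<in>\<D>. measure lborel K *\<^sub>R f x) - integral (cbox a b) s) < e / 2"
    if D: "\<D> tagged_division_of cbox a b" "(\<lambda>x. \<gamma>1 x \<inter> \<gamma>2 x) fine \<D>" for \<D>
  proof -
    have fine: "\<gamma>1 fine \<D>" "\<gamma>2 fine \<D>" using D(2) by (auto simp: fine_Int)
    define X Y W where "X = (\<Sum>(x,K)\<in>\<D>. measure lborel K *\<^sub>R f x)"
      and "Y = (\<Sum>(x,K)\<in>\<D>. measure lborel K *\<^sub>R s x)"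
      and "W = (\<Sum>(x,K)\<in>\<D>. measure lborel K *\<^sub>R (f x - s x))"
    have "norm (X - Y) = norm W" unfolding X_def Y_def W_def
      by (simp add: sum_subtractf[symmetric] case_prod_beta scaleR_diff_right)
    moreover have "norm W \<le> (\<Sum>(x,K)\<in>\<D>. measure lborel K *\<^sub>R norm (f x - s x))"
      unfolding W_def by (rule order_trans[OF norm_sum]) (simp add: case_prod_beta)
    moreover have "(\<Sum>(x,K)\<in>\<D>. measure lborel K *\<^sub>R norm (f x - s x)) < e / 3"
      using s2[OF D(1) fine(2)] small unfolding real_norm_def by linarith
    moreover have "norm (Y - integral (cbox a b) s) < e / 6"
      unfolding Y_def by (rule s1[OF D(1) fine(1)])
    moreover have "norm (X - integral (cbox a b) s) \<le> norm (X - Y) + norm (Y - integral (cbox a b) s)"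
      using norm_triangle_ineq[of "X - Y" "Y - integral (cbox a b) s"] by simp
    ultimately show ?thesis unfolding X_def[symmetric] by linarith
  qed
  \<comment> \<open>all Riemann sums of \<open>f\<close> along a common refinement of the two gauges lie within \<open>e / 2\<close> of
    the integral of \<open>s\<close>\<close>
  show "\<exists>\<gamma>. gauge \<gamma> \<and> (\<forall>\<D>1 \<D>2. \<D>1 tagged_division_of cbox a b \<and> \<gamma> fine \<D>1 \<and>
      \<D>2 tagged_division_of cbox a b \<and> \<gamma> fine \<D>2 \<longrightarrow>
      norm ((\<Sum>(x,K)\<in>\<D>1. measure lborel K *\<^sub>R f x) - (\<Sum>(x,K)\<in>\<D>2. measure lborel K *\<^sub>R f x)) < e)"
  proof (intro exI conjI allI impI)
    show "gauge (\<lambda>x. \<gamma>1 x \<inter> \<gamma>2 x)" using \<gamma>1 \<gamma>2 by (rule gauge_Int)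
    fix \<D>1 \<D>2 assume "\<D>1 tagged_division_of cbox a b \<and> (\<lambda>x. \<gamma>1 x \<inter> \<gamma>2 x) fine \<D>1 \<and>
      \<D>2 tagged_division_of cbox a b \<and> (\<lambda>x. \<gamma>1 x \<inter> \<gamma>2 x) fine \<D>2"
    then show "norm ((\<Sum>(x,K)\<in>\<D>1. measure lborel K *\<^sub>R f x) - (\<Sum>(x,K)\<in>\<D>2. measure lborel K *\<^sub>R f x)) < e"
      using near[of \<D>1] near[of \<D>2]
      by (blast intro: norm_triangle_half_l[where y="integral (cbox a b) s"])
  qed
qed

lemma bochner_integrable_bounded_linear:
  fixes f :: "real \<Rightarrow> 'b::{real_normed_vector, complete_space}" and \<phi> :: "'b \<Rightarrow> real"
  assumes f: "bochner_integrable (lebesgue_on {a..b}) f" and \<phi>: "bounded_linear \<phi>"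
  shows "integrable (lebesgue_on {a..b}) (\<lambda>x. \<phi> (f x))"
    and "\<phi> (integral {a..b} f) = (LINT x|lebesgue_on {a..b}. \<phi> (f x))"
proof -
  interpret complete_measure "lebesgue_on {a..b}" by (rule complete_measure_lebesgue_on) simp
  have m: "f \<in> borel_measurable (lebesgue_on {a..b})" and i: "integrable (lebesgue_on {a..b}) (\<lambda>x. norm (f x))"
    using f by (auto simp: bochner_integrable_def strongly_measurable_imp_borel)
  obtain K where K: "\<And>x. norm (\<phi> x) \<le> norm x * K" using bounded_linear.bounded[OF \<phi>] by blast
  have "\<phi> \<in> borel_measurable borel"
    by (intro borel_measurable_continuous_onI linear_continuous_on \<phi>)
  then have "(\<lambda>x. \<phi> (f x)) \<in> borel_measurable (lebesgue_on {a..b})"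
    using m by (rule measurable_compose_rev)
  then show int: "integrable (lebesgue_on {a..b}) (\<lambda>x. \<phi> (f x))"
    by (rule Bochner_Integration.integrable_bound[rotated, where f="\<lambda>x. norm (f x) * K"])
       (use i in \<open>auto intro!: AE_I2 order_trans[OF K[unfolded real_norm_def] abs_ge_self]\<close>)
  have "\<phi> (integral {a..b} f) = integral {a..b} (\<phi> \<circ> f)"
    by (rule integral_linear[OF bochner_integrable_imp_integrable_on[OF f] \<phi>, symmetric])
  also have "\<dots> = (LINT x|lebesgue_on {a..b}. \<phi> (f x))"
    using lebesgue_integral_eq_integral[OF int] by (simp add: o_def)
  finally show "\<phi> (integral {a..b} f) = (LINT x|lebesgue_on {a..b}. \<phi> (f x))" .
qed

text \<open>The scalar inequality, applied to the inner product with the integral itself.\<close>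

lemma norm_bochner_integral_le:
  fixes f :: "real \<Rightarrow> 'b::{real_inner, complete_space}"
  assumes f: "bochner_integrable (lebesgue_on {a..b}) f"
  shows "norm (integral {a..b} f) \<le> (LINT x|lebesgue_on {a..b}. norm (f x))"
proof (cases "integral {a..b} f = 0")
  case False
  define z where "z = integral {a..b} f"
  have i: "integrable (lebesgue_on {a..b}) (\<lambda>x. norm (f x))" using f by (simp add: bochner_integrable_def)
  have "norm z * norm z = inner z z" by (simp add: norm_eq_sqrt_inner)
  also have "\<dots> = (LINT x|lebesgue_on {a..b}. inner (f x) z)"
    using bochner_integrable_bounded_linear(2)[OF f bounded_linear_inner_left] by (simp add: z_def)
  also have "\<dots> \<le> (LINT x|lebesgue_on {a..b}. norm (f x) * norm z)"
    by (intro integral_mono bochner_integrable_bounded_linear(1)[OF f bounded_linear_inner_left])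
       (use i norm_cauchy_schwarz in auto)
  also have "\<dots> = (LINT x|lebesgue_on {a..b}. norm (f x)) * norm z" by simp
  finally show ?thesis using False by (simp add: z_def)
qed (simp add: integral_nonneg_AE)

lemma bochner_integral_diff:
  fixes f :: "real \<Rightarrow> 'b::{real_normed_vector, complete_space}"
  assumes "bochner_integrable (lebesgue_on {a..b}) f" "bochner_integrable (lebesgue_on {a..b}) g"
  shows "integral {a..b} (\<lambda>x. f x - g x) = integral {a..b} f - integral {a..b} g"
  by (intro integral_diff bochner_integrable_imp_integrable_on assms)

lemma bochner_integrable_restrict_interval:
  fixes f :: "real \<Rightarrow> 'b::{real_inner, complete_space}"
  assumes f: "bochner_integrable (lebesgue_on {c..d}) f" and sub: "{c..d} \<subseteq> {a..b}"
  shows "bochner_integrable (lebesgue_on {a..b}) (\<lambda>x. if x \<in> {c..d} then f x else 0)"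
    and "integral {a..b} (\<lambda>x. if x \<in> {c..d} then f x else 0) = integral {c..d} f"
proof -
  let ?g = "\<lambda>x. if x \<in> {c..d} then f x else 0"
  have "strongly_measurable (lebesgue_on {a..b}) ?g"
  proof -
    obtain s where s: "\<And>i::nat. simple_function (lebesgue_on {c..d}) (s i)"
      and lim: "AE x in lebesgue_on {c..d}. (\<lambda>i. s i x) \<longlonglongrightarrow> f x"
      using f unfolding bochner_integrable_def strongly_measurable_def by blast
    have "AE x in lebesgue. x \<in> {c..d} \<longrightarrow> (\<lambda>i. s i x) \<longlonglongrightarrow> f x"
      using lim by (simp add: AE_restrict_space_iff)
    then have "AE x in lebesgue_on UNIV. (\<lambda>i. if x \<in> {c..d} then s i x else 0) \<longlonglongrightarrow> ?g x"
      unfolding lebesgue_on_UNIV_eq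
    proof eventually_elim
      case (elim x)
      then show ?case by (cases "x \<in> {c..d}") (simp_all only: if_True if_False tendsto_const simp_thms)
    qed
    moreover have "simple_function (lebesgue_on UNIV) (\<lambda>x. if x \<in> {c..d} then s i x else 0)" for i
    proof -
      have "simple_function lebesgue (\<lambda>x. indicator {c..d} x *\<^sub>R s i x)"
        using simple_function_restrict_space[of "{c..d}" lebesgue "s i"] s[of i] by simp
      moreover have "(\<lambda>x. indicator {c..d} x *\<^sub>R s i x) = (\<lambda>x. if x \<in> {c..d} then s i x else 0)"
        by (rule ext) (simp add: indicator_def)
      ultimately have "simple_function lebesgue (\<lambda>x. if x \<in> {c..d} then s i x else 0)" by simp
      then show ?thesis unfolding lebesgue_on_UNIV_eq .
    qed
    ultimately have "strongly_measurable (lebesgue_on UNIV) ?g"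
      unfolding strongly_measurable_def by (intro exI[of _ "\<lambda>i x. if x \<in> {c..d} then s i x else 0"]) blast
    then show ?thesis by (rule strongly_measurable_restrict) auto
  qed
  moreover have "integrable (lebesgue_on {a..b}) (\<lambda>x. norm (?g x))"
  proof -
    have "integrable lebesgue (\<lambda>x. indicator {c..d} x *\<^sub>R norm (f x))"
      using f by (simp add: bochner_integrable_def integrable_restrict_space)
    moreover have "indicator {a..b} x *\<^sub>R norm (?g x) = indicator {c..d} x *\<^sub>R norm (f x)" for x
      using sub by (auto simp: indicator_def)
    ultimately show ?thesis by (simp add: integrable_restrict_space)
  qed
  ultimately show g: "bochner_integrable (lebesgue_on {a..b}) ?g" by (simp add: bochner_integrable_def)
  have "inner (integral {a..b} ?g) e = inner (integral {c..d} f) e" for e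
  proof -
    have "inner (integral {a..b} ?g) e = integral {a..b} (\<lambda>x. inner (?g x) e)"
      using integral_linear[OF bochner_integrable_imp_integrable_on[OF g] bounded_linear_inner_left]
      by (simp add: o_def)
    also have "\<dots> = integral {a..b} (\<lambda>x. if x \<in> {c..d} then inner (f x) e else 0)"
      by (intro integral_cong) auto
    also have "\<dots> = integral {c..d} (\<lambda>x. inner (f x) e)"
      by (simp only: integral_restrict_Int Int_absorb2[OF sub])
    also have "\<dots> = inner (integral {c..d} f) e"
      using integral_linear[OF bochner_integrable_imp_integrable_on[OF f] bounded_linear_inner_left]
      by (simp add: o_def)
    finally show ?thesis .
  qed
  then show "integral {a..b} ?g = integral {c..d} f" by (metis vector_eq_rdot)
qed

text \<open>Dominated convergence, applied to the norm of the difference of the integrands. The continuity in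
  the parameter is required only for almost every \<open>\<sigma>\<close>, with an exceptional set that may depend on
  the parameter, so that indicators of intervals with moving end points are admitted.\<close>

lemma continuous_on_parameter_integral:
  fixes F :: "'t::metric_space \<Rightarrow> real \<Rightarrow> 'b::{real_inner, complete_space}"
  assumes F: "\<And>\<tau>. \<tau> \<in> T \<Longrightarrow> bochner_integrable (lebesgue_on {a..b}) (F \<tau>)"
    and h: "integrable (lebesgue_on {a..b}) h"
    and le: "\<And>\<tau> \<sigma>. \<tau> \<in> T \<Longrightarrow> \<sigma> \<in> {a..b} \<Longrightarrow> norm (F \<tau> \<sigma>) \<le> h \<sigma>"
    and cont: "\<And>\<tau>. \<tau> \<in> T \<Longrightarrow> AE \<sigma> in lebesgue_on {a..b}. continuous (at \<tau> within T) (\<lambda>\<tau>. F \<tau> \<sigma>)"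
  shows "continuous_on T (\<lambda>\<tau>. integral {a..b} (F \<tau>))"
  unfolding continuous_on_sequentially comp_def
proof (intro allI ballI impI)
  let ?M = "lebesgue_on {a..b}"
  fix s \<tau> assume \<tau>: "\<tau> \<in> T" and s: "(\<forall>n. s n \<in> T) \<and> s \<longlonglongrightarrow> \<tau>"
  have D: "bochner_integrable ?M (\<lambda>\<sigma>. F (s n) \<sigma> - F \<tau> \<sigma>)" for n
    using s \<tau> by (intro bochner_integrable_diff F) auto
  have "(\<lambda>n. LINT \<sigma>|?M. norm (F (s n) \<sigma> - F \<tau> \<sigma>)) \<longlonglongrightarrow> (LINT \<sigma>|?M. 0)"
  proof (rule integral_dominated_convergence[where w="\<lambda>\<sigma>. 2 * h \<sigma>"])
    show "(\<lambda>\<sigma>. norm (F (s n) \<sigma> - F \<tau> \<sigma>)) \<in> borel_measurable ?M" for n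
      using D[of n] unfolding bochner_integrable_def by (intro borel_measurable_integrable) (rule conjunct2)
    show "integrable ?M (\<lambda>\<sigma>. 2 * h \<sigma>)" using h by simp
    show "AE \<sigma> in ?M. (\<lambda>n. norm (F (s n) \<sigma> - F \<tau> \<sigma>)) \<longlonglongrightarrow> 0"
      using cont[OF \<tau>]
    proof eventually_elim
      case (elim \<sigma>)
      then have "(\<lambda>n. F (s n) \<sigma>) \<longlonglongrightarrow> F \<tau> \<sigma>"
        using s unfolding continuous_within_sequentially comp_def by blast
      then have "(\<lambda>n. F (s n) \<sigma> - F \<tau> \<sigma>) \<longlonglongrightarrow> 0" by (simp add: LIM_zero_iff)
      then show ?case by (rule tendsto_norm_zero)
    qed
    show "AE \<sigma> in ?M. norm (norm (F (s n) \<sigma> - F \<tau> \<sigma>)) \<le> 2 * h \<sigma>" for n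
      using AE_space
    proof eventually_elim
      case (elim \<sigma>)
      then have "\<sigma> \<in> {a..b}" by simp
      then have "norm (F (s n) \<sigma>) \<le> h \<sigma>" "norm (F \<tau> \<sigma>) \<le> h \<sigma>" using s \<tau> le by blast+
      then show ?case using norm_triangle_ineq4[of "F (s n) \<sigma>" "F \<tau> \<sigma>"] by simp
    qed
  qed simp
  then have lim: "(\<lambda>n. LINT \<sigma>|?M. norm (F (s n) \<sigma> - F \<tau> \<sigma>)) \<longlonglongrightarrow> 0" by simp
  have "norm (integral {a..b} (F (s n)) - integral {a..b} (F \<tau>)) \<le> (LINT \<sigma>|?M. norm (F (s n) \<sigma> - F \<tau> \<sigma>))" for n
    using norm_bochner_integral_le[OF D[of n]] bochner_integral_diff[OF F F] s \<tau> by metis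
  then have "(\<lambda>n. integral {a..b} (F (s n)) - integral {a..b} (F \<tau>)) \<longlonglongrightarrow> 0"
    by (intro Lim_null_comparison[OF _ lim] always_eventually allI)
  then show "(\<lambda>n. integral {a..b} (F (s n))) \<longlonglongrightarrow> integral {a..b} (F \<tau>)" by (simp add: LIM_zero_iff)
qed

lemma measurable_lborel_lebesgue_on:
  assumes "f \<in> borel_measurable borel"
  shows "f \<in> borel_measurable (lebesgue_on S)"
  using assms by (intro measurable_restrict_space1 measurable_completion) simp

text \<open>Strong measurability makes \<open>d\<close> a pointwise limit of simple functions, and for a simple function the
  integrand is a finite sum of products of indicators and kernels evaluated at fixed vectors. Its
  joint measurability therefore follows from that of the kernel at each fixed vector, and the scalar
  Fubini theorem applies.\<close>

lemma Fubini_bochner_kernel: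
  fixes d :: "real \<Rightarrow> 'b::{real_normed_vector, complete_space}" and \<Lambda> :: "real \<Rightarrow> real \<Rightarrow> 'b \<Rightarrow> real"
  assumes d: "bochner_integrable (lebesgue_on {a..b}) d"
    and lin: "\<And>\<tau> \<sigma>. linear (\<Lambda> \<tau> \<sigma>)"
    and bound: "\<And>\<tau> \<sigma> z. \<bar>\<Lambda> \<tau> \<sigma> z\<bar> \<le> C * norm z"
    and meas: "\<And>z. (\<lambda>(\<tau>, \<sigma>). \<Lambda> \<tau> \<sigma> z) \<in> borel_measurable borel"
  shows "(LINT \<tau>|lebesgue_on {a..b}. LINT \<sigma>|lebesgue_on {a..b}. \<Lambda> \<tau> \<sigma> (d \<sigma>)) =
         (LINT \<sigma>|lebesgue_on {a..b}. LINT \<tau>|lebesgue_on {a..b}. \<Lambda> \<tau> \<sigma> (d \<sigma>))"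
proof -
  let ?M = "lebesgue_on {a..b}"
  interpret M: complete_measure ?M by (rule complete_measure_lebesgue_on) simp
  interpret F: finite_measure ?M by (rule finite_measure_lebesgue_on_interval)
  interpret P: pair_sigma_finite ?M ?M by unfold_locales
  have dm: "strongly_measurable ?M d" and di: "integrable ?M (\<lambda>\<sigma>. norm (d \<sigma>))"
    using d by (auto simp: bochner_integrable_def)
  have bl: "bounded_linear (\<Lambda> \<tau> \<sigma>)" for \<tau> \<sigma>
    using lin bound by (intro bounded_linear_intro[where K=C])
      (auto simp: linear_add linear_scale mult.commute)
  obtain s d' where s: "\<And>i::nat. simple_function ?M (s i)"
    and lim: "\<And>x. x \<in> space ?M \<Longrightarrow> (\<lambda>i. s i x) \<longlonglongrightarrow> d' x"
    and ae: "AE x in ?M. d' x = d x" and d': "\<And>x. d' x \<in> {0, d x}"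
    by (rule M.strongly_measurable_everywhere[OF dm]) blast
  have id: "(\<lambda>p. p) \<in> measurable (?M \<Otimes>\<^sub>M ?M) borel"
  proof -
    have f: "fst \<in> measurable (?M \<Otimes>\<^sub>M ?M) borel" and g: "snd \<in> measurable (?M \<Otimes>\<^sub>M ?M) borel"
      using measurable_compose[OF measurable_fst measurable_lborel_lebesgue_on[of "\<lambda>x. x"]]
        measurable_compose[OF measurable_snd measurable_lborel_lebesgue_on[of "\<lambda>x. x"]]
      by (simp_all add: eta_contract_eq)
    have "(\<lambda>p. (fst p, snd p)) \<in> measurable (?M \<Otimes>\<^sub>M ?M) (borel \<Otimes>\<^sub>M borel)"
      using f g by (rule measurable_Pair)
    then show ?thesis by (simp add: borel_prod)
  qed
  have mz: "(\<lambda>p. \<Lambda> (fst p) (snd p) z) \<in> borel_measurable (?M \<Otimes>\<^sub>M ?M)" for z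
    using measurable_compose[OF id meas[of z]] by (simp add: case_prod_beta)
  have ms: "(\<lambda>p. \<Lambda> (fst p) (snd p) (s i (snd p))) \<in> borel_measurable (?M \<Otimes>\<^sub>M ?M)" for i
  proof -
    let ?E = "\<lambda>y. s i -` {y} \<inter> space ?M"
    have [measurable]: "?E y \<in> sets ?M" for y by (rule simple_functionD(2)[OF s])
    have "(\<lambda>p. indicator (?E y) (snd p) * \<Lambda> (fst p) (snd p) y :: real) \<in> borel_measurable (?M \<Otimes>\<^sub>M ?M)" for y
    proof -
      have "(\<lambda>p. indicator (?E y) (snd p) :: real) \<in> borel_measurable (?M \<Otimes>\<^sub>M ?M)" by measurable
      then show ?thesis using mz[of y] by (rule borel_measurable_times)
    qed
    then have "(\<lambda>p. \<Sum>y\<in>s i ` space ?M. indicator (?E y) (snd p) * \<Lambda> (fst p) (snd p) y :: real)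
        \<in> borel_measurable (?M \<Otimes>\<^sub>M ?M)" by (intro borel_measurable_sum)
    moreover have "\<Lambda> (fst p) (snd p) (s i (snd p)) =
        (\<Sum>y\<in>s i ` space ?M. indicator (?E y) (snd p) * \<Lambda> (fst p) (snd p) y)"
      if p: "p \<in> space (?M \<Otimes>\<^sub>M ?M)" for p
    proof -
      have "snd p \<in> space ?M" using p by (auto simp: space_pair_measure)
      then show ?thesis
        by (subst simple_function_indicator_sum[OF s[of i]])
           (simp_all only: linear_sum[OF lin] linear_scale[OF lin] real_scaleR_def)
    qed
    ultimately show ?thesis by (subst measurable_cong)
  qed
  have md: "(\<lambda>p. \<Lambda> (fst p) (snd p) (d' (snd p))) \<in> borel_measurable (?M \<Otimes>\<^sub>M ?M)"
  proof (rule borel_measurable_LIMSEQ_real[OF _ ms])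
    fix p assume "p \<in> space (?M \<Otimes>\<^sub>M ?M)"
    then have "snd p \<in> space ?M" by (auto simp: space_pair_measure)
    then show "(\<lambda>i. \<Lambda> (fst p) (snd p) (s i (snd p))) \<longlonglongrightarrow> \<Lambda> (fst p) (snd p) (d' (snd p))"
      by (intro bounded_linear.tendsto[OF bl] lim)
  qed
  have ni: "integrable (?M \<Otimes>\<^sub>M ?M) (\<lambda>p. C * norm (d (snd p)))"
  proof -
    have "integrable (?M \<Otimes>\<^sub>M ?M) (\<lambda>(x,y). norm (d y))"
    proof (rule P.Fubini_integrable)
      show "(\<lambda>(x,y). norm (d y)) \<in> borel_measurable (?M \<Otimes>\<^sub>M ?M)"
        using borel_measurable_integrable[OF di] by measurable
      show "integrable ?M (\<lambda>x. LINT y|?M. norm (case (x, y) of (x, y) \<Rightarrow> norm (d y)))"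
        by simp
    qed (use di in simp)
    then show ?thesis by (simp add: split_beta')
  qed
  have "integrable (?M \<Otimes>\<^sub>M ?M) (\<lambda>p. \<Lambda> (fst p) (snd p) (d' (snd p)))"
  proof (rule Bochner_Integration.integrable_bound[OF ni md], rule AE_I2)
    fix p :: "real \<times> real"
    have "d' (snd p) = 0 \<or> d' (snd p) = d (snd p)" using d'[of "snd p"] by simp
    then have "C * norm (d' (snd p)) \<le> \<bar>C * norm (d (snd p))\<bar>" by (elim disjE) simp_all
    with bound[of "fst p" "snd p" "d' (snd p)"]
    show "norm (\<Lambda> (fst p) (snd p) (d' (snd p))) \<le> norm (C * norm (d (snd p)))"
      unfolding real_norm_def by (rule order_trans)
  qed
  then have "(LINT \<tau>|?M. LINT \<sigma>|?M. \<Lambda> \<tau> \<sigma> (d' \<sigma>)) = (LINT \<sigma>|?M. LINT \<tau>|?M. \<Lambda> \<tau> \<sigma> (d' \<sigma>))"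
    using P.Fubini_integral[of "\<lambda>\<tau> \<sigma>. \<Lambda> \<tau> \<sigma> (d' \<sigma>)"] by (simp add: split_beta')
  moreover have "(LINT \<sigma>|?M. \<Lambda> \<tau> \<sigma> (d' \<sigma>)) = (LINT \<sigma>|?M. \<Lambda> \<tau> \<sigma> (d \<sigma>))" if "\<tau> \<in> space ?M" for \<tau>
  proof -
    have 1: "(\<lambda>\<sigma>. \<Lambda> \<tau> \<sigma> (d' \<sigma>)) \<in> borel_measurable ?M"
      using measurable_Pair2[OF md that] by simp
    have 2: "AE \<sigma> in ?M. \<Lambda> \<tau> \<sigma> (d' \<sigma>) = \<Lambda> \<tau> \<sigma> (d \<sigma>)" using ae by eventually_elim simp
    show ?thesis using 1 M.borel_measurable_AE_eq[OF 1 2] 2 by (rule integral_cong_AE)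
  qed
  then have "(LINT \<tau>|?M. LINT \<sigma>|?M. \<Lambda> \<tau> \<sigma> (d' \<sigma>)) = (LINT \<tau>|?M. LINT \<sigma>|?M. \<Lambda> \<tau> \<sigma> (d \<sigma>))"
    by (rule Bochner_Integration.integral_cong[OF refl])
  moreover have "(LINT \<sigma>|?M. LINT \<tau>|?M. \<Lambda> \<tau> \<sigma> (d' \<sigma>)) = (LINT \<sigma>|?M. LINT \<tau>|?M. \<Lambda> \<tau> \<sigma> (d \<sigma>))"
  proof -
    have 1: "(\<lambda>\<sigma>. LINT \<tau>|?M. \<Lambda> \<tau> \<sigma> (d' \<sigma>)) \<in> borel_measurable ?M"
    proof (rule F.borel_measurable_lebesgue_integral)
      show "(\<lambda>(\<sigma>, \<tau>). \<Lambda> \<tau> \<sigma> (d' \<sigma>)) \<in> borel_measurable (?M \<Otimes>\<^sub>M ?M)"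
      proof -
        have "(\<lambda>q. (snd q, fst q)) \<in> measurable (?M \<Otimes>\<^sub>M ?M) (?M \<Otimes>\<^sub>M ?M)" by measurable
        from measurable_compose[OF this md] show ?thesis by (simp only: fst_conv snd_conv split_beta')
      qed
    qed
    have 2: "AE \<sigma> in ?M. (LINT \<tau>|?M. \<Lambda> \<tau> \<sigma> (d' \<sigma>)) = (LINT \<tau>|?M. \<Lambda> \<tau> \<sigma> (d \<sigma>))"
      using ae by eventually_elim simp
    show ?thesis using 1 M.borel_measurable_AE_eq[OF 1 2] 2 by (rule integral_cong_AE)
  qed
  ultimately show ?thesis by simp
qed

section \<open>Strongly continuous semigroups and their adjoints\<close>

text \<open>The semigroup law reduces continuity at any time, from both sides, to right continuity at zero.\<close>

lemma semigroup_orbit_modulus: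
  fixes T :: "real \<Rightarrow> 'a::real_normed_vector \<Rightarrow> 'a"
  assumes lin: "\<And>s. 0 \<le> s \<Longrightarrow> linear (T s)"
    and semi: "\<And>s r x. 0 \<le> s \<Longrightarrow> 0 \<le> r \<Longrightarrow> T (s + r) x = T s (T r x)"
    and bound: "\<And>s x. 0 \<le> s \<Longrightarrow> norm (T s x) \<le> exp (\<omega> * s) * norm x" and \<omega>: "0 \<le> \<omega>"
    and s: "0 \<le> s" "s \<le> r" "r \<le> R"
  shows "norm (T r x - T s x) \<le> exp (\<omega> * R) * norm (T (r - s) x - x)"
proof -
  have "T r x - T s x = T s (T (r - s) x - x)"
    using semi[of s "r - s" x] s linear_diff[OF lin[of s]] by simp
  then have "norm (T r x - T s x) \<le> exp (\<omega> * s) * norm (T (r - s) x - x)" using bound s by metis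
  also have "\<dots> \<le> exp (\<omega> * R) * norm (T (r - s) x - x)"
    using s \<omega> by (intro mult_right_mono) (auto intro: mult_left_mono)
  finally show ?thesis .
qed

lemma semigroup_jointly_continuous:
  fixes T :: "real \<Rightarrow> 'a::real_normed_vector \<Rightarrow> 'a"
  assumes lin: "\<And>s. 0 \<le> s \<Longrightarrow> linear (T s)"
    and semi: "\<And>s r x. 0 \<le> s \<Longrightarrow> 0 \<le> r \<Longrightarrow> T (s + r) x = T s (T r x)"
    and bound: "\<And>s x. 0 \<le> s \<Longrightarrow> norm (T s x) \<le> exp (\<omega> * s) * norm x" and \<omega>: "0 \<le> \<omega>"
    and zero: "\<And>x. ((\<lambda>s. T s x) \<longlongrightarrow> x) (at_right 0)" "\<And>x. T 0 x = x"
  shows "continuous_on ({0..} \<times> UNIV) (\<lambda>(s, x). T s x)"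
  unfolding continuous_on_sequentially comp_def
proof (intro allI ballI impI)
  fix q :: "nat \<Rightarrow> real \<times> 'a" and p
  assume "p \<in> {0..} \<times> (UNIV :: 'a set)" and q: "(\<forall>n. q n \<in> {0..} \<times> UNIV) \<and> q \<longlonglongrightarrow> p"
  then obtain s x where p: "p = (s, x)" and s: "0 \<le> s" by auto
  define r y where "r n = fst (q n)" and "y n = snd (q n)" for n
  have r0: "0 \<le> r n" for n
  proof -
    have "q n \<in> {0..} \<times> UNIV" using q by blast
    then show ?thesis by (auto simp: r_def)
  qed
  have rl: "r \<longlonglongrightarrow> s" unfolding r_def using tendsto_fst[OF q[THEN conjunct2]] p by simp
  have yl: "y \<longlonglongrightarrow> x" unfolding y_def using tendsto_snd[OF q[THEN conjunct2]] p by simp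
  let ?K = "exp (\<omega> * (s + 1))"
  have "(\<lambda>n. T \<bar>r n - s\<bar> x) \<longlonglongrightarrow> x"
  proof -
    have "continuous (at 0 within {0..}) (\<lambda>s. T s x)"
      using zero by (simp add: continuous_within at_within_Ici_at_right)
    moreover have "(\<lambda>n. \<bar>r n - s\<bar>) \<longlonglongrightarrow> 0" using rl by (intro tendsto_rabs_zero) (simp add: LIM_zero_iff)
    ultimately have "(\<lambda>n. T \<bar>r n - s\<bar> x) \<longlonglongrightarrow> T 0 x"
      unfolding continuous_within_sequentially comp_def by auto
    then show ?thesis by (simp add: zero)
  qed
  then have "(\<lambda>n. T \<bar>r n - s\<bar> x - x) \<longlonglongrightarrow> 0" by (simp add: LIM_zero_iff)
  moreover have "(\<lambda>n. y n - x) \<longlonglongrightarrow> 0" using yl by (simp add: LIM_zero_iff)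
  ultimately have "(\<lambda>n. ?K * norm (y n - x) + ?K * norm (T \<bar>r n - s\<bar> x - x)) \<longlonglongrightarrow> ?K * 0 + ?K * 0"
    by (intro tendsto_add tendsto_mult tendsto_const tendsto_norm_zero)
  then have lim: "(\<lambda>n. ?K * norm (y n - x) + ?K * norm (T \<bar>r n - s\<bar> x - x)) \<longlonglongrightarrow> 0" by simp
  have ev: "eventually (\<lambda>n. r n < s + 1) sequentially" using rl by (rule order_tendstoD) simp
  have "eventually (\<lambda>n. norm (T (r n) (y n) - T s x)
      \<le> ?K * norm (y n - x) + ?K * norm (T \<bar>r n - s\<bar> x - x)) sequentially"
    using ev
  proof eventually_elim
    case (elim n)
    have "norm (T (r n) (y n - x)) \<le> exp (\<omega> * r n) * norm (y n - x)" by (rule bound[OF r0])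
    also have "\<dots> \<le> ?K * norm (y n - x)"
      using elim \<omega> by (intro mult_right_mono) (auto intro: mult_left_mono)
    finally have 1: "norm (T (r n) (y n) - T (r n) x) \<le> ?K * norm (y n - x)"
      by (simp add: linear_diff[OF lin[OF r0]])
    have 2: "norm (T (r n) x - T s x) \<le> ?K * norm (T \<bar>r n - s\<bar> x - x)"
    proof (cases "s \<le> r n")
      case True
      then show ?thesis
        using semigroup_orbit_modulus[of T \<omega> s "r n" "s + 1" x, OF lin semi bound \<omega>] s elim by simp
    next
      case False
      then show ?thesis
        using semigroup_orbit_modulus[of T \<omega> "r n" s "s + 1" x, OF lin semi bound \<omega>] r0[of n]
        by (simp add: norm_minus_commute)
    qed
    have "norm (T (r n) (y n) - T s x) \<le> norm (T (r n) (y n) - T (r n) x) + norm (T (r n) x - T s x)"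
      using norm_triangle_ineq[of "T (r n) (y n) - T (r n) x" "T (r n) x - T s x"] by simp
    with 1 2 show ?case by linarith
  qed
  then have "(\<lambda>n. T (r n) (y n) - T s x) \<longlonglongrightarrow> 0" using lim by (rule Lim_null_comparison)
  then show "(\<lambda>n. case q n of (s, x) \<Rightarrow> T s x) \<longlonglongrightarrow> (case p of (s, x) \<Rightarrow> T s x)"
    by (simp add: p r_def y_def case_prod_beta LIM_zero_iff)
qed

section \<open>The duality between V and its dual\<close>

locale dual_pair =
  fixes pr :: "'v::{real_inner, complete_space} \<Rightarrow> 'w::{real_inner, complete_space} \<Rightarrow> real"
  assumes pairing: "dual_pairing pr"
begin

sublocale bounded_bilinear pr using pairing by (simp add: dual_pairing_def)

lemma abs_pr_le: "\<bar>pr v w\<bar> \<le> norm v * norm w"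
proof -
  have "norm (pr v w) \<le> onorm (pr v) * norm w" by (rule onorm) (rule bounded_linear_right)
  then show ?thesis using pairing by (simp add: dual_pairing_def)
qed

lemma norm_le_pairing:
  assumes "0 \<le> K" "\<And>w. \<bar>pr v w\<bar> \<le> K * norm w"
  shows "norm v \<le> K"
proof -
  have "onorm (pr v) \<le> K" by (rule onorm_bound) (use assms in auto)
  then show ?thesis using pairing by (simp add: dual_pairing_def)
qed

lemma pairing_eqI:
  assumes "\<And>w. pr v w = pr v' w"
  shows "v = v'"
proof -
  have "norm (v - v') \<le> 0" by (rule norm_le_pairing) (simp_all add: diff_left assms)
  then show ?thesis by simp
qed

lemma functional_representation:
  assumes "bounded_linear \<phi>"
  obtains v where "\<And>w. pr v w = \<phi> w"
  using assms pairing unfolding dual_pairing_def by metis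

text \<open>Here the second space plays the role of the dual of the first.\<close>

lemma functional_representation_left:
  assumes "bounded_linear \<psi>"
  obtains w where "\<And>v. pr v w = \<psi> v"
  using assms pairing unfolding dual_pairing_def by metis

lemma pr_pairing_adjoint: "pr (pairing_adjoint pr L v) x = pr v (blinfun_apply L x)"
proof -
  have "bounded_linear (\<lambda>x. pr v (blinfun_apply L x))"
    by (intro bounded_linear_compose[OF bounded_linear_right] blinfun.bounded_linear_right)
  then obtain z where z: "\<And>x. pr z x = pr v (blinfun_apply L x)" by (rule functional_representation) blast
  have "\<forall>x. pr (THE z. \<forall>x. pr z x = pr v (blinfun_apply L x)) x = pr v (blinfun_apply L x)"
    by (rule theI[where a=z]) (auto intro: pairing_eqI simp: z)
  then show ?thesis by (simp add: pairing_adjoint_def)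
qed

lemma linear_pairing_adjoint: "linear (pairing_adjoint pr L)"
  by (intro linearI pairing_eqI) (simp_all add: pr_pairing_adjoint add_left scaleR_left)

lemma norm_pairing_adjoint_le:
  assumes "0 \<le> K" "\<And>x. norm (blinfun_apply L x) \<le> K * norm x"
  shows "norm (pairing_adjoint pr L v) \<le> K * norm v"
proof (rule norm_le_pairing)
  fix w
  have "\<bar>pr (pairing_adjoint pr L v) w\<bar> \<le> norm v * norm (blinfun_apply L w)"
    unfolding pr_pairing_adjoint by (rule abs_pr_le)
  also have "\<dots> \<le> norm v * (K * norm w)" using assms by (intro mult_left_mono) auto
  finally show "\<bar>pr (pairing_adjoint pr L v) w\<bar> \<le> K * norm v * norm w" by (simp add: mult_ac)
qed (use assms in simp)

lemma inner_control_adjoint: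
  fixes B :: "'u::{real_inner, complete_space} \<Rightarrow>\<^sub>L 'w"
  shows "inner (control_adjoint pr B v) u = pr v (blinfun_apply B u)"
proof -
  have "bounded_linear (\<lambda>u. pr v (blinfun_apply B u))"
    by (intro bounded_linear_compose[OF bounded_linear_right] blinfun.bounded_linear_right)
  from theI'[OF riesz_representation[OF this]] show ?thesis by (simp add: control_adjoint_def)
qed

lemma bounded_linear_control_adjoint:
  fixes B :: "'u::{real_inner, complete_space} \<Rightarrow>\<^sub>L 'w"
  shows "bounded_linear (control_adjoint pr B)"
proof (rule bounded_linear_intro[where K="norm B"])
  show "control_adjoint pr B (v + v') = control_adjoint pr B v + control_adjoint pr B v'" for v v'
    by (subst vector_eq_rdot[symmetric]) (simp add: inner_control_adjoint inner_add_left add_left)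
  show "control_adjoint pr B (r *\<^sub>R v) = r *\<^sub>R control_adjoint pr B v" for r v
    by (subst vector_eq_rdot[symmetric]) (simp add: inner_control_adjoint scaleR_left)
  show "norm (control_adjoint pr B v) \<le> norm v * norm B" for v
  proof (cases "control_adjoint pr B v = 0")
    case False
    let ?z = "control_adjoint pr B v"
    have "norm ?z * norm ?z = inner ?z ?z" by (simp add: norm_eq_sqrt_inner)
    also have "\<dots> \<le> norm v * norm (blinfun_apply B ?z)"
      unfolding inner_control_adjoint using abs_pr_le[of v "blinfun_apply B ?z"] by linarith
    also have "\<dots> \<le> norm v * (norm B * norm ?z)" by (intro mult_left_mono norm_blinfun norm_ge_zero)
    finally show ?thesis using False by (simp add: mult.assoc[symmetric])
  qed simp
qed

lemma pr_pairing_deriv: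
  assumes "(g has_derivative g') (at x)"
  shows "pr (pairing_deriv pr g x) = g'"
proof -
  obtain v where v: "\<And>w. pr v w = g' w"
    using functional_representation[OF has_derivative_bounded_linear[OF assms]] by blast
  have "pr v = g'" using v by blast
  then have ex: "(g has_derivative pr v) (at x)" using assms by simp
  then have "(g has_derivative pr (THE v. (g has_derivative pr v) (at x))) (at x)"
    by (rule theI) (metis ex has_derivative_unique pairing_eqI)
  then show ?thesis using has_derivative_unique[OF _ assms] by (simp add: pairing_deriv_def)
qed

text \<open>The integral of the adjoint orbit of \<open>v\<close> over \<open>[0, r]\<close>, taken in the weak sense: as a bounded
  functional it is represented by a vector before the orbit is known to be strongly measurable.\<close>

lemma averaged_functional:
  assumes cont: "\<And>w. continuous_on {0..} (\<lambda>s. pr v (blinfun_apply (S s) w))"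
    and bound: "\<And>s w. 0 \<le> s \<Longrightarrow> norm (blinfun_apply (S s) w) \<le> exp (\<omega> * s) * norm w" and \<omega>: "0 \<le> \<omega>"
    and r: "0 \<le> r"
  obtains z where "\<And>w. pr z w = integral {0..r} (\<lambda>s. pr v (blinfun_apply (S s) w))"
proof -
  have int: "(\<lambda>s. pr v (blinfun_apply (S s) w)) integrable_on {0..r}" for w
    by (intro integrable_continuous_real continuous_on_subset[OF cont]) auto
  have "bounded_linear (\<lambda>w. integral {0..r} (\<lambda>s. pr v (blinfun_apply (S s) w)))"
  proof (rule bounded_linear_intro[where K="norm v * exp (\<omega> * r) * r"])
    fix w w' :: 'w and c :: real
    show "integral {0..r} (\<lambda>s. pr v (blinfun_apply (S s) (w + w'))) =
        integral {0..r} (\<lambda>s. pr v (blinfun_apply (S s) w)) + integral {0..r} (\<lambda>s. pr v (blinfun_apply (S s) w'))"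
      by (simp add: blinfun.add_right add_right integral_add int)
    show "integral {0..r} (\<lambda>s. pr v (blinfun_apply (S s) (c *\<^sub>R w))) =
        c *\<^sub>R integral {0..r} (\<lambda>s. pr v (blinfun_apply (S s) w))"
      by (simp add: blinfun.scaleR_right scaleR_right)
    have "norm (integral {0..r} (\<lambda>s. pr v (blinfun_apply (S s) w))) \<le> norm v * (exp (\<omega> * r) * norm w) * (r - 0)"
    proof (rule integral_bound[OF r])
      show "continuous_on {0..r} (\<lambda>s. pr v (blinfun_apply (S s) w))" by (rule continuous_on_subset[OF cont]) auto
      fix s assume s: "s \<in> {0..r}"
      have "norm (pr v (blinfun_apply (S s) w)) \<le> norm v * norm (blinfun_apply (S s) w)"
        using abs_pr_le by simp
      also have "\<dots> \<le> norm v * (exp (\<omega> * s) * norm w)" using s bound by (intro mult_left_mono) auto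
      also have "\<dots> \<le> norm v * (exp (\<omega> * r) * norm w)"
        using s \<omega> by (intro mult_left_mono mult_right_mono) (auto intro: mult_left_mono)
      finally show "norm (pr v (blinfun_apply (S s) w)) \<le> norm v * (exp (\<omega> * r) * norm w)" .
    qed
    then show "norm (integral {0..r} (\<lambda>s. pr v (blinfun_apply (S s) w))) \<le> norm w * (norm v * exp (\<omega> * r) * r)"
      by (simp add: mult_ac)
  qed
  then show ?thesis using that functional_representation by blast
qed

text \<open>The vectors at which the adjoint orbits are strongly continuous form a closed subspace, and it
  contains the time averages of all orbits. The component of \<open>v\<close> perpendicular to this subspace is
  therefore perpendicular to the averages of the orbit of \<open>v\<close>, hence also to their weak limit \<open>v\<close>, and
  so it vanishes.\<close>

lemma adjoint_semigroup_continuous_at_0: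
  assumes sg: "\<And>s r x. 0 \<le> s \<Longrightarrow> 0 \<le> r \<Longrightarrow> blinfun_apply (S (s + r)) x = blinfun_apply (S s) (blinfun_apply (S r) x)"
    and S0: "\<And>x. blinfun_apply (S 0) x = x"
    and bound: "\<And>s w. 0 \<le> s \<Longrightarrow> norm (blinfun_apply (S s) w) \<le> exp (\<omega> * s) * norm w" and \<omega>: "0 \<le> \<omega>"
    and cont: "\<And>w. continuous_on {0..} (\<lambda>s. blinfun_apply (S s) w)"
  shows "((\<lambda>s. pairing_adjoint pr (S s) v) \<longlongrightarrow> v) (at_right 0)"
proof -
  define T where "T s = pairing_adjoint pr (S s)" for s
  have prT: "pr (T s v) w = pr v (blinfun_apply (S s) w)" for s v w
    by (simp add: T_def pr_pairing_adjoint)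
  have linT: "linear (T s)" for s unfolding T_def by (rule linear_pairing_adjoint)
  have boundT: "norm (T s v) \<le> exp (\<omega> * s) * norm v" if "0 \<le> s" for s v
    unfolding T_def using bound[OF that] by (intro norm_pairing_adjoint_le) auto
  have contp: "continuous_on {0..} (\<lambda>s. pr v (blinfun_apply (S s) w))" for v w
    by (intro bounded_linear.continuous_on[OF bounded_linear_right] cont)
  \<comment> \<open>the vectors with strongly continuous orbit\<close>
  define M where "M = {v. ((\<lambda>s. T s v) \<longlongrightarrow> v) (at_right 0)}"
  have ev01: "eventually (\<lambda>s::real. 0 < s \<and> s < 1) (at_right 0)"
    unfolding eventually_at_right_field by (intro exI[of _ 1]) auto
  have sub: "subspace M"
    unfolding subspace_def M_def
    by (auto simp: linear_0[OF linT] linear_add[OF linT] linear_scale[OF linT] intro!: tendsto_intros)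
  have "closed M"
    unfolding closed_sequential_limits
  proof (intro allI impI)
    fix f v assume f: "(\<forall>n. f n \<in> M) \<and> f \<longlonglongrightarrow> v"
    show "v \<in> M"
      unfolding M_def mem_Collect_eq
    proof (rule tendstoI)
      fix e :: real assume e: "e > 0"
      define K where "K = exp \<omega>"
      have K: "K > 0" by (simp add: K_def)
      have "e / (2 * (K + 1)) > 0" using e K by simp
      then obtain n where n: "dist (f n) v < e / (2 * (K + 1))"
        using f unfolding lim_sequentially by blast
      have "((\<lambda>s. T s (f n)) \<longlongrightarrow> f n) (at_right 0)" using f by (auto simp: M_def)
      then have "eventually (\<lambda>s. dist (T s (f n)) (f n) < e / 2) (at_right 0)"
        using e by (intro tendstoD) auto
      with ev01 show "eventually (\<lambda>s. dist (T s v) v < e) (at_right 0)"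
      proof eventually_elim
        case (elim s)
        have "norm (T s (v - f n)) \<le> exp (\<omega> * s) * norm (v - f n)" using elim by (intro boundT) simp
        also have "\<dots> \<le> K * norm (v - f n)"
          using elim \<omega> unfolding K_def by (intro mult_right_mono) (auto intro: mult_left_le)
        finally have 1: "norm (T s v - T s (f n)) \<le> K * norm (v - f n)" by (simp add: linear_diff[OF linT])
        have "norm (T s v - v) \<le> norm (T s v - T s (f n)) + norm (T s (f n) - f n) + norm (v - f n)"
          using norm_triangle_ineq[of "T s v - T s (f n)" "T s (f n) - f n"]
            norm_triangle_ineq4[of "T s v - f n" "v - f n"] by simp
        also have "\<dots> < (K + 1) * norm (v - f n) + e / 2"
          using 1 elim by (simp add: dist_norm algebra_simps)
        also have "\<dots> < e"
          using n K e by (simp add: dist_norm norm_minus_commute field_simps)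
        finally show ?case by (simp add: dist_norm)
      qed
    qed
  qed
  have avg: "z \<in> M" if r: "0 \<le> r" and z: "\<And>w. pr z w = integral {0..r} (\<lambda>s. pr v (blinfun_apply (S s) w))" for r z v
  proof -
    define C where "C = norm v * exp (\<omega> * (r + 1))"
    have C: "0 \<le> C" by (simp add: C_def)
    have "norm (T h z - z) \<le> 2 * C * h" if h: "0 < h" "h < 1" for h
    proof (rule norm_le_pairing)
      fix w
      let ?f = "\<lambda>s. pr v (blinfun_apply (S s) w)"
      have fb: "norm (?f s) \<le> C * norm w" if "0 \<le> s" "s \<le> r + 1" for s
      proof -
        have "norm (?f s) \<le> norm v * norm (blinfun_apply (S s) w)" using abs_pr_le by simp
        also have "\<dots> \<le> norm v * (exp (\<omega> * s) * norm w)" using that bound by (intro mult_left_mono) auto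
        also have "\<dots> \<le> norm v * (exp (\<omega> * (r + 1)) * norm w)"
          using that \<omega> by (intro mult_left_mono mult_right_mono) (auto intro: mult_left_mono)
        finally show ?thesis by (simp add: C_def mult_ac)
      qed
      have cf: "continuous_on {c..d} ?f" if "0 \<le> c" for c d
        by (rule continuous_on_subset[OF contp]) (use that in auto)
      have fi: "?f integrable_on {c..d}" if "0 \<le> c" for c d
        by (rule integrable_continuous_real[OF cf[OF that]])
      have "pr (T h z) w = integral {0..r} (\<lambda>s. ?f (h + s))"
        unfolding prT z using sg h by (intro integral_cong) (simp add: add.commute)
      also have "\<dots> = integral {h..r + h} ?f"
        using integral_shift_Icc_real[of 0 r ?f h] by (simp add: o_def)
      finally have "pr (T h z) w = integral {h..r + h} ?f" .
      moreover have "integral {0..h} ?f + integral {h..r + h} ?f = integral {0..r + h} ?f"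
        using h r by (intro Henstock_Kurzweil_Integration.integral_combine fi) auto
      moreover have "integral {0..r} ?f + integral {r..r + h} ?f = integral {0..r + h} ?f"
        using h r by (intro Henstock_Kurzweil_Integration.integral_combine fi) auto
      \<comment> \<open>shifting the averaged orbit by \<open>h\<close> changes it by two pieces of length \<open>h\<close>\<close>
      ultimately have "pr (T h z - z) w = integral {r..r + h} ?f - integral {0..h} ?f"
        by (simp add: diff_left z)
      moreover have "norm (integral {r..r + h} ?f) \<le> C * norm w * (r + h - r)"
        by (rule integral_bound) (use h r cf fb in auto)
      moreover have "norm (integral {0..h} ?f) \<le> C * norm w * (h - 0)"
        by (rule integral_bound) (use h r cf fb in auto)
      ultimately show "\<bar>pr (T h z - z) w\<bar> \<le> 2 * C * h * norm w"
        by (simp add: algebra_simps)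
    qed (use C h in simp)
    then have "eventually (\<lambda>h. norm (T h z - z) \<le> 2 * C * h) (at_right 0)"
      using ev01 by (auto elim: eventually_mono)
    moreover have "((\<lambda>h. 2 * C * h) \<longlongrightarrow> 2 * C * 0) (at_right 0)" by (intro tendsto_intros)
    ultimately have "((\<lambda>h. T h z - z) \<longlongrightarrow> 0) (at_right 0)"
      using Lim_null_comparison by fastforce
    then show "z \<in> M" by (simp add: M_def LIM_zero_iff)
  qed
  \<comment> \<open>the functional represented by \<open>w\<close> vanishes on \<open>M\<close>, hence on all averages of the orbit of \<open>v\<close>; as their
    lengths shrink to zero this gives \<open>pr v w = 0\<close>\<close>
  obtain m where m: "m \<in> M" "\<And>z. z \<in> M \<Longrightarrow> inner (v - m) z = 0"
    by (rule closed_subspace_perpendicular_foot[OF sub \<open>closed M\<close>, where v=v]) blast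
  obtain w where w: "\<And>x. pr x w = inner (v - m) x"
    by (rule functional_representation_left[OF bounded_linear_inner_right[of "v - m"]]) blast
  let ?f = "\<lambda>s. pr v (blinfun_apply (S s) w)"
  have zero: "integral {0..r} ?f = 0" if r: "0 \<le> r" for r
  proof -
    obtain z where z: "\<And>w. pr z w = integral {0..r} (\<lambda>s. pr v (blinfun_apply (S s) w))"
      by (rule averaged_functional[OF contp bound \<omega> r]) blast+
    have "pr z w = 0" using w m(2)[OF avg[OF r z]] by simp
    then show ?thesis by (simp add: z)
  qed
  have "?f 0 = 0"
  proof (rule ccontr)
    assume f0: "?f 0 \<noteq> 0"
    have "\<exists>d>0. \<forall>s\<in>{0..}. dist s 0 < d \<longrightarrow> dist (?f s) (?f 0) < \<bar>?f 0\<bar> / 2"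
      using contp[of v w] f0 unfolding continuous_on_iff by (metis atLeast_iff order_refl half_gt_zero zero_less_abs_iff)
    then obtain d where d: "d > 0" "\<And>s. 0 \<le> s \<Longrightarrow> s < d \<Longrightarrow> \<bar>?f s - ?f 0\<bar> < \<bar>?f 0\<bar> / 2"
      by (auto simp: dist_real_def)
    let ?r = "d / 2"
    have c: "continuous_on {0..?r} ?f" by (rule continuous_on_subset[OF contp]) auto
    have "norm (integral {0..?r} (\<lambda>s. ?f s - ?f 0)) \<le> \<bar>?f 0\<bar> / 2 * (?r - 0)"
      by (rule integral_bound) (use d c in \<open>auto intro!: continuous_intros less_imp_le\<close>)
    moreover have "integral {0..?r} (\<lambda>s. ?f s - ?f 0) = - (?r * ?f 0)"
      using zero[of ?r] d(1) c
      by (subst integral_diff) (auto intro: integrable_continuous_real)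
    ultimately have "?r * \<bar>?f 0\<bar> \<le> ?r * (\<bar>?f 0\<bar> / 2)"
      using d(1) by (simp add: abs_mult)
    then show False using d(1) f0 by (simp add: field_simps)
  qed
  then have "inner (v - m) v = 0" using w S0 by simp
  moreover have "inner (v - m) m = 0" using m by blast
  ultimately have "inner (v - m) (v - m) = 0" by (simp add: inner_diff_right)
  then have "v = m" by simp
  with m(1) show ?thesis by (simp add: M_def T_def)
qed

lemma adjoint_semigroup_jointly_continuous:
  assumes sg: "\<And>s r x. 0 \<le> s \<Longrightarrow> 0 \<le> r \<Longrightarrow> blinfun_apply (S (s + r)) x = blinfun_apply (S s) (blinfun_apply (S r) x)"
    and S0: "\<And>x. blinfun_apply (S 0) x = x"
    and bound: "\<And>s w. 0 \<le> s \<Longrightarrow> norm (blinfun_apply (S s) w) \<le> exp (\<omega> * s) * norm w" and \<omega>: "0 \<le> \<omega>"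
    and cont: "\<And>w. continuous_on {0..} (\<lambda>s. blinfun_apply (S s) w)"
  shows "continuous_on ({0..} \<times> UNIV) (\<lambda>(s, v). pairing_adjoint pr (S s) v)"
proof (rule semigroup_jointly_continuous[where \<omega>=\<omega>])
  show "pairing_adjoint pr (S (s + r)) v = pairing_adjoint pr (S s) (pairing_adjoint pr (S r) v)"
    if "0 \<le> s" "0 \<le> r" for s r v
    by (rule pairing_eqI) (use that sg[of r s] in \<open>simp add: pr_pairing_adjoint add.commute\<close>)
  show "norm (pairing_adjoint pr (S s) v) \<le> exp (\<omega> * s) * norm v" if "0 \<le> s" for s v
    using bound[OF that] by (intro norm_pairing_adjoint_le) auto
  show "((\<lambda>s. pairing_adjoint pr (S s) v) \<longlongrightarrow> v) (at_right 0)" for v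
    by (rule adjoint_semigroup_continuous_at_0[OF sg S0 bound \<omega> cont])
  show "pairing_adjoint pr (S 0) v = v" for v
    by (rule pairing_eqI) (simp add: pr_pairing_adjoint S0)
qed (use \<omega> linear_pairing_adjoint in auto)

end

section \<open>Convex functions with Lipschitz derivative and their conjugates\<close>

text \<open>Replaces the limit of difference quotients when the error is of first order in the step.\<close>

lemma le_if_le_perturbed:
  fixes a b K :: real
  assumes "\<And>s. 0 < s \<Longrightarrow> s < 1 \<Longrightarrow> a \<le> b + s * K"
  shows "a \<le> b"
proof (rule field_le_epsilon)
  fix e :: real assume e: "e > 0"
  define s where "s = min (1/2) (e / (\<bar>K\<bar> + 1))"
  have s: "0 < s" "s < 1" "s \<le> e / (\<bar>K\<bar> + 1)" using e by (auto simp: s_def)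
  have "s * K \<le> s * (\<bar>K\<bar> + 1)" using s by (intro mult_left_mono) auto
  also have "\<dots> \<le> e" using s(3) by (simp add: field_simps)
  finally show "a \<le> b + e" using assms[OF s(1,2)] by linarith
qed

text \<open>The mean value theorem along the segment from \<open>x\<close> to \<open>x + d\<close>.\<close>

lemma lipschitz_derivative_remainder:
  fixes f :: "'a::real_normed_vector \<Rightarrow> real" and f' :: "'a \<Rightarrow> 'a \<Rightarrow>\<^sub>L real"
  assumes der: "\<And>x. (f has_derivative blinfun_apply (f' x)) (at x)" and lip: "L-lipschitz_on UNIV f'"
  shows "\<bar>f (x + d) - f x - blinfun_apply (f' x) d\<bar> \<le> L * (norm d)\<^sup>2"
proof -
  have der': "((\<lambda>s. f (x + s *\<^sub>R d)) has_real_derivative blinfun_apply (f' (x + s *\<^sub>R d)) d) (at s)" for s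
  proof -
    have "((\<lambda>s. x + s *\<^sub>R d) has_derivative (\<lambda>h. h *\<^sub>R d)) (at s)"
      by (auto intro!: derivative_eq_intros)
    from has_derivative_compose[OF this der]
    have "((\<lambda>s. f (x + s *\<^sub>R d)) has_derivative (\<lambda>h. blinfun_apply (f' (x + s *\<^sub>R d)) (h *\<^sub>R d))) (at s)" .
    then show ?thesis
      by (rule has_derivative_imp_has_field_derivative) (simp add: blinfun.scaleR_right)
  qed
  have "\<exists>z::real. 0 < z \<and> z < 1 \<and>
      f (x + 1 *\<^sub>R d) - f (x + 0 *\<^sub>R d) = (1 - 0) * blinfun_apply (f' (x + z *\<^sub>R d)) d"
    by (rule MVT2) (simp, rule der')
  then obtain z :: real where z: "0 < z" "z < 1"
    and eq: "f (x + 1 *\<^sub>R d) - f (x + 0 *\<^sub>R d) = (1 - 0) * blinfun_apply (f' (x + z *\<^sub>R d)) d"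
    by blast
  have L: "0 \<le> L" using lip by (rule lipschitz_on_nonneg)
  have "\<bar>f (x + d) - f x - blinfun_apply (f' x) d\<bar> = norm (blinfun_apply (f' (x + z *\<^sub>R d) - f' x) d)"
    using eq by (simp add: blinfun.diff_left)
  also have "\<dots> \<le> norm (f' (x + z *\<^sub>R d) - f' x) * norm d" by (rule norm_blinfun)
  also have "\<dots> \<le> (L * norm d) * norm d"
  proof (rule mult_right_mono)
    have "norm (f' (x + z *\<^sub>R d) - f' x) \<le> L * dist (x + z *\<^sub>R d) x"
      using lipschitz_onD[OF lip, of "x + z *\<^sub>R d" x] by (simp add: dist_norm)
    also have "\<dots> \<le> L * norm d" using L z by (intro mult_left_mono) (auto simp: dist_norm mult_left_le_one_le)
    finally show "norm (f' (x + z *\<^sub>R d) - f' x) \<le> L * norm d" .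
  qed simp
  finally show ?thesis by (simp add: power2_eq_square mult.assoc)
qed

lemma convex_above_tangent:
  fixes f :: "'a::real_normed_vector \<Rightarrow> real" and f' :: "'a \<Rightarrow> 'a \<Rightarrow>\<^sub>L real"
  assumes der: "\<And>x. (f has_derivative blinfun_apply (f' x)) (at x)" and lip: "L-lipschitz_on UNIV f'"
    and conv: "convex_on UNIV f"
  shows "f x + blinfun_apply (f' x) d \<le> f (x + d)"
proof -
  have "blinfun_apply (f' x) d \<le> f (x + d) - f x + s * (L * (norm d)\<^sup>2)" if s: "0 < s" "s < 1" for s
  proof -
    have "f ((1 - s) *\<^sub>R x + s *\<^sub>R (x + d)) \<le> (1 - s) * f x + s * f (x + d)"
      using conv s by (intro convex_onD) auto
    moreover have "(1 - s) *\<^sub>R x + s *\<^sub>R (x + d) = x + s *\<^sub>R d" by (simp add: algebra_simps)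
    moreover have "\<bar>f (x + s *\<^sub>R d) - f x - s * blinfun_apply (f' x) d\<bar> \<le> L * (s * norm d)\<^sup>2"
      using lipschitz_derivative_remainder[OF der lip, of x "s *\<^sub>R d"] s by (simp add: blinfun.scaleR_right)
    ultimately have "s * blinfun_apply (f' x) d \<le> s * (f (x + d) - f x + s * (L * (norm d)\<^sup>2))"
      by (simp add: algebra_simps power2_eq_square)
    then show ?thesis using s by simp
  qed
  then have "blinfun_apply (f' x) d \<le> f (x + d) - f x" by (rule le_if_le_perturbed)
  then show ?thesis by linarith
qed

lemma conjugate_ge:
  assumes "\<And>v. convex_conjugate h v = ereal (k v)"
  shows "ereal (inner u v) - h u \<le> ereal (k v)"
  unfolding assms[symmetric] convex_conjugate_def by (rule SUP_upper) simp

lemma lsc_above: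
  fixes h :: "'u::topological_space \<Rightarrow> ereal"
  assumes "lower_semicontinuous h" "c < h u"
  shows "eventually (\<lambda>x. c < h x) (nhds u)"
proof -
  have "c < Liminf (at u) h" using assms unfolding lower_semicontinuous_def by (meson less_le_trans)
  then have "eventually (\<lambda>x. c < h x) (at u)" by (rule less_LiminfD)
  then show ?thesis using assms(2) by (simp add: eventually_nhds_conv_at)
qed

lemma lsc_borel_measurable:
  fixes h :: "'u::topological_space \<Rightarrow> ereal"
  assumes "lower_semicontinuous h"
  shows "h \<in> borel_measurable borel"
proof (rule borel_measurableI_greater)
  fix c
  have "open {x. c < h x}"
    unfolding open_subopen[of "{x. c < h x}"]
  proof (intro ballI)
    fix u assume "u \<in> {x. c < h x}"
    then have "eventually (\<lambda>x. c < h x) (nhds u)" using lsc_above[OF assms] by blast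
    then show "\<exists>T. open T \<and> u \<in> T \<and> T \<subseteq> {x. c < h x}" unfolding eventually_nhds by blast
  qed
  then show "{x \<in> space borel. c < h x} \<in> sets borel" by simp
qed

text \<open>Let \<open>s m\<close> and \<open>s n\<close> be almost maximizing in the supremum that defines \<open>k v\<close>. They bound \<open>k\<close> from below
  by affine functions which almost touch \<open>k\<close> at \<open>v\<close> and have slopes \<open>s m\<close> and \<open>s n\<close>. Comparing these bounds
  at \<open>v + \<theta> e\<close> and \<open>v - \<theta> e\<close>, where \<open>e = s m - s n\<close>, with the quadratic upper bound for \<open>k\<close> shows that \<open>e\<close>
  is small. So a maximizing sequence converges, and by lower semicontinuity its limit is a
  maximizer.\<close>

lemma conjugate_supremum_attained:
  fixes h :: "'u::{real_inner, complete_space} \<Rightarrow> ereal"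
  assumes noninf: "\<And>u. h u \<noteq> -\<infinity>" and lsc: "lower_semicontinuous h"
    and conj: "\<And>v. convex_conjugate h v = ereal (k v)"
    and der: "\<And>x. (k has_derivative blinfun_apply (k' x)) (at x)" and lip: "L-lipschitz_on UNIV k'"
  shows "\<exists>g. h g = ereal (inner g v - k v)"
proof -
  have L: "0 \<le> L" using lip by (rule lipschitz_on_nonneg)
  have "\<exists>u. ereal (k v - inverse (Suc n)) < ereal (inner u v) - h u" for n
  proof -
    have "ereal (k v - inverse (Suc n)) < (SUP u. ereal (inner u v) - h u)"
      unfolding convex_conjugate_def[symmetric] conj by simp
    then show ?thesis unfolding less_SUP_iff by blast
  qed
  then obtain s where s: "\<And>n::nat. ereal (k v - inverse (Suc n)) < ereal (inner (s n) v) - h (s n)" by metis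
  have "h (s n) \<noteq> \<infinity>" for n using s[of n] by auto
  then have fin: "\<bar>h (s n)\<bar> \<noteq> \<infinity>" for n using noninf[of "s n"] by (cases "h (s n)") auto
  define r where "r n = real_of_ereal (h (s n))" for n
  have r: "h (s n) = ereal (r n)" for n unfolding r_def using fin by (rule ereal_real'[symmetric])
  have near: "k v - inverse (Suc n) < inner (s n) v - r n" for n using s[of n] by (simp add: r)
  have below: "inner (s n) z - r n \<le> k z" for n z
    using conjugate_ge[OF conj, of "s n" z] by (simp add: r)
  have close: "(norm (s m - s n))\<^sup>2 \<le> 8 * (L + 1) * (inverse (Suc m) + inverse (Suc n))" for m n
  proof -
    define e where "e = s m - s n"
    \<comment> \<open>small enough for the term quadratic in \<open>\<theta>\<close> to be absorbed into half of the linear one\<close>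
    define \<theta> where "\<theta> = 1 / (4 * (L + 1))"
    have \<theta>: "0 < \<theta>" "L * \<theta> \<le> 1/4" using L by (auto simp: \<theta>_def field_simps)
    have "\<bar>k (v + \<theta> *\<^sub>R e) - k v - \<theta> * blinfun_apply (k' v) e\<bar> \<le> L * (\<theta> * norm e)\<^sup>2"
      using lipschitz_derivative_remainder[OF der lip, of v "\<theta> *\<^sub>R e"] \<theta> by (simp add: blinfun.scaleR_right)
    moreover have "\<bar>k (v - \<theta> *\<^sub>R e) - k v + \<theta> * blinfun_apply (k' v) e\<bar> \<le> L * (\<theta> * norm e)\<^sup>2"
      using lipschitz_derivative_remainder[OF der lip, of v "- (\<theta> *\<^sub>R e)"] \<theta>
      by (simp add: blinfun.scaleR_right blinfun.minus_right)
    moreover have "inner (s m) v + \<theta> * inner (s m) e - r m \<le> k (v + \<theta> *\<^sub>R e)"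
      using below[of m "v + \<theta> *\<^sub>R e"] by (simp add: inner_add_right)
    moreover have "inner (s n) v - \<theta> * inner (s n) e - r n \<le> k (v - \<theta> *\<^sub>R e)"
      using below[of n "v - \<theta> *\<^sub>R e"] by (simp add: inner_diff_right)
    moreover have "\<theta> * inner (s m) e - \<theta> * inner (s n) e = \<theta> * (norm e)\<^sup>2"
      by (simp add: e_def power2_norm_eq_inner inner_diff_left inner_diff_right algebra_simps)
    ultimately have "\<theta> * (norm e)\<^sup>2 \<le> inverse (Suc m) + inverse (Suc n) + 2 * (L * (\<theta> * norm e)\<^sup>2)"
      using near[of m] near[of n] by linarith
    also have "2 * (L * (\<theta> * norm e)\<^sup>2) = (L * \<theta>) * (2 * \<theta> * (norm e)\<^sup>2)" by (simp add: power2_eq_square)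
    also have "\<dots> \<le> 1/4 * (2 * \<theta> * (norm e)\<^sup>2)" using \<theta> by (intro mult_right_mono) auto
    finally have "\<theta> * (norm e)\<^sup>2 \<le> 2 * (inverse (Suc m) + inverse (Suc n))" by simp
    then have "(norm e)\<^sup>2 \<le> 2 * (inverse (Suc m) + inverse (Suc n)) / \<theta>"
      using \<theta>(1) by (simp add: pos_le_divide_eq mult.commute)
    then show ?thesis by (simp add: \<theta>_def e_def algebra_simps)
  qed
  have "Cauchy s"
  proof (rule metric_CauchyI)
    fix e :: real assume e: "e > 0"
    have "0 < e\<^sup>2 / (16 * (L + 1))" using e L by simp
    then obtain N where N: "inverse (real (Suc N)) < e\<^sup>2 / (16 * (L + 1))"
      using reals_Archimedean by blast
    have "dist (s m) (s n) < e" if mn: "m \<ge> N" "n \<ge> N" for m n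
    proof -
      have "inverse (real (Suc m)) \<le> inverse (real (Suc N))" "inverse (real (Suc n)) \<le> inverse (real (Suc N))"
        using mn by (auto intro!: le_imp_inverse_le)
      then have "inverse (real (Suc m)) + inverse (real (Suc n)) < 2 * (e\<^sup>2 / (16 * (L + 1)))" using N by linarith
      then have "8 * (L + 1) * (inverse (real (Suc m)) + inverse (real (Suc n))) < 8 * (L + 1) * (2 * (e\<^sup>2 / (16 * (L + 1))))"
        using L by (intro mult_strict_left_mono) auto
      also have "\<dots> = e\<^sup>2" using L by (simp add: field_simps)
      finally have "(norm (s m - s n))\<^sup>2 < e\<^sup>2" using close[of m n] by linarith
      then show ?thesis using e by (simp add: dist_norm power2_less_imp_less)
    qed
    then show "\<exists>N. \<forall>m\<ge>N. \<forall>n\<ge>N. dist (s m) (s n) < e" by blast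
  qed
  then obtain g where g: "s \<longlonglongrightarrow> g" using Cauchy_convergent convergent_def by blast
  have "h g \<le> ereal (inner g v - k v)"
  proof (rule ccontr)
    assume "\<not> ?thesis"
    then obtain c where c: "ereal (inner g v - k v) < ereal c" "ereal c < h g"
      using ereal_dense2[of "ereal (inner g v - k v)" "h g"] by (auto simp: not_le)
    have "eventually (\<lambda>n. ereal c < h (s n)) sequentially"
      using lsc_above[OF lsc c(2)] g by (rule eventually_compose_filterlim)
    then have "eventually (\<lambda>n. c \<le> inner (s n) v - k v + inverse (Suc n)) sequentially"
      by eventually_elim (use near in \<open>simp add: r, smt (verit)\<close>)
    moreover have "(\<lambda>n. inner (s n) v - k v + inverse (real (Suc n))) \<longlonglongrightarrow> inner g v - k v + 0"
      by (intro tendsto_intros g LIMSEQ_inverse_real_of_nat)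
    ultimately have "c \<le> inner g v - k v + 0"
      by (intro tendsto_lowerbound) auto
    with c(1) show False by simp
  qed
  moreover have "ereal (inner g v - k v) \<le> h g"
    using conjugate_ge[OF conj, of g v] noninf[of g] by (cases "h g") auto
  ultimately show ?thesis by (intro exI[of _ g]) auto
qed

text \<open>A maximizer \<open>G v\<close> is the slope of an affine function below \<open>k\<close> that touches \<open>k\<close> at \<open>v\<close>, hence it is the
  gradient of \<open>k\<close> there and inherits the Lipschitz constant of the derivative.\<close>

lemma conjugate_gradient:
  fixes h :: "'u::{real_inner, complete_space} \<Rightarrow> ereal"
  assumes noninf: "\<And>u. h u \<noteq> -\<infinity>" and lsc: "lower_semicontinuous h"
    and conj: "\<And>v. convex_conjugate h v = ereal (k v)"
    and der: "\<And>x. (k has_derivative blinfun_apply (k' x)) (at x)" and lip: "L-lipschitz_on UNIV k'"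
  obtains G where "\<And>v. h (G v) = ereal (inner (G v) v - k v)" "continuous_on UNIV G"
proof -
  obtain G where G: "\<And>v. h (G v) = ereal (inner (G v) v - k v)"
    using conjugate_supremum_attained[OF noninf lsc conj der lip] by metis
  have le: "inner (G v) d \<le> blinfun_apply (k' v) d" for v d
  proof (rule le_if_le_perturbed)
    fix s :: real assume s: "0 < s" "s < 1"
    have "inner (G v) (v + s *\<^sub>R d) - (inner (G v) v - k v) \<le> k (v + s *\<^sub>R d)"
      using conjugate_ge[OF conj, of "G v" "v + s *\<^sub>R d"] by (simp add: G)
    moreover have "\<bar>k (v + s *\<^sub>R d) - k v - s * blinfun_apply (k' v) d\<bar> \<le> L * (s * norm d)\<^sup>2"
      using lipschitz_derivative_remainder[OF der lip, of v "s *\<^sub>R d"] s by (simp add: blinfun.scaleR_right)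
    ultimately have "s * inner (G v) d \<le> s * (blinfun_apply (k' v) d + s * (L * (norm d)\<^sup>2))"
      by (simp add: inner_add_right algebra_simps power2_eq_square)
    then show "inner (G v) d \<le> blinfun_apply (k' v) d + s * (L * (norm d)\<^sup>2)" using s by simp
  qed
  have eq: "blinfun_apply (k' v) d = inner (G v) d" for v d
    using le[of v d] le[of v "- d"] by (simp add: blinfun.minus_right)
  have "L-lipschitz_on UNIV G"
  proof (rule lipschitz_onI)
    fix v w
    have "norm (G v - G w) * norm (G v - G w) = inner (G v - G w) (G v - G w)"
      by (simp add: norm_eq_sqrt_inner)
    also have "\<dots> = blinfun_apply (k' v - k' w) (G v - G w)"
      by (simp add: inner_diff_left eq blinfun.diff_left)
    also have "\<dots> \<le> norm (k' v - k' w) * norm (G v - G w)"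
      using norm_blinfun[of "k' v - k' w" "G v - G w"] by simp
    also have "\<dots> \<le> (L * dist v w) * norm (G v - G w)"
      using lipschitz_onD[OF lip, of v w] by (intro mult_right_mono) (auto simp: dist_norm)
    finally show "dist (G v) (G w) \<le> L * dist v w"
      using lipschitz_on_nonneg[OF lip] by (cases "G v = G w") (auto simp: dist_norm)
  qed (use lip in \<open>rule lipschitz_on_nonneg\<close>)
  then show ?thesis using that G lipschitz_on_continuous_on by blast
qed

section \<open>Integrals of extended real functions\<close>

lemma ereal_integral_mono_AE:
  assumes "AE x in M. f x \<le> g x"
  shows "ereal_integral M f \<le> ereal_integral M g"
  unfolding ereal_integral_def
proof (rule ereal_minus_mono)
  show "enn2ereal (\<integral>\<^sup>+x. e2ennreal (f x) \<partial>M) \<le> enn2ereal (\<integral>\<^sup>+x. e2ennreal (g x) \<partial>M)"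
    unfolding less_eq_ennreal.rep_eq[symmetric]
    by (rule nn_integral_mono_AE) (use assms in \<open>eventually_elim, auto intro: e2ennreal_mono\<close>)
  show "enn2ereal (\<integral>\<^sup>+x. e2ennreal (- g x) \<partial>M) \<le> enn2ereal (\<integral>\<^sup>+x. e2ennreal (- f x) \<partial>M)"
    unfolding less_eq_ennreal.rep_eq[symmetric]
    by (rule nn_integral_mono_AE) (use assms in \<open>eventually_elim, auto intro: e2ennreal_mono\<close>)
qed

text \<open>The decomposition of a sum into positive and negative parts, rearranged so that no difference of
  possibly infinite terms occurs.\<close>

lemma positive_negative_parts_add:
  assumes "0 \<le> (b::ereal)"
  shows "e2ennreal (ereal a + b) + ennreal (- a) = ennreal a + e2ennreal b + e2ennreal (- (ereal a + b))"
proof (cases b)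
  case (real r)
  have "ennreal (a + r) + ennreal (- a) = ennreal a + ennreal r + ennreal (- a - r)"
  proof (cases "0 \<le> a")
    case True
    then show ?thesis using assms real by (simp add: ennreal_neg ennreal_plus)
  next
    case False
    then show ?thesis using assms real
      by (cases "0 \<le> a + r") (simp_all add: ennreal_neg flip: ennreal_plus)
  qed
  then show ?thesis using real by (simp add: e2ennreal_ereal)
qed (use assms in auto)

lemma ereal_integral_add:
  assumes \<alpha>: "integrable M \<alpha>" and \<beta>: "\<beta> \<in> borel_measurable M" "\<And>x. x \<in> space M \<Longrightarrow> (0::ereal) \<le> \<beta> x"
  shows "ereal_integral M (\<lambda>x. ereal (\<alpha> x) + \<beta> x) =
         ereal (LINT x|M. \<alpha> x) + enn2ereal (\<integral>\<^sup>+x. e2ennreal (\<beta> x) \<partial>M)"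
proof -
  have [measurable]: "\<alpha> \<in> borel_measurable M" using \<alpha> by (rule borel_measurable_integrable)
  note [measurable] = \<beta>(1)
  define P N H A A' where "P = (\<integral>\<^sup>+x. e2ennreal (ereal (\<alpha> x) + \<beta> x) \<partial>M)"
    and "N = (\<integral>\<^sup>+x. e2ennreal (- (ereal (\<alpha> x) + \<beta> x)) \<partial>M)"
    and "H = (\<integral>\<^sup>+x. e2ennreal (\<beta> x) \<partial>M)"
    and "A = (\<integral>\<^sup>+x. ennreal (\<alpha> x) \<partial>M)" and "A' = (\<integral>\<^sup>+x. ennreal (- \<alpha> x) \<partial>M)"
  have "P + A' = (\<integral>\<^sup>+x. e2ennreal (ereal (\<alpha> x) + \<beta> x) + ennreal (- \<alpha> x) \<partial>M)"
    unfolding P_def A'_def by (intro nn_integral_add[symmetric]) measurable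
  also have "\<dots> = (\<integral>\<^sup>+x. ennreal (\<alpha> x) + e2ennreal (\<beta> x) + e2ennreal (- (ereal (\<alpha> x) + \<beta> x)) \<partial>M)"
    by (intro nn_integral_cong positive_negative_parts_add \<beta>)
  also have "\<dots> = A + H + N"
    unfolding A_def H_def N_def by (subst nn_integral_add; (subst nn_integral_add)?; simp)
  finally have eq: "P + A' = A + H + N" .
  have fin: "A < \<infinity>" "A' < \<infinity>" unfolding A_def A'_def
    using \<alpha> by (auto simp: real_integrable_def less_top)
  have "N \<le> A'" unfolding N_def A'_def
  proof (intro nn_integral_mono)
    fix x assume "x \<in> space M"
    then have "- (ereal (\<alpha> x) + \<beta> x) \<le> ereal (- \<alpha> x)" using \<beta>(2)[of x] by (cases "\<beta> x") auto
    from e2ennreal_mono[OF this] show "e2ennreal (- (ereal (\<alpha> x) + \<beta> x)) \<le> ennreal (- \<alpha> x)"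
      by (simp add: e2ennreal_ereal)
  qed
  then have "N < \<infinity>" using fin by (rule_tac le_less_trans)
  have int: "(LINT x|M. \<alpha> x) = enn2real A - enn2real A'"
    unfolding A_def A'_def using \<alpha> by (rule real_lebesgue_integral_def)
  obtain a a' n where an: "A = ennreal a" "A' = ennreal a'" "N = ennreal n" "0 \<le> a" "0 \<le> a'" "0 \<le> n"
    using fin \<open>N < \<infinity>\<close> by (metis ennreal_cases infinity_ennreal_def less_irrefl)
  have "enn2ereal P - enn2ereal N = ereal (a - a') + enn2ereal H"
  proof (cases H)
    case (real r)
    then have "P + ennreal a' = ennreal (a + r + n)" using eq an by (simp add: ennreal_plus)
    then have "P \<noteq> top" by auto
    then obtain p where p: "P = ennreal p" "0 \<le> p" by (metis ennreal_cases)
    have "ennreal (p + a') = ennreal (a + r + n)" using \<open>P + ennreal a' = _\<close> p an by (simp add: ennreal_plus)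
    then have "p + a' = a + r + n" using p an real by (subst (asm) ennreal_inj) auto
    then show ?thesis using p an real by (simp add: enn2ereal_ennreal)
  next
    case top
    then have "P + ennreal a' = top" using eq an by simp
    then have "P = top" by (simp add: ennreal_add_eq_top)
    then show ?thesis using top an by (simp add: enn2ereal_ennreal)
  qed
  then show ?thesis unfolding ereal_integral_def int an P_def[symmetric] N_def[symmetric] H_def[symmetric]
    using an by simp
qed

lemma ereal_integral_real:
  assumes "integrable M \<alpha>"
  shows "ereal_integral M (\<lambda>x. ereal (\<alpha> x)) = ereal (LINT x|M. \<alpha> x)"
  using ereal_integral_add[OF assms, of "\<lambda>_. 0"] by (simp add: e2ennreal_neg zero_ennreal.rep_eq)

section \<open>Weighted Lebesgue spaces on a bounded interval\<close>

lemma AE_lebesgue_on_Ico_iff_Icc: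
  "(AE x in lebesgue_on {a..<b::real}. P x) \<longleftrightarrow> (AE x in lebesgue_on {a..b}. P x)"
proof -
  have "AE x in lebesgue. x \<noteq> b"
  proof -
    have "{b} \<in> null_sets lebesgue" using negligible_iff_null_sets[of "{b}"] by simp
    from AE_not_in[OF this] show ?thesis by simp
  qed
  then have "(AE x in lebesgue. x \<in> {a..<b} \<longrightarrow> P x) \<longleftrightarrow> (AE x in lebesgue. x \<in> {a..b} \<longrightarrow> P x)"
  proof (intro iffI)
    assume ae: "AE x in lebesgue. x \<noteq> b"
    { assume "AE x in lebesgue. x \<in> {a..<b} \<longrightarrow> P x"
      with ae show "AE x in lebesgue. x \<in> {a..b} \<longrightarrow> P x" by eventually_elim auto }
    { assume "AE x in lebesgue. x \<in> {a..b} \<longrightarrow> P x"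
      with ae show "AE x in lebesgue. x \<in> {a..<b} \<longrightarrow> P x" by eventually_elim auto }
  qed
  then show ?thesis by (simp add: AE_restrict_space_iff)
qed

lemma nn_integral_lebesgue_on_Ico_eq_Icc:
  "(\<integral>\<^sup>+x. f x \<partial>lebesgue_on {a..<b::real}) = (\<integral>\<^sup>+x. f x \<partial>lebesgue_on {a..b})"
proof -
  have "{b} \<in> null_sets lebesgue" using negligible_iff_null_sets[of "{b}"] by simp
  then have "AE x in lebesgue. x \<notin> {b}" by (rule AE_not_in)
  then have "AE x in lebesgue. f x * indicator {a..<b} x = f x * indicator {a..b} x"
    by eventually_elim (auto simp: indicator_def)
  then have "(\<integral>\<^sup>+x. f x * indicator {a..<b} x \<partial>lebesgue) = (\<integral>\<^sup>+x. f x * indicator {a..b} x \<partial>lebesgue)"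
    by (rule nn_integral_cong_AE)
  then show ?thesis by (simp add: nn_integral_restrict_space)
qed

lemma ereal_integral_lebesgue_on_Ico_eq_Icc:
  "ereal_integral (lebesgue_on {a..<b::real}) f = ereal_integral (lebesgue_on {a..b}) f"
  by (simp add: ereal_integral_def nn_integral_lebesgue_on_Ico_eq_Icc)

lemma strongly_measurable_Ico_iff_Icc:
  fixes f :: "real \<Rightarrow> 'b::real_normed_vector"
  shows "strongly_measurable (lebesgue_on {a..<b}) f \<longleftrightarrow> strongly_measurable (lebesgue_on {a..b}) f"
proof
  have "{a..b} - {a..<b} \<subseteq> {b}" by auto
  then have "negligible ({a..b} - {a..<b})" by (rule negligible_subset[rotated]) simp
  then show "strongly_measurable (lebesgue_on {a..b}) f" if "strongly_measurable (lebesgue_on {a..<b}) f"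
    by (intro strongly_measurable_restrict[OF that]) auto
  have "{a..<b} - {a..b} = {}" by auto
  then have "negligible ({a..<b} - {a..b})" by (simp only: negligible_empty)
  then show "strongly_measurable (lebesgue_on {a..<b}) f" if "strongly_measurable (lebesgue_on {a..b}) f"
    by (intro strongly_measurable_restrict[OF that]) auto
qed

lemma strongly_measurable_scaleR_continuous:
  fixes f :: "real \<Rightarrow> 'b::real_normed_vector"
  assumes c: "continuous_on {a..b} c" and f: "strongly_measurable (lebesgue_on {a..b}) f"
  shows "strongly_measurable (lebesgue_on {a..b}) (\<lambda>x. c x *\<^sub>R f x)"
proof (rule strongly_measurable_continuous_compose[OF _ f])
  have "continuous_on ({a..b} \<times> UNIV) (\<lambda>p. c (fst p))"
    by (rule continuous_on_compose2[OF c continuous_on_fst[OF continuous_on_id]]) auto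
  then show "continuous_on ({a..b} \<times> UNIV) (\<lambda>(x, z). c x *\<^sub>R (z::'b))"
    unfolding case_prod_beta by (intro continuous_on_scaleR continuous_on_snd continuous_on_id)
qed

lemma continuous_on_interval_norm_bound:
  fixes f :: "real \<Rightarrow> 'b::real_normed_vector"
  assumes "continuous_on {a..b} f"
  obtains C where "0 \<le> C" "\<And>x. x \<in> {a..b} \<Longrightarrow> norm (f x) \<le> C"
proof -
  have "bounded (f ` {a..b})"
    by (intro compact_imp_bounded compact_continuous_image assms) simp
  then obtain C where C: "\<forall>y\<in>f ` {a..b}. norm y \<le> C" unfolding bounded_iff ..
  show ?thesis
  proof (rule that[of "\<bar>C\<bar>"])
    fix x assume "x \<in> {a..b}"
    then have "norm (f x) \<le> C" using C by simp
    then show "norm (f x) \<le> \<bar>C\<bar>" by simp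
  qed simp
qed

lemma Lspace_weighted_strongly_measurable:
  fixes f :: "real \<Rightarrow> 'b::real_normed_vector"
  assumes "f \<in> Lspace_weighted r lam t T"
  shows "strongly_measurable (lebesgue_on {t..T}) f"
proof -
  have "strongly_measurable (lebesgue_on {t..T}) (\<lambda>\<tau>. exp (- lam * \<tau> / r) *\<^sub>R f \<tau>)"
    using assms by (simp add: Lspace_weighted_def Lspace_def strongly_measurable_Ico_iff_Icc)
  then have "strongly_measurable (lebesgue_on {t..T}) (\<lambda>\<tau>. exp (lam * \<tau> / r) *\<^sub>R exp (- lam * \<tau> / r) *\<^sub>R f \<tau>)"
    by (rule strongly_measurable_scaleR_continuous[rotated]) (cases "r = 0", auto intro!: continuous_intros)
  then show ?thesis by (simp flip: exp_add)
qed

text \<open>From \<open>(x + y) powr r \<le> 2 powr r * (x powr r + y powr r)\<close>, since the weight is bounded on \<open>[t, T]\<close>.\<close>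

lemma Lspace_weighted_dominated:
  fixes f :: "real \<Rightarrow> 'b::real_normed_vector" and g :: "real \<Rightarrow> 'c::real_normed_vector"
  assumes f: "strongly_measurable (lebesgue_on {t..T}) f" and r: "0 < r"
    and g: "g \<in> Lspace_weighted r lam t T" and C: "0 \<le> C"
    and le: "\<And>\<tau>. \<tau> \<in> {t..T} \<Longrightarrow> norm (f \<tau>) \<le> norm (g \<tau>) + C"
  shows "f \<in> Lspace_weighted r lam t T"
proof -
  let ?M = "lebesgue_on {t..T}"
  let ?e = "\<lambda>\<tau>. exp (- lam * \<tau> / r)"
  interpret complete_measure ?M by (rule complete_measure_lebesgue_on) simp
  have [measurable]: "g \<in> borel_measurable ?M"
    by (intro strongly_measurable_imp_borel Lspace_weighted_strongly_measurable[OF g])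
  have ce: "continuous_on {t..T} ?e" by (cases "r = 0") (auto intro!: continuous_intros)
  have me: "strongly_measurable ?M (\<lambda>\<tau>. ?e \<tau> *\<^sub>R f \<tau>)"
    by (rule strongly_measurable_scaleR_continuous[OF ce f])
  have mg: "(\<lambda>\<tau>. ?e \<tau> *\<^sub>R g \<tau>) \<in> borel_measurable ?M"
    by (intro strongly_measurable_imp_borel strongly_measurable_scaleR_continuous[OF ce]
        Lspace_weighted_strongly_measurable[OF g])
  have gfin: "(\<integral>\<^sup>+\<tau>. ennreal (norm (?e \<tau> *\<^sub>R g \<tau>) powr r) \<partial>?M) < \<infinity>"
    using g by (simp add: Lspace_weighted_def Lspace_def nn_integral_lebesgue_on_Ico_eq_Icc)
  have cfin: "(\<integral>\<^sup>+\<tau>. ennreal ((?e \<tau> * C) powr r) \<partial>?M) < \<infinity>"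
  proof -
    have "continuous_on {t..T} (\<lambda>\<tau>. (?e \<tau> * C) powr r)"
      using C r ce by (intro continuous_on_powr' continuous_on_mult continuous_on_const) auto
    then have "integrable ?M (\<lambda>\<tau>. (?e \<tau> * C) powr r)" by (rule continuous_imp_integrable_real)
    then have "(\<integral>\<^sup>+\<tau>. ennreal (norm ((?e \<tau> * C) powr r)) \<partial>?M) < \<infinity>" by (simp add: integrable_iff_bounded)
    then show ?thesis by simp
  qed
  have pw: "ennreal (norm (?e \<tau> *\<^sub>R f \<tau>) powr r) \<le>
      ennreal (2 powr r) * (ennreal (norm (?e \<tau> *\<^sub>R g \<tau>) powr r) + ennreal ((?e \<tau> * C) powr r))"
    if "\<tau> \<in> {t..T}" for \<tau>
  proof -
    define x y where "x = norm (?e \<tau> *\<^sub>R g \<tau>)" and "y = ?e \<tau> * C"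
    have xy: "0 \<le> x" "0 \<le> y" using C by (auto simp: x_def y_def)
    have "norm (?e \<tau> *\<^sub>R f \<tau>) \<le> ?e \<tau> * (norm (g \<tau>) + C)"
      using le[OF that] by (simp add: mult_left_mono)
    then have "norm (?e \<tau> *\<^sub>R f \<tau>) \<le> x + y" by (simp add: x_def y_def distrib_left)
    then have "norm (?e \<tau> *\<^sub>R f \<tau>) powr r \<le> (2 * max x y) powr r"
      using r by (intro powr_mono2) (auto simp: max_def)
    also have "\<dots> = 2 powr r * max x y powr r" using xy by (simp add: powr_mult)
    also have "\<dots> \<le> 2 powr r * (x powr r + y powr r)"
      by (intro mult_left_mono) (simp_all add: max_def)
    finally have "ennreal (norm (?e \<tau> *\<^sub>R f \<tau>) powr r) \<le> ennreal (2 powr r * (x powr r + y powr r))"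
      by (rule ennreal_leI)
    then show ?thesis by (simp add: x_def y_def ennreal_mult ennreal_plus)
  qed
  have "(\<integral>\<^sup>+\<tau>. ennreal (norm (?e \<tau> *\<^sub>R f \<tau>) powr r) \<partial>?M) \<le>
      (\<integral>\<^sup>+\<tau>. ennreal (2 powr r) * (ennreal (norm (?e \<tau> *\<^sub>R g \<tau>) powr r) + ennreal ((?e \<tau> * C) powr r)) \<partial>?M)"
    by (rule nn_integral_mono) (use pw in simp)
  also have "\<dots> = ennreal (2 powr r) * ((\<integral>\<^sup>+\<tau>. ennreal (norm (?e \<tau> *\<^sub>R g \<tau>) powr r) \<partial>?M)
      + (\<integral>\<^sup>+\<tau>. ennreal ((?e \<tau> * C) powr r) \<partial>?M))"
  proof -
    have X: "(\<lambda>\<tau>. ennreal (norm (?e \<tau> *\<^sub>R g \<tau>) powr r)) \<in> borel_measurable ?M"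
      using mg by (rule measurable_compose) measurable
    have "(\<lambda>\<tau>. ennreal ((?e \<tau> * C) powr r)) \<in> borel_measurable borel" by measurable
    then have Y: "(\<lambda>\<tau>. ennreal ((?e \<tau> * C) powr r)) \<in> borel_measurable ?M"
      by (intro measurable_restrict_space1 measurable_completion) simp
    show ?thesis
      unfolding nn_integral_add[OF X Y, symmetric]
      by (rule nn_integral_cmult) (intro borel_measurable_add X Y)
  qed
  also have "\<dots> < \<infinity>"
    using gfin cfin ennreal_less_top[of "2 powr r"] unfolding infinity_ennreal_def ennreal_mult_less_top ennreal_add_less_top by blast
  finally show ?thesis
    using me by (simp add: Lspace_weighted_def Lspace_def strongly_measurable_Ico_iff_Icc
        nn_integral_lebesgue_on_Ico_eq_Icc)
qed

lemma Lspace_weighted_continuous: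
  fixes f :: "real \<Rightarrow> 'b::real_normed_vector"
  assumes f: "continuous_on {t..T} f" and r: "0 < r"
  shows "f \<in> Lspace_weighted r lam t T"
proof -
  obtain C where C: "0 \<le> C" "\<And>\<tau>. \<tau> \<in> {t..T} \<Longrightarrow> norm (f \<tau>) \<le> C"
    using continuous_on_interval_norm_bound[OF f] by metis
  have "simple_function (lebesgue_on {t..<T}) (\<lambda>_. 0::real)" by simp
  then have z: "(\<lambda>_. 0::real) \<in> Lspace_weighted r lam t T"
    using r by (simp add: Lspace_weighted_def Lspace_def strongly_measurable_simple_function)
  have "norm (f \<tau>) \<le> norm (0::real) + C" if "\<tau> \<in> {t..T}" for \<tau> using C(2)[OF that] by simp
  then show ?thesis
    by (rule Lspace_weighted_dominated[OF strongly_measurable_continuous[OF f] r z C(1)])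
qed

text \<open>On a bounded interval the weight is bounded away from zero, and \<open>x \<le> 1 + x powr r\<close>.\<close>

lemma Lspace_weighted_bochner_integrable:
  fixes f :: "real \<Rightarrow> 'b::real_normed_vector"
  assumes f: "f \<in> Lspace_weighted r lam t T" and r: "1 \<le> r"
  shows "bochner_integrable (lebesgue_on {t..T}) f"
proof -
  let ?M = "lebesgue_on {t..T}"
  let ?e = "\<lambda>\<tau>. exp (- lam * \<tau> / r)"
  interpret complete_measure ?M by (rule complete_measure_lebesgue_on) simp
  have sm: "strongly_measurable ?M f" by (rule Lspace_weighted_strongly_measurable[OF f])
  have ce: "continuous_on {t..T} ?e" using r by (intro continuous_intros) auto
  have "(\<lambda>\<tau>. ?e \<tau> *\<^sub>R f \<tau>) \<in> borel_measurable ?M"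
    by (intro strongly_measurable_imp_borel strongly_measurable_scaleR_continuous[OF ce] sm)
  then have "(\<lambda>\<tau>. norm (?e \<tau> *\<^sub>R f \<tau>) powr r) \<in> borel_measurable ?M"
    by (rule measurable_compose) measurable
  moreover have "(\<integral>\<^sup>+\<tau>. ennreal (norm (?e \<tau> *\<^sub>R f \<tau>) powr r) \<partial>?M) < \<infinity>"
    using f by (simp add: Lspace_weighted_def Lspace_def nn_integral_lebesgue_on_Ico_eq_Icc)
  ultimately have i: "integrable ?M (\<lambda>\<tau>. norm (?e \<tau> *\<^sub>R f \<tau>) powr r)"
    by (simp add: integrable_iff_bounded)
  have "continuous_on {t..T} (\<lambda>\<tau>. exp (lam * \<tau> / r))" using r by (intro continuous_intros) auto
  then obtain K where K0: "0 \<le> K" and K: "\<And>\<tau>. \<tau> \<in> {t..T} \<Longrightarrow> norm (exp (lam * \<tau> / r)) \<le> K"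
    using continuous_on_interval_norm_bound by metis
  show ?thesis
  proof (rule bochner_integrable_bound[OF sm])
    interpret finite_measure ?M by (rule finite_measure_lebesgue_on_interval)
    show "integrable ?M (\<lambda>\<tau>. K * (1 + norm (?e \<tau> *\<^sub>R f \<tau>) powr r))" using i by simp
    fix \<tau> assume \<tau>: "\<tau> \<in> {t..T}"
    define x where "x = norm (?e \<tau> *\<^sub>R f \<tau>)"
    have x: "0 \<le> x" by (simp add: x_def)
    have "x \<le> 1 + x powr r"
    proof (cases "x \<le> 1")
      case True
      have "0 \<le> x powr r" by simp
      with True show ?thesis by linarith
    next
      case False
      then have "x powr 1 \<le> x powr r" using r by (intro powr_mono) auto
      then show ?thesis using False by simp
    qed
    have "norm (f \<tau>) = exp (lam * \<tau> / r) * x" by (simp add: x_def flip: exp_add)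
    also have "\<dots> \<le> K * x" using K[OF \<tau>] x by (intro mult_right_mono) auto
    also have "\<dots> \<le> K * (1 + x powr r)"
      using \<open>x \<le> 1 + x powr r\<close> K0 by (rule mult_left_mono)
    finally show "norm (f \<tau>) \<le> K * (1 + norm (?e \<tau> *\<^sub>R f \<tau>) powr r)" by (simp add: x_def)
  qed
qed

section \<open>Integrals with a variable end point\<close>

text \<open>The integral over the variable interval is the integral over \<open>[a, b]\<close> of the integrand cut off
  outside of it. For fixed \<open>\<sigma>\<close> the cut-off integrand is continuous in \<open>\<tau>\<close> except at \<open>\<tau> = \<sigma>\<close>.\<close>

lemma continuous_on_integral_variable_end:
  fixes P :: "real \<Rightarrow> real \<Rightarrow> 'b::{real_inner, complete_space}"
  assumes P: "\<And>\<tau>. \<tau> \<in> {a..b} \<Longrightarrow> bochner_integrable (lebesgue_on {a..b}) (P \<tau>)"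
    and h: "integrable (lebesgue_on {a..b}) h"
    and le: "\<And>\<tau> \<sigma>. \<tau> \<in> {a..b} \<Longrightarrow> \<sigma> \<in> {a..b} \<Longrightarrow> norm (P \<tau> \<sigma>) \<le> h \<sigma>"
    and cont: "\<And>\<sigma>. \<sigma> \<in> {a..b} \<Longrightarrow> continuous_on {a..b} (\<lambda>\<tau>. P \<tau> \<sigma>)"
  shows "continuous_on {a..b} (\<lambda>\<tau>. integral {a..\<tau>} (P \<tau>))"
    and "continuous_on {a..b} (\<lambda>\<tau>. integral {\<tau>..b} (P \<tau>))"
proof -
  let ?M = "lebesgue_on {a..b}"
  have h0: "0 \<le> h \<sigma>" if "\<sigma> \<in> {a..b}" for \<sigma>
    by (rule order_trans[OF norm_ge_zero le[OF that that]])
  have ae: "AE \<sigma> in ?M. \<sigma> \<noteq> \<tau> \<and> \<sigma> \<in> {a..b}" for \<tau>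
  proof -
    have "{\<tau>} \<in> null_sets lebesgue" using negligible_iff_null_sets[of "{\<tau>}"] by simp
    then have "AE \<sigma> in lebesgue. \<sigma> \<notin> {\<tau>}" by (rule AE_not_in)
    then have "AE \<sigma> in lebesgue. \<sigma> \<in> {a..b} \<longrightarrow> \<sigma> \<notin> {\<tau>}" by eventually_elim simp
    then have "AE \<sigma> in ?M. \<sigma> \<notin> {\<tau>}" by (simp add: AE_restrict_space_iff)
    then show ?thesis using AE_space by eventually_elim simp
  qed
  have key: "continuous_on {a..b} (\<lambda>\<tau>. integral {a..b} (\<lambda>\<sigma>. if \<sigma> \<in> J \<tau> then P \<tau> \<sigma> else 0))"
    if J: "\<And>\<tau>. \<tau> \<in> {a..b} \<Longrightarrow> J \<tau> = {c \<tau>..d \<tau>} \<and> {c \<tau>..d \<tau>} \<subseteq> {a..b}"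
      and loc: "\<And>\<tau> \<sigma>. \<tau> \<noteq> \<sigma> \<Longrightarrow> \<tau> \<in> {a..b} \<Longrightarrow> \<sigma> \<in> {a..b} \<Longrightarrow>
        eventually (\<lambda>r. \<sigma> \<in> J r \<longleftrightarrow> \<sigma> \<in> J \<tau>) (at \<tau> within {a..b})" for J c d
  proof (rule continuous_on_parameter_integral[OF _ h])
    fix \<tau> assume \<tau>: "\<tau> \<in> {a..b}"
    have "bochner_integrable (lebesgue_on {c \<tau>..d \<tau>}) (P \<tau>)"
      using bochner_integrable_mono[OF P[OF \<tau>]] J[OF \<tau>] by blast
    from bochner_integrable_restrict_interval(1)[OF this] J[OF \<tau>]
    show "bochner_integrable ?M (\<lambda>\<sigma>. if \<sigma> \<in> J \<tau> then P \<tau> \<sigma> else 0)" by simp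
    show "norm (if \<sigma> \<in> J \<tau> then P \<tau> \<sigma> else 0) \<le> h \<sigma>" if "\<sigma> \<in> {a..b}" for \<sigma>
      using le[OF \<tau> that] h0[OF that] by simp
    show "AE \<sigma> in ?M. continuous (at \<tau> within {a..b}) (\<lambda>\<tau>. if \<sigma> \<in> J \<tau> then P \<tau> \<sigma> else 0)"
      using ae[of \<tau>]
    proof eventually_elim
      case (elim \<sigma>)
      have lim: "((\<lambda>\<tau>. P \<tau> \<sigma>) \<longlongrightarrow> P \<tau> \<sigma>) (at \<tau> within {a..b})"
        using cont[of \<sigma>] elim \<tau> unfolding continuous_on_def by blast
      have ev: "eventually (\<lambda>r. \<sigma> \<in> J r \<longleftrightarrow> \<sigma> \<in> J \<tau>) (at \<tau> within {a..b})"
        using loc[of \<tau> \<sigma>] elim \<tau> by blast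
      show ?case
      proof (cases "\<sigma> \<in> J \<tau>")
        case True
        have "eventually (\<lambda>r. P r \<sigma> = (if \<sigma> \<in> J r then P r \<sigma> else 0)) (at \<tau> within {a..b})"
          using ev by eventually_elim (simp add: True)
        from Lim_transform_eventually[OF lim this] show ?thesis using True by (simp add: continuous_within)
      next
        case False
        have "eventually (\<lambda>r. 0 = (if \<sigma> \<in> J r then P r \<sigma> else 0)) (at \<tau> within {a..b})"
          using ev by eventually_elim (simp add: False)
        from Lim_transform_eventually[OF tendsto_const this] show ?thesis
          using False by (simp add: continuous_within)
      qed
    qed
  qed
  have lt: "eventually (\<lambda>r. (\<sigma> < r) = (\<sigma> < \<tau>) \<and> (r < \<sigma>) = (\<tau> < \<sigma>)) (at \<tau> within {a..b})"
    if "\<tau> \<noteq> \<sigma>" for \<sigma> \<tau>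
  proof -
    have id: "((\<lambda>r. r) \<longlongrightarrow> \<tau>) (at \<tau> within {a..b})" by (rule tendsto_ident_at)
    show ?thesis
    proof (cases "\<tau> < \<sigma>")
      case True
      show ?thesis using order_tendstoD(2)[OF id True] by eventually_elim (use True in auto)
    next
      case False
      then have "\<sigma> < \<tau>" using that by simp
      show ?thesis using order_tendstoD(1)[OF id \<open>\<sigma> < \<tau>\<close>] by eventually_elim (use \<open>\<sigma> < \<tau>\<close> in auto)
    qed
  qed
  have int: "integral {a..b} (\<lambda>\<sigma>. if \<sigma> \<in> {c..d} then P \<tau> \<sigma> else 0) = integral {c..d} (P \<tau>)"
    if "\<tau> \<in> {a..b}" "{c..d} \<subseteq> {a..b}" for \<tau> c d
    by (rule bochner_integrable_restrict_interval(2)[OF bochner_integrable_mono[OF P[OF that(1)] that(2)] that(2)])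
  have "continuous_on {a..b} (\<lambda>\<tau>. integral {a..b} (\<lambda>\<sigma>. if \<sigma> \<in> {a..\<tau>} then P \<tau> \<sigma> else 0))"
  proof (rule key[where c="\<lambda>_. a" and d="\<lambda>\<tau>. \<tau>"])
    fix \<tau> \<sigma> assume n: "\<tau> \<noteq> \<sigma>" "\<sigma> \<in> {a..b}"
    show "eventually (\<lambda>r. \<sigma> \<in> {a..r} \<longleftrightarrow> \<sigma> \<in> {a..\<tau>}) (at \<tau> within {a..b})"
      using lt[OF n(1)] by eventually_elim (use n(2) in \<open>auto simp: not_less[symmetric]\<close>)
  qed auto
  then show "continuous_on {a..b} (\<lambda>\<tau>. integral {a..\<tau>} (P \<tau>))"
    by (rule continuous_on_eq) (rule int, auto)
  have "continuous_on {a..b} (\<lambda>\<tau>. integral {a..b} (\<lambda>\<sigma>. if \<sigma> \<in> {\<tau>..b} then P \<tau> \<sigma> else 0))"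
  proof (rule key[where c="\<lambda>\<tau>. \<tau>" and d="\<lambda>_. b"])
    fix \<tau> \<sigma> assume n: "\<tau> \<noteq> \<sigma>" "\<sigma> \<in> {a..b}"
    show "eventually (\<lambda>r. \<sigma> \<in> {r..b} \<longleftrightarrow> \<sigma> \<in> {\<tau>..b}) (at \<tau> within {a..b})"
      using lt[OF n(1)] by eventually_elim (use n(2) in \<open>auto simp: not_less[symmetric]\<close>)
  qed auto
  then show "continuous_on {a..b} (\<lambda>\<tau>. integral {\<tau>..b} (P \<tau>))"
    by (rule continuous_on_eq) (rule int, auto)
qed

section \<open>Trajectories, costates and the duality between them\<close>

locale linear_control = dual_pair pr
  for pr :: "'v::{real_inner, complete_space} \<Rightarrow> 'w::{real_inner, complete_space} \<Rightarrow> real" +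
  fixes S :: "real \<Rightarrow> 'w \<Rightarrow>\<^sub>L 'w" and B :: "'u::{real_inner, complete_space} \<Rightarrow>\<^sub>L 'w"
    and \<omega> lam t T :: real
  assumes C0: "C0_semigroup S" and \<omega>: "0 \<le> \<omega>"
    and growth: "\<And>s z. 0 \<le> s \<Longrightarrow> norm (blinfun_apply (S s) z) \<le> exp (\<omega> * s) * norm z"
begin

abbreviation M where "M \<equiv> lebesgue_on {t..T}"

text \<open>The part of the trajectory that is caused by the control. It is linear in the control, so it is
  also the change of the trajectory under a variation of the control.\<close>

definition response :: "(real \<Rightarrow> 'u) \<Rightarrow> real \<Rightarrow> 'w" where
  "response d \<tau> = integral {t..\<tau>} (\<lambda>\<sigma>. blinfun_apply (S (\<tau> - \<sigma>)) (blinfun_apply B (d \<sigma>)))"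

text \<open>The mild solution of the adjoint equation with source \<open>\<gamma>\<close> and value zero at \<open>T\<close>.\<close>

definition costate :: "(real \<Rightarrow> 'v) \<Rightarrow> real \<Rightarrow> 'v" where
  "costate \<gamma> \<tau> = integral {\<tau>..T} (\<lambda>\<sigma>. exp (- lam * (\<sigma> - \<tau>)) *\<^sub>R pairing_adjoint pr (S (\<sigma> - \<tau>)) (\<gamma> \<sigma>))"

lemma semigroup_law:
  "0 \<le> s \<Longrightarrow> 0 \<le> r \<Longrightarrow> blinfun_apply (S (s + r)) x = blinfun_apply (S s) (blinfun_apply (S r) x)"
  and semigroup_0: "blinfun_apply (S 0) x = x"
  and semigroup_at_0: "((\<lambda>s. blinfun_apply (S s) x) \<longlongrightarrow> x) (at_right 0)"
  using C0 by (auto simp: C0_semigroup_def)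

lemma semigroup_continuous: "continuous_on ({0..} \<times> UNIV) (\<lambda>(s, z). blinfun_apply (S s) z)"
  by (rule semigroup_jointly_continuous[OF _ semigroup_law growth \<omega> semigroup_at_0 semigroup_0])
     (auto simp: blinfun.bounded_linear_right bounded_linear.linear)

lemma continuous_on_semigroup:
  assumes "continuous_on A f" "continuous_on A g" "\<And>p. p \<in> A \<Longrightarrow> 0 \<le> f p"
  shows "continuous_on A (\<lambda>p. blinfun_apply (S (f p)) (g p))"
  using continuous_on_compose2[OF semigroup_continuous continuous_on_Pair[OF assms(1,2)]] assms(3)
  by (auto simp: image_subset_iff)

lemma continuous_on_adjoint:
  assumes "continuous_on A f" "continuous_on A g" "\<And>p. p \<in> A \<Longrightarrow> 0 \<le> f p"
  shows "continuous_on A (\<lambda>p. pairing_adjoint pr (S (f p)) (g p))"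
proof -
  have "continuous_on {0..} (\<lambda>s. blinfun_apply (S s) w)" for w
    by (intro continuous_on_semigroup continuous_on_id continuous_on_const) auto
  then have "continuous_on ({0..} \<times> UNIV) (\<lambda>(s, v). pairing_adjoint pr (S s) v)"
    by (intro adjoint_semigroup_jointly_continuous[where \<omega>=\<omega>])
       (simp_all add: semigroup_law semigroup_0 growth \<omega>)
  from continuous_on_compose2[OF this continuous_on_Pair[OF assms(1,2)]] assms(3)
  show ?thesis by (auto simp: image_subset_iff)
qed

lemma growth_on_interval:
  assumes "0 \<le> s" "s \<le> T - t"
  shows "norm (blinfun_apply (S s) z) \<le> exp (\<omega> * (T - t)) * norm z"
proof -
  have "norm (blinfun_apply (S s) z) \<le> exp (\<omega> * s) * norm z" using assms(1) by (rule growth)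
  also have "\<dots> \<le> exp (\<omega> * (T - t)) * norm z"
    using assms \<omega> by (intro mult_right_mono) (auto intro: mult_left_mono)
  finally show ?thesis .
qed

lemma response_integrand_bound:
  assumes "0 \<le> s" "s \<le> T - t"
  shows "norm (blinfun_apply (S s) (blinfun_apply B z)) \<le> exp (\<omega> * (T - t)) * norm B * norm z"
proof -
  have "norm (blinfun_apply (S s) (blinfun_apply B z)) \<le> exp (\<omega> * (T - t)) * norm (blinfun_apply B z)"
    using assms by (rule growth_on_interval)
  also have "\<dots> \<le> exp (\<omega> * (T - t)) * (norm B * norm z)" by (intro mult_left_mono norm_blinfun) simp
  finally show ?thesis by (simp add: mult.assoc)
qed

text \<open>The maximum with zero leaves the integrand unchanged on \<open>[t, \<tau>]\<close>, where it is integrated, and makes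
  it jointly continuous on the whole interval; the semigroup is controlled for nonnegative times
  only. The same device is used for the costate.\<close>

lemma response_integrand_integrable:
  assumes d: "bochner_integrable M d" and \<tau>: "\<tau> \<in> {t..T}"
  shows "bochner_integrable M (\<lambda>\<sigma>. blinfun_apply (S (max 0 (\<tau> - \<sigma>))) (blinfun_apply B (d \<sigma>)))"
proof (rule bochner_integrable_bound)
  have "continuous_on ({t..T} \<times> UNIV)
      (\<lambda>p. blinfun_apply (S (max 0 (\<tau> - fst p))) (blinfun_apply B (snd p)))"
    by (intro continuous_on_semigroup continuous_intros continuous_on_max) auto
  then show "strongly_measurable M (\<lambda>\<sigma>. blinfun_apply (S (max 0 (\<tau> - \<sigma>))) (blinfun_apply B (d \<sigma>)))"
    using d unfolding bochner_integrable_def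
    by (intro strongly_measurable_continuous_compose[where
          F="\<lambda>\<sigma> z. blinfun_apply (S (max 0 (\<tau> - \<sigma>))) (blinfun_apply B z)"])
       (simp_all add: case_prod_beta)
  show "integrable M (\<lambda>\<sigma>. exp (\<omega> * (T - t)) * norm B * norm (d \<sigma>))"
    using d by (simp add: bochner_integrable_def)
  show "norm (blinfun_apply (S (max 0 (\<tau> - \<sigma>))) (blinfun_apply B (d \<sigma>)))
      \<le> exp (\<omega> * (T - t)) * norm B * norm (d \<sigma>)" if "\<sigma> \<in> {t..T}" for \<sigma>
    by (rule response_integrand_bound) (use that \<tau> in auto)
qed

lemma response_eq:
  "response d \<tau> = integral {t..\<tau>} (\<lambda>\<sigma>. blinfun_apply (S (max 0 (\<tau> - \<sigma>))) (blinfun_apply B (d \<sigma>)))"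
  unfolding response_def by (rule Henstock_Kurzweil_Integration.integral_cong) auto

lemma continuous_on_response:
  assumes d: "bochner_integrable M d"
  shows "continuous_on {t..T} (response d)"
  unfolding response_eq[abs_def]
proof (rule continuous_on_integral_variable_end(1)[OF response_integrand_integrable[OF d]])
  show "integrable M (\<lambda>\<sigma>. exp (\<omega> * (T - t)) * norm B * norm (d \<sigma>))"
    using d by (simp add: bochner_integrable_def)
  show "norm (blinfun_apply (S (max 0 (\<tau> - \<sigma>))) (blinfun_apply B (d \<sigma>)))
      \<le> exp (\<omega> * (T - t)) * norm B * norm (d \<sigma>)" if "\<tau> \<in> {t..T}" "\<sigma> \<in> {t..T}" for \<tau> \<sigma>
    by (rule response_integrand_bound) (use that in auto)
  show "continuous_on {t..T} (\<lambda>\<tau>. blinfun_apply (S (max 0 (\<tau> - \<sigma>))) (blinfun_apply B (d \<sigma>)))" for \<sigma>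
    by (intro continuous_on_semigroup continuous_intros continuous_on_max) auto
qed

lemma response_linear:
  assumes u: "bochner_integrable M u" and d: "bochner_integrable M d" and \<tau>: "\<tau> \<in> {t..T}"
  shows "response (\<lambda>\<sigma>. u \<sigma> + c *\<^sub>R d \<sigma>) \<tau> = response u \<tau> + c *\<^sub>R response d \<tau>"
proof -
  have sub: "{t..\<tau>} \<subseteq> {t..T}" using \<tau> by auto
  have i: "(\<lambda>\<sigma>. blinfun_apply (S (max 0 (\<tau> - \<sigma>))) (blinfun_apply B (f \<sigma>))) integrable_on {t..\<tau>}"
    if "bochner_integrable M f" for f
    by (intro bochner_integrable_imp_integrable_on
        bochner_integrable_mono[OF response_integrand_integrable[OF that \<tau>] sub])
  show ?thesis
    unfolding response_eq blinfun.add_right blinfun.scaleR_right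
    by (subst integral_add[OF i[OF u] integrable_cmul[OF i[OF d]]]) simp
qed

lemma trajectory_eq: "trajectory S B t x u \<tau> = blinfun_apply (S (\<tau> - t)) x + response u \<tau>"
  by (simp add: trajectory_def response_def)

lemma continuous_on_trajectory:
  assumes "bochner_integrable M u"
  shows "continuous_on {t..T} (trajectory S B t x u)"
  unfolding trajectory_eq[abs_def]
  by (intro continuous_on_add continuous_on_response[OF assms] continuous_on_semigroup continuous_intros) auto

lemma costate_integrand_continuous:
  assumes \<gamma>: "continuous_on {t..T} \<gamma>"
  shows "continuous_on {t..T} (\<lambda>\<sigma>. exp (- lam * (\<sigma> - \<tau>)) *\<^sub>R pairing_adjoint pr (S (max 0 (\<sigma> - \<tau>))) (\<gamma> \<sigma>))"
  by (intro continuous_intros continuous_on_adjoint continuous_on_max \<gamma>) auto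

lemma costate_eq:
  "costate \<gamma> \<tau> = integral {\<tau>..T} (\<lambda>\<sigma>. exp (- lam * (\<sigma> - \<tau>)) *\<^sub>R pairing_adjoint pr (S (max 0 (\<sigma> - \<tau>))) (\<gamma> \<sigma>))"
  unfolding costate_def by (rule Henstock_Kurzweil_Integration.integral_cong) auto

lemma continuous_on_costate:
  assumes \<gamma>: "continuous_on {t..T} \<gamma>"
  shows "continuous_on {t..T} (costate \<gamma>)"
proof -
  obtain C where C: "0 \<le> C" "\<And>\<sigma>. \<sigma> \<in> {t..T} \<Longrightarrow> norm (\<gamma> \<sigma>) \<le> C"
    using continuous_on_interval_norm_bound[OF \<gamma>] by metis
  let ?K = "exp (\<bar>lam\<bar> * (T - t)) * (exp (\<omega> * (T - t)) * C)"
  show ?thesis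
    unfolding costate_eq[abs_def]
  proof (rule continuous_on_integral_variable_end(2)[where h="\<lambda>_. ?K"])
    show "bochner_integrable M (\<lambda>\<sigma>. exp (- lam * (\<sigma> - \<tau>)) *\<^sub>R pairing_adjoint pr (S (max 0 (\<sigma> - \<tau>))) (\<gamma> \<sigma>))" for \<tau>
      by (rule bochner_integrable_continuous[OF costate_integrand_continuous[OF \<gamma>]])
    show "integrable M (\<lambda>_. ?K)"
      using finite_measure.integrable_const[OF finite_measure_lebesgue_on_interval] .
    show "norm (exp (- lam * (\<sigma> - \<tau>)) *\<^sub>R pairing_adjoint pr (S (max 0 (\<sigma> - \<tau>))) (\<gamma> \<sigma>)) \<le> ?K"
      if ts: "\<tau> \<in> {t..T}" "\<sigma> \<in> {t..T}" for \<tau> \<sigma>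
    proof -
      have "- lam * (\<sigma> - \<tau>) \<le> \<bar>lam * (\<sigma> - \<tau>)\<bar>" by simp
      also have "\<dots> \<le> \<bar>lam\<bar> * (T - t)" unfolding abs_mult using ts by (intro mult_left_mono) auto
      finally have 1: "exp (- lam * (\<sigma> - \<tau>)) \<le> exp (\<bar>lam\<bar> * (T - t))" by simp
      have "norm (pairing_adjoint pr (S (max 0 (\<sigma> - \<tau>))) (\<gamma> \<sigma>)) \<le> exp (\<omega> * (T - t)) * norm (\<gamma> \<sigma>)"
        by (rule norm_pairing_adjoint_le) (use ts growth_on_interval in auto)
      also have "\<dots> \<le> exp (\<omega> * (T - t)) * C" using C(2)[OF ts(2)] by simp
      finally show ?thesis using 1 by (simp add: mult_mono)
    qed
    show "continuous_on {t..T} (\<lambda>\<tau>. exp (- lam * (\<sigma> - \<tau>)) *\<^sub>R pairing_adjoint pr (S (max 0 (\<sigma> - \<tau>))) (\<gamma> \<sigma>))"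
      for \<sigma>
      by (intro continuous_intros continuous_on_adjoint continuous_on_max) auto
  qed
qed

text \<open>Integration by parts for mild solutions: both sides are the integral of
  \<open>exp (- lam * \<tau>) * pr (\<gamma> \<tau>) (S (\<tau> - \<sigma>) (B (d \<sigma>)))\<close> over the triangle \<open>t \<le> \<sigma> \<le> \<tau> \<le> T\<close>.\<close>

lemma response_costate_duality:
  assumes \<gamma>: "continuous_on {t..T} \<gamma>" and d: "bochner_integrable M d"
  shows "(LINT \<tau>|M. exp (- lam * \<tau>) * pr (\<gamma> \<tau>) (response d \<tau>)) =
         (LINT \<sigma>|M. exp (- lam * \<sigma>) * inner (control_adjoint pr B (costate \<gamma> \<sigma>)) (d \<sigma>))"
proof -
  define \<Delta> where "\<Delta> = {p. t \<le> snd p \<and> snd p \<le> fst p \<and> fst p \<le> T}"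
  define \<Lambda> where "\<Lambda> \<tau> \<sigma> z = indicator \<Delta> (\<tau>, \<sigma>) *
      (exp (- lam * \<tau>) * pr (\<gamma> \<tau>) (blinfun_apply (S (\<tau> - \<sigma>)) (blinfun_apply B z)))" for \<tau> \<sigma> z
  obtain C where C: "0 \<le> C" "\<And>\<sigma>. \<sigma> \<in> {t..T} \<Longrightarrow> norm (\<gamma> \<sigma>) \<le> C"
    using continuous_on_interval_norm_bound[OF \<gamma>] by metis
  have "continuous_on {t..T} (\<lambda>\<tau>. exp (- lam * \<tau>))" by (intro continuous_intros)
  then obtain E where E: "0 \<le> E" "\<And>\<tau>. \<tau> \<in> {t..T} \<Longrightarrow> norm (exp (- lam * \<tau>)) \<le> E"
    using continuous_on_interval_norm_bound by metis
  have fub: "(LINT \<tau>|M. LINT \<sigma>|M. \<Lambda> \<tau> \<sigma> (d \<sigma>)) = (LINT \<sigma>|M. LINT \<tau>|M. \<Lambda> \<tau> \<sigma> (d \<sigma>))"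
  proof (rule Fubini_bochner_kernel[OF d])
    show "linear (\<Lambda> \<tau> \<sigma>)" for \<tau> \<sigma>
      unfolding \<Lambda>_def
      by (intro linearI) (simp_all add: blinfun.add_right blinfun.scaleR_right add_right scaleR_right algebra_simps)
    show "\<bar>\<Lambda> \<tau> \<sigma> z\<bar> \<le> (E * (C * (exp (\<omega> * (T - t)) * norm B))) * norm z" for \<tau> \<sigma> z
    proof (cases "(\<tau>, \<sigma>) \<in> \<Delta>")
      case True
      then have ts: "\<tau> \<in> {t..T}" "0 \<le> \<tau> - \<sigma>" "\<tau> - \<sigma> \<le> T - t" by (auto simp: \<Delta>_def)
      have "\<bar>pr (\<gamma> \<tau>) (blinfun_apply (S (\<tau> - \<sigma>)) (blinfun_apply B z))\<bar>
          \<le> norm (\<gamma> \<tau>) * norm (blinfun_apply (S (\<tau> - \<sigma>)) (blinfun_apply B z))" by (rule abs_pr_le)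
      also have "\<dots> \<le> C * (exp (\<omega> * (T - t)) * norm B * norm z)"
        using C ts by (intro mult_mono response_integrand_bound) auto
      finally have "\<bar>exp (- lam * \<tau>)\<bar> * \<bar>pr (\<gamma> \<tau>) (blinfun_apply (S (\<tau> - \<sigma>)) (blinfun_apply B z))\<bar>
          \<le> E * (C * (exp (\<omega> * (T - t)) * norm B * norm z))"
        using E(1) E(2)[OF ts(1)] by (intro mult_mono) auto
      then show ?thesis using True by (simp add: \<Lambda>_def abs_mult mult_ac)
    next
      case False
      then show ?thesis using E C by (simp add: \<Lambda>_def)
    qed
    show "(\<lambda>(\<tau>, \<sigma>). \<Lambda> \<tau> \<sigma> z) \<in> borel_measurable borel" for z
    proof -
      have "closed \<Delta>" unfolding \<Delta>_def by (intro closed_Collect_conj closed_Collect_le continuous_intros)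
      moreover have "continuous_on \<Delta> (\<lambda>p. exp (- lam * fst p) *
          pr (\<gamma> (fst p)) (blinfun_apply (S (fst p - snd p)) (blinfun_apply B z)))"
        by (intro continuous_on_mult continuous_on_exp bounded_bilinear.continuous_on[OF bounded_bilinear_axioms]
            continuous_on_semigroup continuous_on_compose2[OF \<gamma>] continuous_intros)
           (auto simp: \<Delta>_def)
      ultimately have "(\<lambda>p. indicator \<Delta> p *\<^sub>R (exp (- lam * fst p) *
          pr (\<gamma> (fst p)) (blinfun_apply (S (fst p - snd p)) (blinfun_apply B z)))) \<in> borel_measurable borel"
        by (intro borel_measurable_continuous_on_indicator borel_closed)
      then show ?thesis by (simp add: \<Lambda>_def split_beta')
    qed
  qed
  have inner1: "(LINT \<sigma>|M. \<Lambda> \<tau> \<sigma> (d \<sigma>)) = exp (- lam * \<tau>) * pr (\<gamma> \<tau>) (response d \<tau>)"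
    if \<tau>: "\<tau> \<in> {t..T}" for \<tau>
  proof -
    let ?f = "\<lambda>\<sigma>. blinfun_apply (S (max 0 (\<tau> - \<sigma>))) (blinfun_apply B (d \<sigma>))"
    let ?g = "\<lambda>\<sigma>. if \<sigma> \<in> {t..\<tau>} then ?f \<sigma> else 0"
    have sub: "{t..\<tau>} \<subseteq> {t..T}" using \<tau> by auto
    have f: "bochner_integrable (lebesgue_on {t..\<tau>}) ?f"
      by (rule bochner_integrable_mono[OF response_integrand_integrable[OF d \<tau>] sub])
    have bl: "bounded_linear (\<lambda>w. exp (- lam * \<tau>) * pr (\<gamma> \<tau>) w)"
      by (intro bounded_linear_const_mult bounded_linear_right)
    have "exp (- lam * \<tau>) * pr (\<gamma> \<tau>) (response d \<tau>) = (LINT \<sigma>|M. exp (- lam * \<tau>) * pr (\<gamma> \<tau>) (?g \<sigma>))"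
      unfolding response_eq bochner_integrable_restrict_interval(2)[OF f sub, symmetric]
      by (rule bochner_integrable_bounded_linear(2)[OF bochner_integrable_restrict_interval(1)[OF f sub] bl])
    also have "\<dots> = (LINT \<sigma>|M. \<Lambda> \<tau> \<sigma> (d \<sigma>))"
      using \<tau> by (intro Bochner_Integration.integral_cong) (auto simp: \<Lambda>_def \<Delta>_def zero_right)
    finally show ?thesis ..
  qed
  have inner2: "(LINT \<tau>|M. \<Lambda> \<tau> \<sigma> (d \<sigma>)) = exp (- lam * \<sigma>) * inner (control_adjoint pr B (costate \<gamma> \<sigma>)) (d \<sigma>)"
    if \<sigma>: "\<sigma> \<in> {t..T}" for \<sigma>
  proof -
    let ?f = "\<lambda>\<tau>. exp (- lam * (\<tau> - \<sigma>)) *\<^sub>R pairing_adjoint pr (S (max 0 (\<tau> - \<sigma>))) (\<gamma> \<tau>)"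
    let ?g = "\<lambda>\<tau>. if \<tau> \<in> {\<sigma>..T} then ?f \<tau> else 0"
    have sub: "{\<sigma>..T} \<subseteq> {t..T}" using \<sigma> by auto
    have f: "bochner_integrable (lebesgue_on {\<sigma>..T}) ?f"
      by (rule bochner_integrable_mono[OF bochner_integrable_continuous[OF costate_integrand_continuous[OF \<gamma>]] sub])
    have bl: "bounded_linear (\<lambda>v. exp (- lam * \<sigma>) * pr v (blinfun_apply B (d \<sigma>)))"
      by (intro bounded_linear_const_mult bounded_linear_left)
    have "exp (- lam * \<sigma>) * pr (costate \<gamma> \<sigma>) (blinfun_apply B (d \<sigma>)) =
        (LINT \<tau>|M. exp (- lam * \<sigma>) * pr (?g \<tau>) (blinfun_apply B (d \<sigma>)))"
      unfolding costate_eq bochner_integrable_restrict_interval(2)[OF f sub, symmetric]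
      by (rule bochner_integrable_bounded_linear(2)[OF bochner_integrable_restrict_interval(1)[OF f sub] bl])
    also have "\<dots> = (LINT \<tau>|M. \<Lambda> \<tau> \<sigma> (d \<sigma>))"
    proof (rule Bochner_Integration.integral_cong[OF refl])
      fix \<tau> assume "\<tau> \<in> space M"
      have "exp (- lam * \<sigma>) * exp (- lam * (\<tau> - \<sigma>)) = exp (- lam * \<tau>)"
        by (simp add: algebra_simps flip: exp_add)
      then show "exp (- lam * \<sigma>) * pr (?g \<tau>) (blinfun_apply B (d \<sigma>)) = \<Lambda> \<tau> \<sigma> (d \<sigma>)"
        using \<sigma> \<open>\<tau> \<in> space M\<close>
        by (auto simp: \<Lambda>_def \<Delta>_def zero_left scaleR_left pr_pairing_adjoint mult.assoc[symmetric])
    qed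
    finally show ?thesis by (simp add: inner_control_adjoint)
  qed
  have "(LINT \<tau>|M. exp (- lam * \<tau>) * pr (\<gamma> \<tau>) (response d \<tau>)) = (LINT \<tau>|M. LINT \<sigma>|M. \<Lambda> \<tau> \<sigma> (d \<sigma>))"
    by (rule Bochner_Integration.integral_cong[OF refl]) (simp add: inner1)
  also have "\<dots> = (LINT \<sigma>|M. exp (- lam * \<sigma>) * inner (control_adjoint pr B (costate \<gamma> \<sigma>)) (d \<sigma>))"
    unfolding fub by (rule Bochner_Integration.integral_cong[OF refl]) (simp add: inner2)
  finally show ?thesis .
qed

end

section \<open>Optimality and extremality\<close>

locale convex_control = linear_control pr S B \<omega> lam t T
  for pr :: "'v::{real_inner, complete_space} \<Rightarrow> 'w::{real_inner, complete_space} \<Rightarrow> real"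
    and S :: "real \<Rightarrow> 'w \<Rightarrow>\<^sub>L 'w" and B :: "'u::{real_inner, complete_space} \<Rightarrow>\<^sub>L 'w"
    and \<omega> lam t T :: real +
  fixes g0 :: "'w \<Rightarrow> real" and g' :: "'w \<Rightarrow> 'w \<Rightarrow>\<^sub>L real" and L :: real
    and h0 :: "'u \<Rightarrow> ereal" and k :: "'u \<Rightarrow> real" and k' :: "'u \<Rightarrow> 'u \<Rightarrow>\<^sub>L real" and L' :: real
    and p :: real
  assumes g_convex: "convex_on UNIV g0"
    and g_deriv: "\<And>z. (g0 has_derivative blinfun_apply (g' z)) (at z)"
    and g_lipschitz: "L-lipschitz_on UNIV g'"
    and h_convex: "convex_ereal h0" and h_lsc: "lower_semicontinuous h0"
    and h_conj: "\<And>v. convex_conjugate h0 v = ereal (k v)" and h_conj_0: "k 0 = 0"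
    and k_deriv: "\<And>v. (k has_derivative blinfun_apply (k' v)) (at v)"
    and k_lipschitz: "L'-lipschitz_on UNIV k'"
    and p: "1 \<le> p"
begin

text \<open>The conjugate vanishes at zero, that is, the infimum of \<open>h0\<close> is zero.\<close>

lemma h_nonneg: "0 \<le> h0 z"
  using conjugate_ge[OF h_conj, of z 0] by (cases "h0 z") (auto simp: h_conj_0)

lemma h_noninf: "h0 z \<noteq> -\<infinity>"
  using h_nonneg[of z] by auto

abbreviation Dg where "Dg \<equiv> pairing_deriv pr g0"

lemma pr_Dg: "pr (Dg z) w = blinfun_apply (g' z) w"
  by (simp add: pr_pairing_deriv[OF g_deriv])

lemma continuous_on_Dg: "continuous_on UNIV Dg"
proof -
  have "L-lipschitz_on UNIV Dg"
  proof (rule lipschitz_onI)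
    fix y z
    have "norm (Dg y - Dg z) \<le> norm (g' y - g' z)"
      by (rule norm_le_pairing)
         (use norm_blinfun[of "g' y - g' z"] in \<open>simp_all add: diff_left pr_Dg blinfun.diff_left\<close>)
    then show "dist (Dg y) (Dg z) \<le> L * dist y z"
      using lipschitz_onD[OF g_lipschitz, of y z] by (simp add: dist_norm)
  qed (use g_lipschitz in \<open>rule lipschitz_on_nonneg\<close>)
  then show ?thesis by (rule lipschitz_on_continuous_on)
qed

lemma continuous_on_g: "continuous_on UNIV g0"
  by (intro continuous_at_imp_continuous_on ballI has_derivative_continuous[OF g_deriv])

definition hpart :: "(real \<Rightarrow> 'u) \<Rightarrow> real \<Rightarrow> ereal" where
  "hpart w \<tau> = ereal (exp (- lam * \<tau>)) * h0 (w \<tau>)"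

lemma hpart_nonneg: "0 \<le> hpart w \<tau>"
  by (simp add: hpart_def h_nonneg)

lemma hpart_measurable:
  assumes "strongly_measurable M w"
  shows "hpart w \<in> borel_measurable M"
proof -
  interpret complete_measure M by (rule complete_measure_lebesgue_on) simp
  have "(\<lambda>\<tau>. h0 (w \<tau>)) \<in> borel_measurable M"
    using strongly_measurable_imp_borel[OF assms] lsc_borel_measurable[OF h_lsc] by (rule measurable_compose)
  moreover have "(\<lambda>\<tau>. ereal (exp (- lam * \<tau>))) \<in> borel_measurable M"
    by (intro measurable_restrict_space1 measurable_completion) simp
  ultimately show ?thesis unfolding hpart_def by (intro borel_measurable_ereal_times)
qed

abbreviation traj where "traj x w \<equiv> trajectory S B t x w"

lemma running_cost_split:
  "ereal (exp (- lam * \<tau>)) * (ereal (g0 z) + h0 (w \<tau>)) = ereal (exp (- lam * \<tau>) * g0 z) + hpart w \<tau>"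
  using h_nonneg[of "w \<tau>"] by (cases "h0 (w \<tau>)") (auto simp: hpart_def algebra_simps)

lemma cost_eq_ereal_integral:
  "cost S B g0 h0 lam T t x w = ereal_integral M (\<lambda>\<tau>. ereal (exp (- lam * \<tau>) * g0 (traj x w \<tau>)) + hpart w \<tau>)"
  unfolding cost_def ereal_integral_lebesgue_on_Ico_eq_Icc running_cost_split ..

lemma integrable_weighted_continuous:
  assumes "continuous_on {t..T} f"
  shows "integrable M (\<lambda>\<tau>. exp (- lam * \<tau>) * f \<tau> :: real)"
  by (intro continuous_imp_integrable_real continuous_intros assms)

lemma integrable_running_state_cost:
  assumes "bochner_integrable M w"
  shows "integrable M (\<lambda>\<tau>. exp (- lam * \<tau>) * g0 (traj x w \<tau>))"
  by (intro integrable_weighted_continuous continuous_on_compose2[OF continuous_on_g]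
      continuous_on_trajectory[OF assms]) auto

text \<open>Since \<open>h0\<close> is nonnegative and the trajectory is continuous, the negative part of the running cost is
  integrable, and the cost is a real number plus a possibly infinite nonnegative one.\<close>

lemma cost_eq:
  assumes w: "bochner_integrable M w"
  shows "cost S B g0 h0 lam T t x w =
    ereal (LINT \<tau>|M. exp (- lam * \<tau>) * g0 (traj x w \<tau>)) + enn2ereal (\<integral>\<^sup>+\<tau>. e2ennreal (hpart w \<tau>) \<partial>M)"
  unfolding cost_eq_ereal_integral
  using w by (intro ereal_integral_add integrable_running_state_cost hpart_measurable hpart_nonneg)
    (auto simp: bochner_integrable_def)

lemma integrable_inner_continuous:
  assumes v: "continuous_on {t..T} v" and d: "bochner_integrable M d"
  shows "integrable M (\<lambda>\<sigma>. exp (- lam * \<sigma>) * inner (v \<sigma>) (d \<sigma> :: 'u))"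
proof -
  let ?F = "\<lambda>\<sigma> z. exp (- lam * \<sigma>) * inner (v \<sigma>) z"
  have c: "continuous_on {t..T} (\<lambda>\<sigma>. exp (- lam * \<sigma>) *\<^sub>R v \<sigma>)" by (intro continuous_intros v)
  obtain C where C: "0 \<le> C" "\<And>\<sigma>. \<sigma> \<in> {t..T} \<Longrightarrow> norm (exp (- lam * \<sigma>) *\<^sub>R v \<sigma>) \<le> C"
    using continuous_on_interval_norm_bound[OF c] by metis
  have "continuous_on ({t..T} \<times> UNIV) (\<lambda>q. ?F (fst q) (snd q))"
    by (intro continuous_intros continuous_on_compose2[OF v]) auto
  then have "strongly_measurable M (\<lambda>\<sigma>. ?F \<sigma> (d \<sigma>))"
    using d unfolding bochner_integrable_def
    by (intro strongly_measurable_continuous_compose[where F="?F"]) (simp_all add: case_prod_beta)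
  then have "bochner_integrable M (\<lambda>\<sigma>. ?F \<sigma> (d \<sigma>))"
  proof (rule bochner_integrable_bound)
    show "integrable M (\<lambda>\<sigma>. C * norm (d \<sigma>))" using d by (simp add: bochner_integrable_def)
    fix \<sigma> assume \<sigma>: "\<sigma> \<in> {t..T}"
    have "norm (?F \<sigma> (d \<sigma>)) \<le> norm (exp (- lam * \<sigma>) *\<^sub>R v \<sigma>) * norm (d \<sigma>)"
      using Cauchy_Schwarz_ineq2[of "exp (- lam * \<sigma>) *\<^sub>R v \<sigma>" "d \<sigma>"] by simp
    also have "\<dots> \<le> C * norm (d \<sigma>)" using C(2)[OF \<sigma>] by (rule mult_right_mono) simp
    finally show "norm (?F \<sigma> (d \<sigma>)) \<le> C * norm (d \<sigma>)" .
  qed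
  from bochner_integrable_bounded_linear(1)[OF this bounded_linear_ident] show ?thesis .
qed

text \<open>An extremal control is recovered from this function, as the gradient of the conjugate of \<open>h0\<close> at
  its values.\<close>

abbreviation switching :: "'w \<Rightarrow> (real \<Rightarrow> 'u) \<Rightarrow> real \<Rightarrow> 'u" where
  "switching x u \<sigma> \<equiv> - control_adjoint pr B (costate (\<lambda>\<tau>. Dg (traj x u \<tau>)) \<sigma>)"

lemma continuous_on_Dg_trajectory:
  assumes "bochner_integrable M u"
  shows "continuous_on {t..T} (\<lambda>\<tau>. Dg (traj x u \<tau>))"
  by (rule continuous_on_compose2[OF continuous_on_Dg continuous_on_trajectory[OF assms]]) auto

lemma continuous_on_switching:
  assumes "bochner_integrable M u"
  shows "continuous_on {t..T} (switching x u)"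
  by (intro continuous_on_minus bounded_linear.continuous_on[OF bounded_linear_control_adjoint]
      continuous_on_costate continuous_on_Dg_trajectory assms)

text \<open>The first variation of the state cost in the direction \<open>d\<close>.\<close>

lemma linearized_state_cost:
  assumes u: "bochner_integrable M u" and d: "bochner_integrable M d"
  shows "(LINT \<tau>|M. exp (- lam * \<tau>) * blinfun_apply (g' (traj x u \<tau>)) (response d \<tau>)) =
         - (LINT \<sigma>|M. exp (- lam * \<sigma>) * inner (switching x u \<sigma>) (d \<sigma>))"
  using response_costate_duality[OF continuous_on_Dg_trajectory[OF u] d] by (simp add: pr_Dg)

lemma integrable_linearized_state_cost:
  assumes u: "bochner_integrable M u" and d: "bochner_integrable M d"
  shows "integrable M (\<lambda>\<tau>. exp (- lam * \<tau>) * blinfun_apply (g' (traj x u \<tau>)) (response d \<tau>))"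
  unfolding pr_Dg[symmetric]
  by (intro integrable_weighted_continuous bounded_bilinear.continuous_on[OF bounded_bilinear_axioms]
      continuous_on_Dg_trajectory u continuous_on_response d)

text \<open>Sufficiency. The subgradient inequalities for \<open>g0\<close> and \<open>h0\<close> are added pointwise, in a form in which
  only the running cost of \<open>w\<close> can be infinite on the right; the error terms \<open>?D\<close> and \<open>?R\<close> cancel after
  integration.\<close>

lemma subdifferential_imp_cost_le:
  assumes u: "bochner_integrable M u" and w: "bochner_integrable M w"
    and sub: "AE \<sigma> in M. switching x u \<sigma> \<in> subdifferential h0 (u \<sigma>)"
  shows "cost S B g0 h0 lam T t x u \<le> cost S B g0 h0 lam T t x w"
proof -
  define d where "d \<sigma> = w \<sigma> - u \<sigma>" for \<sigma>
  have d: "bochner_integrable M d" unfolding d_def[abs_def] by (rule bochner_integrable_diff[OF w u])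
  let ?e = "\<lambda>\<tau>. exp (- lam * \<tau>)"
  let ?G = "\<lambda>\<tau>. ?e \<tau> * g0 (traj x w \<tau>)"
  let ?D = "\<lambda>\<tau>. ?e \<tau> * blinfun_apply (g' (traj x u \<tau>)) (response d \<tau>)"
  let ?R = "\<lambda>\<sigma>. ?e \<sigma> * inner (switching x u \<sigma>) (d \<sigma>)"
  have traj_w: "traj x w \<tau> = traj x u \<tau> + response d \<tau>" if "\<tau> \<in> {t..T}" for \<tau>
    using response_linear[OF u d that, of 1] by (simp add: trajectory_eq d_def)
  have iG: "integrable M ?G" by (rule integrable_running_state_cost[OF w])
  have iD: "integrable M ?D" by (rule integrable_linearized_state_cost[OF u d])
  have iR: "integrable M ?R" by (rule integrable_inner_continuous[OF continuous_on_switching[OF u] d])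
  have "AE \<tau> in M. ereal (?e \<tau> * g0 (traj x u \<tau>)) + hpart u \<tau> \<le> ereal (?G \<tau> - ?D \<tau> - ?R \<tau>) + hpart w \<tau>"
    using sub AE_space
  proof eventually_elim
    case (elim \<tau>)
    then have \<tau>: "\<tau> \<in> {t..T}" by simp
    have "g0 (traj x u \<tau>) + blinfun_apply (g' (traj x u \<tau>)) (response d \<tau>) \<le> g0 (traj x w \<tau>)"
      unfolding traj_w[OF \<tau>] by (rule convex_above_tangent[OF g_deriv g_lipschitz g_convex])
    then have "?e \<tau> * (g0 (traj x u \<tau>) + blinfun_apply (g' (traj x u \<tau>)) (response d \<tau>)) \<le> ?G \<tau>"
      by (rule mult_left_mono) simp
    then have 1: "?e \<tau> * g0 (traj x u \<tau>) \<le> ?G \<tau> - ?D \<tau>" by (simp only: distrib_left le_diff_eq)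
    have "h0 (u \<tau>) + ereal (inner (switching x u \<tau>) (d \<tau>)) \<le> h0 (w \<tau>)"
      using elim(1) by (auto simp: subdifferential_def d_def)
    then have "ereal (?e \<tau>) * (h0 (u \<tau>) + ereal (inner (switching x u \<tau>) (d \<tau>))) \<le> hpart w \<tau>"
      unfolding hpart_def by (rule ereal_mult_left_mono) simp
    moreover have "ereal (?e \<tau>) * (h0 (u \<tau>) + ereal r) = hpart u \<tau> + ereal (?e \<tau> * r)" for r
      using h_noninf[of "u \<tau>"] by (cases "h0 (u \<tau>)") (simp_all add: hpart_def distrib_left)
    ultimately have 2: "hpart u \<tau> + ereal (?R \<tau>) \<le> hpart w \<tau>" by simp
    have le: "ereal r + H \<le> ereal (s - q) + K" if "r \<le> s" "H + ereal q \<le> K" "0 \<le> H" "0 \<le> K"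
      for r s q :: real and H K :: ereal
      using that by (cases H; cases K) auto
    show ?case by (rule le[OF 1 2 hpart_nonneg hpart_nonneg])
  qed
  then have "cost S B g0 h0 lam T t x u \<le> ereal_integral M (\<lambda>\<tau>. ereal (?G \<tau> - ?D \<tau> - ?R \<tau>) + hpart w \<tau>)"
    unfolding cost_eq_ereal_integral by (rule ereal_integral_mono_AE)
  also have "\<dots> = ereal (LINT \<tau>|M. ?G \<tau> - ?D \<tau> - ?R \<tau>) + enn2ereal (\<integral>\<^sup>+\<tau>. e2ennreal (hpart w \<tau>) \<partial>M)"
    using w iG iD iR
    by (intro ereal_integral_add hpart_measurable hpart_nonneg) (auto simp: bochner_integrable_def)
  also have "(LINT \<tau>|M. ?G \<tau> - ?D \<tau> - ?R \<tau>) = (LINT \<tau>|M. ?G \<tau>)"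
    using iG iD iR linearized_state_cost[OF u d, of x] by simp
  also have "ereal (LINT \<tau>|M. ?G \<tau>) + enn2ereal (\<integral>\<^sup>+\<tau>. e2ennreal (hpart w \<tau>) \<partial>M) = cost S B g0 h0 lam T t x w"
    by (rule cost_eq[OF w, symmetric])
  finally show ?thesis .
qed

text \<open>A control of finite cost has finite values of \<open>h0\<close> almost everywhere, so that its cost can be computed
  with real integrals.\<close>

lemma finite_hpart:
  assumes u: "bochner_integrable M u" and fin: "cost S B g0 h0 lam T t x u < \<infinity>"
  obtains \<eta> where "integrable M (\<lambda>\<tau>. exp (- lam * \<tau>) * \<eta> \<tau>)" "AE \<tau> in M. h0 (u \<tau>) = ereal (\<eta> \<tau>)"
    "cost S B g0 h0 lam T t x u =
      ereal ((LINT \<tau>|M. exp (- lam * \<tau>) * g0 (traj x u \<tau>)) + (LINT \<tau>|M. exp (- lam * \<tau>) * \<eta> \<tau>))"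
proof -
  have m: "hpart u \<in> borel_measurable M" using u by (intro hpart_measurable) (simp add: bochner_integrable_def)
  define \<eta> where "\<eta> \<tau> = real_of_ereal (h0 (u \<tau>))" for \<tau>
  have \<eta>0: "0 \<le> \<eta> \<tau>" for \<tau> unfolding \<eta>_def by (intro real_of_ereal_pos h_nonneg)
  have Hfin: "(\<integral>\<^sup>+\<tau>. e2ennreal (hpart u \<tau>) \<partial>M) \<noteq> \<infinity>"
    using fin unfolding cost_eq[OF u] by auto
  have me: "(\<lambda>\<tau>. e2ennreal (hpart u \<tau>)) \<in> borel_measurable M" using m by measurable
  have "AE \<tau> in M. e2ennreal (hpart u \<tau>) \<noteq> \<infinity>" by (rule nn_integral_PInf_AE[OF me Hfin])
  then have ae: "AE \<tau> in M. h0 (u \<tau>) = ereal (\<eta> \<tau>)"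
  proof eventually_elim
    case (elim \<tau>)
    then have "h0 (u \<tau>) \<noteq> \<infinity>" by (auto simp: hpart_def)
    then show ?case using h_noninf[of "u \<tau>"] by (cases "h0 (u \<tau>)") (auto simp: \<eta>_def)
  qed
  have aeq: "AE \<tau> in M. e2ennreal (hpart u \<tau>) = ennreal (exp (- lam * \<tau>) * \<eta> \<tau>)"
    using ae by eventually_elim (simp add: hpart_def e2ennreal_ereal)
  have nn: "(\<integral>\<^sup>+\<tau>. e2ennreal (hpart u \<tau>) \<partial>M) = (\<integral>\<^sup>+\<tau>. ennreal (exp (- lam * \<tau>) * \<eta> \<tau>) \<partial>M)"
    by (rule nn_integral_cong_AE[OF aeq])
  have "(\<lambda>\<tau>. real_of_ereal (hpart u \<tau>)) \<in> borel_measurable M" using m by measurable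
  moreover have "(\<lambda>\<tau>. real_of_ereal (hpart u \<tau>)) = (\<lambda>\<tau>. exp (- lam * \<tau>) * \<eta> \<tau>)"
    by (simp add: hpart_def \<eta>_def)
  ultimately have mr: "(\<lambda>\<tau>. exp (- lam * \<tau>) * \<eta> \<tau>) \<in> borel_measurable M" by simp
  have int: "integrable M (\<lambda>\<tau>. exp (- lam * \<tau>) * \<eta> \<tau>)"
    using mr Hfin \<eta>0 unfolding nn by (intro integrableI_nonneg) (auto simp: less_top)
  have "enn2ereal (\<integral>\<^sup>+\<tau>. e2ennreal (hpart u \<tau>) \<partial>M) = ereal (LINT \<tau>|M. exp (- lam * \<tau>) * \<eta> \<tau>)"
    unfolding nn using int \<eta>0 by (subst nn_integral_eq_integral) (auto intro!: enn2ereal_ennreal integral_nonneg_AE)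
  with int ae show ?thesis by (intro that) (simp_all add: cost_eq[OF u])
qed

text \<open>Necessity. The optimal control \<open>u\<close> is compared with the controls between \<open>u\<close> and the pointwise
  maximizer \<open>\<nu>\<close> of \<open>(\<cdot> | ?v \<tau>) - h0\<close>, at which \<open>h0\<close> takes the value \<open>\<mu>\<close>.\<close>

lemma optimal_imp_subdifferential:
  assumes u: "u \<in> Lspace_weighted p lam t T"
    and opt: "\<And>w. w \<in> Lspace_weighted p lam t T \<Longrightarrow> cost S B g0 h0 lam T t x u \<le> cost S B g0 h0 lam T t x w"
  shows "AE \<sigma> in M. switching x u \<sigma> \<in> subdifferential h0 (u \<sigma>)"
proof -
  obtain G where G: "\<And>v. h0 (G v) = ereal (inner (G v) v - k v)" and cG: "continuous_on UNIV G"
    using conjugate_gradient[OF h_noninf h_lsc h_conj k_deriv k_lipschitz] by blast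
  have ub: "bochner_integrable M u" by (rule Lspace_weighted_bochner_integrable[OF u p])
  let ?e = "\<lambda>\<tau>. exp (- lam * \<tau>)"
  let ?v = "switching x u"
  define \<nu> where "\<nu> \<tau> = G (?v \<tau>)" for \<tau>
  define \<mu> where "\<mu> \<tau> = inner (\<nu> \<tau>) (?v \<tau>) - k (?v \<tau>)" for \<tau>
  have cv: "continuous_on {t..T} ?v" by (rule continuous_on_switching[OF ub])
  have c\<nu>: "continuous_on {t..T} \<nu>"
    unfolding \<nu>_def by (rule continuous_on_compose2[OF cG cv]) auto
  have ck: "continuous_on UNIV k"
    by (intro continuous_at_imp_continuous_on ballI has_derivative_continuous[OF k_deriv])
  have ckv: "continuous_on {t..T} (\<lambda>\<tau>. k (?v \<tau>))" by (rule continuous_on_compose2[OF ck cv]) auto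
  have c\<mu>: "continuous_on {t..T} \<mu>" unfolding \<mu>_def by (intro continuous_intros c\<nu> cv ckv)
  have h\<nu>: "h0 (\<nu> \<tau>) = ereal (\<mu> \<tau>)" for \<tau> by (simp add: \<nu>_def \<mu>_def G)
  have \<nu>b: "bochner_integrable M \<nu>" by (rule bochner_integrable_continuous[OF c\<nu>])
  have \<nu>L: "\<nu> \<in> Lspace_weighted p lam t T" using p by (intro Lspace_weighted_continuous[OF c\<nu>]) simp
  have i\<mu>: "integrable M (\<lambda>\<tau>. ?e \<tau> * \<mu> \<tau>)" by (rule integrable_weighted_continuous[OF c\<mu>])
  \<comment> \<open>this competitor shows that the optimal cost is finite\<close>
  have "cost S B g0 h0 lam T t x \<nu> < \<infinity>"
  proof -
    have "\<mu> \<tau> \<ge> 0" for \<tau> using h_nonneg[of "\<nu> \<tau>"] by (simp add: h\<nu>)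
    then have "(\<integral>\<^sup>+\<tau>. ennreal (?e \<tau> * \<mu> \<tau>) \<partial>M) = ennreal (LINT \<tau>|M. ?e \<tau> * \<mu> \<tau>)"
      by (intro nn_integral_eq_integral[OF i\<mu>] AE_I2 mult_nonneg_nonneg exp_ge_zero)
    then have "(\<integral>\<^sup>+\<tau>. e2ennreal (hpart \<nu> \<tau>) \<partial>M) = ennreal (LINT \<tau>|M. ?e \<tau> * \<mu> \<tau>)"
      by (simp add: hpart_def h\<nu> e2ennreal_ereal)
    then show ?thesis unfolding cost_eq[OF \<nu>b] by simp
  qed
  with opt[OF \<nu>L] have "cost S B g0 h0 lam T t x u < \<infinity>" by (rule le_less_trans)
  then obtain \<eta> where i\<eta>: "integrable M (\<lambda>\<tau>. ?e \<tau> * \<eta> \<tau>)" and hu: "AE \<tau> in M. h0 (u \<tau>) = ereal (\<eta> \<tau>)"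
    and cu: "cost S B g0 h0 lam T t x u =
      ereal ((LINT \<tau>|M. ?e \<tau> * g0 (traj x u \<tau>)) + (LINT \<tau>|M. ?e \<tau> * \<eta> \<tau>))"
    by (rule finite_hpart[OF ub]) blast
  define d where "d \<tau> = \<nu> \<tau> - u \<tau>" for \<tau>
  have d: "bochner_integrable M d" unfolding d_def[abs_def] by (rule bochner_integrable_diff[OF \<nu>b ub])
  let ?z = "response d"
  let ?D = "\<lambda>\<tau>. ?e \<tau> * blinfun_apply (g' (traj x u \<tau>)) (?z \<tau>)"
  let ?Q = "\<lambda>\<tau>. ?e \<tau> * (L * (norm (?z \<tau>))\<^sup>2)"
  have iG: "integrable M (\<lambda>\<tau>. ?e \<tau> * g0 (traj x u \<tau>))" by (rule integrable_running_state_cost[OF ub])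
  have iD: "integrable M ?D" by (rule integrable_linearized_state_cost[OF ub d])
  have iQ: "integrable M ?Q"
    by (intro integrable_weighted_continuous continuous_intros continuous_on_response[OF d])
  have "(LINT \<tau>|M. ?e \<tau> * \<eta> \<tau>) \<le> (LINT \<tau>|M. ?e \<tau> * \<mu> \<tau>) + (LINT \<tau>|M. ?D \<tau>) + \<theta> * (LINT \<tau>|M. ?Q \<tau>)"
    if \<theta>: "0 < \<theta>" "\<theta> < 1" for \<theta>
  proof -
    define w where "w \<tau> = u \<tau> + \<theta> *\<^sub>R d \<tau>" for \<tau>
    obtain C where C: "0 \<le> C" "\<And>\<tau>. \<tau> \<in> {t..T} \<Longrightarrow> norm (\<nu> \<tau>) \<le> C"
      using continuous_on_interval_norm_bound[OF c\<nu>] by metis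
    have w_alt: "w \<tau> = \<theta> *\<^sub>R \<nu> \<tau> + (1 - \<theta>) *\<^sub>R u \<tau>" for \<tau>
      by (simp add: w_def d_def algebra_simps)
    have "continuous_on ({t..T} \<times> UNIV) (\<lambda>q. \<theta> *\<^sub>R \<nu> (fst q) + (1 - \<theta>) *\<^sub>R snd q)"
      by (intro continuous_intros continuous_on_compose2[OF c\<nu>]) auto
    then have wm: "strongly_measurable M w"
      using ub unfolding bochner_integrable_def w_alt[abs_def]
      by (intro strongly_measurable_continuous_compose[where F="\<lambda>\<tau> z. \<theta> *\<^sub>R \<nu> \<tau> + (1 - \<theta>) *\<^sub>R z"])
         (simp_all add: case_prod_beta)
    have "norm (w \<tau>) \<le> norm (u \<tau>) + C" if "\<tau> \<in> {t..T}" for \<tau>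
    proof -
      have "norm (w \<tau>) \<le> \<theta> * norm (\<nu> \<tau>) + (1 - \<theta>) * norm (u \<tau>)"
        unfolding w_alt using \<theta> by (intro norm_triangle_le) simp
      also have "\<dots> \<le> 1 * norm (\<nu> \<tau>) + 1 * norm (u \<tau>)"
        using \<theta> by (intro add_mono mult_right_mono) auto
      finally show ?thesis using C(2)[OF that] by simp
    qed
    then have wL: "w \<in> Lspace_weighted p lam t T"
      using p C(1) by (intro Lspace_weighted_dominated[OF wm _ u]) auto
    let ?a = "\<lambda>\<tau>. ?e \<tau> * g0 (traj x u \<tau>) + \<theta> * ?D \<tau> + \<theta> * \<theta> * ?Q \<tau>
      + (\<theta> * (?e \<tau> * \<mu> \<tau>) + (1 - \<theta>) * (?e \<tau> * \<eta> \<tau>))"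
    have ia: "integrable M ?a" using iG iD iQ i\<mu> i\<eta> by simp
    have a_int: "(LINT \<tau>|M. ?a \<tau>) = (LINT \<tau>|M. ?e \<tau> * g0 (traj x u \<tau>)) + \<theta> * (LINT \<tau>|M. ?D \<tau>)
      + \<theta> * \<theta> * (LINT \<tau>|M. ?Q \<tau>) + (\<theta> * (LINT \<tau>|M. ?e \<tau> * \<mu> \<tau>) + (1 - \<theta>) * (LINT \<tau>|M. ?e \<tau> * \<eta> \<tau>))"
      using iG iD iQ i\<mu> i\<eta> by simp
    \<comment> \<open>second order expansion of \<open>g0\<close>, and convexity of \<open>h0\<close> between \<open>u\<close> and \<open>\<nu>\<close>\<close>
    have "AE \<tau> in M. ereal (?e \<tau> * g0 (traj x w \<tau>)) + hpart w \<tau> \<le> ereal (?a \<tau>)"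
      using hu AE_space
    proof eventually_elim
      case (elim \<tau>)
      then have \<tau>: "\<tau> \<in> {t..T}" by simp
      have tw: "traj x w \<tau> = traj x u \<tau> + \<theta> *\<^sub>R ?z \<tau>"
        unfolding trajectory_eq w_def using response_linear[OF ub d \<tau>, of \<theta>] by simp
      have "g0 (traj x w \<tau>) \<le> g0 (traj x u \<tau>) + \<theta> * blinfun_apply (g' (traj x u \<tau>)) (?z \<tau>)
          + \<theta> * \<theta> * (L * (norm (?z \<tau>))\<^sup>2)"
        using lipschitz_derivative_remainder[OF g_deriv g_lipschitz, of "traj x u \<tau>" "\<theta> *\<^sub>R ?z \<tau>"] \<theta>
        unfolding tw by (simp add: blinfun.scaleR_right power2_eq_square algebra_simps)
      then have "?e \<tau> * g0 (traj x w \<tau>) \<le> ?e \<tau> * (g0 (traj x u \<tau>) + \<theta> * blinfun_apply (g' (traj x u \<tau>)) (?z \<tau>)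
          + \<theta> * \<theta> * (L * (norm (?z \<tau>))\<^sup>2))" by (rule mult_left_mono) simp
      then have 1: "?e \<tau> * g0 (traj x w \<tau>) \<le> ?e \<tau> * g0 (traj x u \<tau>) + \<theta> * ?D \<tau> + \<theta> * \<theta> * ?Q \<tau>"
        by (simp add: algebra_simps)
      have "h0 (w \<tau>) \<le> ereal \<theta> * h0 (\<nu> \<tau>) + ereal (1 - \<theta>) * h0 (u \<tau>)"
        using h_convex \<theta> unfolding w_alt convex_ereal_def by blast
      then have "h0 (w \<tau>) \<le> ereal (\<theta> * \<mu> \<tau> + (1 - \<theta>) * \<eta> \<tau>)" by (simp add: h\<nu> elim(1))
      then have "hpart w \<tau> \<le> ereal (?e \<tau>) * ereal (\<theta> * \<mu> \<tau> + (1 - \<theta>) * \<eta> \<tau>)"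
        unfolding hpart_def by (rule ereal_mult_left_mono) simp
      then have 2: "hpart w \<tau> \<le> ereal (\<theta> * (?e \<tau> * \<mu> \<tau>) + (1 - \<theta>) * (?e \<tau> * \<eta> \<tau>))"
        by (simp add: algebra_simps)
      have "ereal (?e \<tau> * g0 (traj x w \<tau>)) + hpart w \<tau> \<le>
          ereal (?e \<tau> * g0 (traj x u \<tau>) + \<theta> * ?D \<tau> + \<theta> * \<theta> * ?Q \<tau>)
          + ereal (\<theta> * (?e \<tau> * \<mu> \<tau>) + (1 - \<theta>) * (?e \<tau> * \<eta> \<tau>))"
        using 1 2 by (intro add_mono) auto
      then show ?case by simp
    qed
    then have "cost S B g0 h0 lam T t x w \<le> ereal_integral M (\<lambda>\<tau>. ereal (?a \<tau>))"
      unfolding cost_eq_ereal_integral by (rule ereal_integral_mono_AE)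
    also have "\<dots> = ereal (LINT \<tau>|M. ?a \<tau>)"
      by (rule ereal_integral_real[OF ia])
    finally have "cost S B g0 h0 lam T t x u \<le> ereal (LINT \<tau>|M. ?a \<tau>)"
      using opt[OF wL] by (rule order_trans[rotated])
    then have "\<theta> * (LINT \<tau>|M. ?e \<tau> * \<eta> \<tau>) \<le>
        \<theta> * ((LINT \<tau>|M. ?e \<tau> * \<mu> \<tau>) + (LINT \<tau>|M. ?D \<tau>) + \<theta> * (LINT \<tau>|M. ?Q \<tau>))"
      unfolding cu a_int ereal_less_eq by (simp add: algebra_simps)
    then show ?thesis using \<theta> by simp
  qed
  then have var: "(LINT \<tau>|M. ?e \<tau> * \<eta> \<tau>) \<le> (LINT \<tau>|M. ?e \<tau> * \<mu> \<tau>) + (LINT \<tau>|M. ?D \<tau>)"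
    by (rule le_if_le_perturbed)
  \<comment> \<open>the defect in the Fenchel inequality at \<open>u \<tau>\<close> and \<open>?v \<tau>\<close>\<close>
  define gap where "gap \<tau> = \<eta> \<tau> - \<mu> \<tau> + inner (?v \<tau>) (d \<tau>)" for \<tau>
  have gap_eq: "gap \<tau> = \<eta> \<tau> - (inner (u \<tau>) (?v \<tau>) - k (?v \<tau>))" for \<tau>
    by (simp add: gap_def \<mu>_def d_def inner_diff_left inner_diff_right inner_commute)
  have iR: "integrable M (\<lambda>\<sigma>. ?e \<sigma> * inner (?v \<sigma>) (d \<sigma>))"
    by (rule integrable_inner_continuous[OF cv d])
  have split: "(\<lambda>\<tau>. ?e \<tau> * gap \<tau>) = (\<lambda>\<tau>. ?e \<tau> * \<eta> \<tau> - ?e \<tau> * \<mu> \<tau> + ?e \<tau> * inner (?v \<tau>) (d \<tau>))"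
    by (rule ext) (simp only: gap_def distrib_left right_diff_distrib)
  have igap: "integrable M (\<lambda>\<tau>. ?e \<tau> * gap \<tau>)"
    and gap_int: "(LINT \<tau>|M. ?e \<tau> * gap \<tau>) = (LINT \<tau>|M. ?e \<tau> * \<eta> \<tau>) - (LINT \<tau>|M. ?e \<tau> * \<mu> \<tau>)
      + (LINT \<tau>|M. ?e \<tau> * inner (?v \<tau>) (d \<tau>))"
    unfolding split using i\<eta> i\<mu> iR
    by (simp_all only: Bochner_Integration.integral_add Bochner_Integration.integral_diff
        Bochner_Integration.integrable_add Bochner_Integration.integrable_diff)
  have gap_nonneg: "AE \<tau> in M. 0 \<le> ?e \<tau> * gap \<tau>"
    using hu
  proof eventually_elim
    case (elim \<tau>)
    have "0 \<le> gap \<tau>" using conjugate_ge[OF h_conj, of "u \<tau>" "?v \<tau>"] by (simp add: elim gap_eq)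
    then show ?case by simp
  qed
  have "(LINT \<tau>|M. ?e \<tau> * gap \<tau>) \<le> 0"
    using var linearized_state_cost[OF ub d, of x] unfolding gap_int by linarith
  then have "(LINT \<tau>|M. ?e \<tau> * gap \<tau>) = 0"
    using integral_nonneg_AE[OF gap_nonneg] by linarith
  then have "AE \<tau> in M. ?e \<tau> * gap \<tau> = 0"
    using integral_nonneg_eq_0_iff_AE[OF igap gap_nonneg] by blast
  then show ?thesis using hu
  proof eventually_elim
    case (elim \<tau>)
    then have eq: "h0 (u \<tau>) = ereal (inner (u \<tau>) (?v \<tau>) - k (?v \<tau>))" by (simp add: gap_eq)
    have "h0 (u \<tau>) + ereal (inner (?v \<tau>) (w - u \<tau>)) \<le> h0 w" for w
      using conjugate_ge[OF h_conj, of w "?v \<tau>"] h_noninf[of w] unfolding eq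
      by (cases "h0 w") (auto simp: inner_diff_left inner_diff_right inner_commute)
    then show ?case by (simp add: subdifferential_def)
  qed
qed

text \<open>A couple prescribes the state on \<open>[t, T)\<close>, while the costate integral includes the end point \<open>T\<close>.\<close>

lemma costate_cong:
  assumes "\<And>\<sigma>. \<sigma> \<in> {t..<T} \<Longrightarrow> \<gamma> \<sigma> = \<gamma>' \<sigma>" and "\<tau> \<in> {t..T}"
  shows "costate \<gamma> \<tau> = costate \<gamma>' \<tau>"
  unfolding costate_def by (rule integral_spike[of "{T}"]) (use assms in auto)

theorem optimal_iff_extremal:
  assumes u: "u \<in> Lspace_weighted p lam t T" and y: "y \<in> L1_loc t T" and q: "0 < q"
  shows "optimal_couple S B g0 h0 lam p T t x u y \<longleftrightarrow> extremal_couple pr S B g0 h0 lam p q T t x u y"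
proof
  let ?\<pi> = "costate (\<lambda>\<tau>. Dg (traj x u \<tau>))"
  have ub: "bochner_integrable M u" by (rule Lspace_weighted_bochner_integrable[OF u p])
  have \<pi>_y: "costate (\<lambda>\<tau>. Dg (y \<tau>)) \<tau> = ?\<pi> \<tau>"
    if "\<And>\<tau>. \<tau> \<in> {t..<T} \<Longrightarrow> y \<tau> = traj x u \<tau>" "\<tau> \<in> {t..T}" for \<tau>
    by (rule costate_cong) (use that in auto)
  {
    assume opt: "optimal_couple S B g0 h0 lam p T t x u y"
    then have yt: "\<And>\<tau>. \<tau> \<in> {t..<T} \<Longrightarrow> y \<tau> = traj x u \<tau>" by (simp add: optimal_couple_def)
    have "?\<pi> \<in> Lspace_weighted q lam t T"
      by (intro Lspace_weighted_continuous continuous_on_costate continuous_on_Dg_trajectory ub q)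
    moreover have "AE \<tau> in lebesgue_on {t..<T}. - control_adjoint pr B (?\<pi> \<tau>) \<in> subdifferential h0 (u \<tau>)"
      unfolding AE_lebesgue_on_Ico_iff_Icc
      by (rule optimal_imp_subdifferential[OF u]) (use opt in \<open>simp add: optimal_couple_def\<close>)
    ultimately show "extremal_couple pr S B g0 h0 lam p q T t x u y"
      unfolding extremal_couple_def costate_def[symmetric]
      using u y yt \<pi>_y[OF yt] by (intro conjI bexI[of _ ?\<pi>] ballI) simp_all
  next
    assume "extremal_couple pr S B g0 h0 lam p q T t x u y"
    then obtain \<pi> where yt: "\<And>\<tau>. \<tau> \<in> {t..<T} \<Longrightarrow> y \<tau> = traj x u \<tau>"
      and \<pi>: "\<And>\<tau>. \<tau> \<in> {t..T} \<Longrightarrow> \<pi> \<tau> = costate (\<lambda>\<tau>. Dg (y \<tau>)) \<tau>"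
      and sub: "AE \<tau> in lebesgue_on {t..<T}. - control_adjoint pr B (\<pi> \<tau>) \<in> subdifferential h0 (u \<tau>)"
      unfolding extremal_couple_def costate_def[symmetric] by blast
    have "AE \<tau> in M. switching x u \<tau> \<in> subdifferential h0 (u \<tau>)"
      using sub[unfolded AE_lebesgue_on_Ico_iff_Icc] AE_space
    proof eventually_elim
      case (elim \<tau>)
      then have \<tau>: "\<tau> \<in> {t..T}" by simp
      have "\<pi> \<tau> = ?\<pi> \<tau>" using \<pi>[OF \<tau>] \<pi>_y[OF yt \<tau>] by (rule trans)
      with elim(1) show ?case by simp
    qed
    then show "optimal_couple S B g0 h0 lam p T t x u y"
      using u yt subdifferential_imp_cost_le[OF ub Lspace_weighted_bochner_integrable[OF _ p]]
      by (simp add: optimal_couple_def)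
  }
qed

end

theorem theorem4p7:
  fixes pr :: "'v::{real_inner, complete_space} \<Rightarrow> 'w::{real_inner, complete_space} \<Rightarrow> real"
    and D :: "'w set" and A :: "'w \<Rightarrow> 'w" and S :: "real \<Rightarrow> 'w \<Rightarrow>\<^sub>L 'w"
    and B :: "'u::{real_inner, complete_space} \<Rightarrow>\<^sub>L 'w"
    and g0 :: "'w \<Rightarrow> real" and h0 :: "'u \<Rightarrow> ereal"
    and \<omega> a b p q lam t T :: real and x :: 'w
    and u :: "real \<Rightarrow> 'u" and y :: "real \<Rightarrow> 'w"
  assumes "dual_pairing pr"
    and hyp1: "generates_semigroup D A S"
    and hyp3: "\<omega> \<ge> 0" "\<forall>\<tau>\<ge>0. \<forall>z. norm (blinfun_apply (S \<tau>) z) \<le> exp (\<omega> * \<tau>) * norm z"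
    and hyp4: "g0 \<in> Sigma0"
    and hyp5: "\<forall>v. h0 v \<noteq> -\<infinity>" "convex_ereal h0" "lower_semicontinuous h0"
              "\<forall>u1 u2. u1 \<noteq> u2 \<longrightarrow> subdifferential h0 u1 \<inter> subdifferential h0 u2 = {}"
    and hyp6: "convex_conjugate h0 0 = 0"
              "\<exists>k \<in> Sigma0. \<forall>v. convex_conjugate h0 v = ereal (k v)"
    and hyp7: "a > 0" "p \<ge> 2" "\<forall>v. h0 v \<ge> ereal (a * norm v powr p + b)"
    and "1 / p + 1 / q = 1"
    and "lam > 2 * \<omega>"
    and "t \<ge> 0" "t < T"
    and "u \<in> Lspace_weighted p lam t T" "y \<in> L1_loc t T"
  shows "optimal_couple S B g0 h0 lam p T t x u y \<longleftrightarrow>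
         extremal_couple pr S B g0 h0 lam p q T t x u y"
proof -
  obtain g' L where g: "\<And>z. (g0 has_derivative blinfun_apply (g' z)) (at z)" "L-lipschitz_on UNIV g'"
    using hyp4 unfolding Sigma0_def C1_Lip_def by blast
  obtain k where k: "k \<in> Sigma0" "\<And>v. convex_conjugate h0 v = ereal (k v)" using hyp6(2) by blast
  then obtain k' L' where k': "\<And>v. (k has_derivative blinfun_apply (k' v)) (at v)" "L'-lipschitz_on UNIV k'"
    unfolding Sigma0_def C1_Lip_def by blast
  have "k 0 = 0" using hyp6(1) k(2)[of 0] by simp
  interpret convex_control pr S B \<omega> lam t T g0 g' L h0 k k' L' p
    by unfold_locales
      (use assms g k(2) k' \<open>k 0 = 0\<close> in \<open>auto simp: generates_semigroup_def Sigma0_def\<close>)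
  have "1 / p < 1" using hyp7(2) by simp
  then have "0 < 1 / q" using \<open>1 / p + 1 / q = 1\<close> by linarith
  then have "0 < q" by simp
  with \<open>u \<in> Lspace_weighted p lam t T\<close> \<open>y \<in> L1_loc t T\<close> show ?thesis by (rule optimal_iff_extremal)
qed

end
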